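(* Let $W$ be a real analytic planar 3-web defined on a neighborhood of a point $M$, and suppose $W$ is non-flat near $M$. Then either $W$ has only the identity $Id$ as simple symmetry around $M$, or it has exactly two simple symmetries around $M$, namely $Id$ and $\phi$, where $\phi$ is a non-trivial involution ($\phi^2=Id$, and the linear part of $\phi$ at $M$ is $-Id$). Moreover, $W$ has exactly two simple symmetries around $M$ if and only if its normal form $(x,y,\,x+y+xy(x-y)g(x,y))$ near $M$ is such that $g(x,y)=g(-x,-y)$ for every $x$ and $y$ (near the origin).
   Context: Everything is real analytic and local (germs at $M$). A planar 3-web is a triple of 1-dimensional, mutually transversal foliations on an open domain of the plane. A symmetry of $W$ around $M$ is a (germ at $M$ of a) local diffeomorphism of the plane which fixes $M$ and maps each foliation of $W$ to a (possibly different) foliation of $W$. A symmetry is called simple if it maps each of the three foliations to itself. Given local coordinates $(x,y)$ vanishing at $M$, $(x,y,f)$ denotes the 3-web whose foliations are $\{x=\text{constant}\}$, $\{y=\text{constant}\}$ and the level sets $\{f(x,y)=\text{constant}\}$. $W$ is flat near $M$ if there are local coordinates in which it is $(x,y,x+y)$; otherwise it is non-flat near $M$. It is known that there always exist local coordinates $(x,y)$ vanishing at $M$ in which $W$ is $(x,y,f)$ with $f(x,y)=x+y+xy(x-y)g(x,y)$, $g$ analytic near the origin; this is called a normal form of $W$ near $M$. These coordinates are unique up to a homothety $(x,y)\mapsto(\lambda x,\lambda y)$, $\lambda\neq 0$ (once it is fixed which foliation plays the role of verticals, horizontals and level sets of $f$). $W$ is non-flat near $M$ if and only if $g$ does not vanish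 identically near the origin. *)

theory Defs
  imports "HOL-Analysis.Analysis"
begin

type_synonym plane = "real \<times> real"

type_synonym foliation = "plane set set"

type_synonym web = "foliation \<times> foliation \<times> foliation"

definition real_analytic_at :: "(plane \<Rightarrow> 'a::euclidean_space) \<Rightarrow> plane \<Rightarrow> bool" where
  "real_analytic_at f p \<longleftrightarrow>
     (\<exists>a r. r > 0 \<and>
        (\<forall>x y. \<bar>x\<bar> < r \<and> \<bar>y\<bar> < r \<longrightarrow>
           ((\<lambda>(i, j). (x ^ i * y ^ j) *\<^sub>R a i j) has_sum f (p + (x, y)))
             (UNIV :: (nat \<times> nat) set)))"

definition analytic_diffeo_on :: "(plane \<Rightarrow> plane) \<Rightarrow> plane set \<Rightarrow> bool" where
  "analytic_diffeo_on \<phi> A \<longleftrightarrow>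
     open A \<and> open (\<phi> ` A) \<and> inj_on \<phi> A \<and>
     (\<forall>p\<in>A. real_analytic_at \<phi> p) \<and>
     (\<forall>q\<in>\<phi> ` A. real_analytic_at (inv_into A \<phi>) q)"

definition local_diffeo_at :: "plane \<Rightarrow> (plane \<Rightarrow> plane) \<Rightarrow> bool" where
  "local_diffeo_at M \<phi> \<longleftrightarrow> (\<exists>A. M \<in> A \<and> analytic_diffeo_on \<phi> A)"

definition path_components :: "plane set \<Rightarrow> plane set set" where
  "path_components S = path_component_set S ` S"

(* The leaves of the restriction of a foliation to N are the components of the sets L \<inter> N for
   the intrinsic leaf topology.  Path components in the plane give exactly these: a continuous
   path in the plane that stays in L stays, locally, in one plaque of L.  Connected components
   would not do, since L need not be embedded. *)
definition restrict_foliation :: "foliation \<Rightarrow> plane set \<Rightarrow> foliation" where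
  "restrict_foliation F N = (\<Union>L\<in>F. path_components (L \<inter> N))"

definition level_foliation :: "(plane \<Rightarrow> real) \<Rightarrow> plane set \<Rightarrow> foliation" where
  "level_foliation u N = (\<Union>c. path_components {p \<in> N. u p = c})"

definition foliated_chart :: "foliation \<Rightarrow> plane set \<Rightarrow> (plane \<Rightarrow> plane) \<Rightarrow> bool" where
  "foliated_chart F V \<kappa> \<longleftrightarrow>
     V \<subseteq> \<Union>F \<and> analytic_diffeo_on \<kappa> V \<and>
     restrict_foliation F V = level_foliation (fst \<circ> \<kappa>) V"

definition foliation_on :: "plane set \<Rightarrow> foliation \<Rightarrow> bool" where
  "foliation_on U F \<longleftrightarrow>
     open U \<and> partition_on U F \<and> (\<forall>L\<in>F. path_connected L) \<and>
     (\<forall>p\<in>U. \<exists>V \<kappa>. p \<in> V \<and> foliated_chart F V \<kappa>)"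

(* The tangent line at p of the leaf through p: the preimage of the vertical direction under the
   differential of a foliated chart, which does not depend on the chart. *)
definition tangent_line :: "foliation \<Rightarrow> plane \<Rightarrow> plane set" where
  "tangent_line F p =
     {v. \<exists>V \<kappa> D. p \<in> V \<and> foliated_chart F V \<kappa> \<and> (\<kappa> has_derivative D) (at p) \<and> fst (D v) = 0}"

definition transversal_on :: "plane set \<Rightarrow> foliation \<Rightarrow> foliation \<Rightarrow> bool" where
  "transversal_on U F G \<longleftrightarrow> (\<forall>p\<in>U. tangent_line F p \<inter> tangent_line G p = {0})"

fun planar_3web_on :: "plane set \<Rightarrow> web \<Rightarrow> bool" where
  "planar_3web_on U (F, G, H) \<longleftrightarrow>
     foliation_on U F \<and> foliation_on U G \<and> foliation_on U H \<and>
     transversal_on U F G \<and> transversal_on U G H \<and> transversal_on U F H"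

definition maps_foliation_near ::
    "plane \<Rightarrow> (plane \<Rightarrow> plane) \<Rightarrow> foliation \<Rightarrow> foliation \<Rightarrow> bool" where
  "maps_foliation_near M \<phi> F G \<longleftrightarrow>
     (\<exists>N. M \<in> N \<and> N \<subseteq> \<Union>F \<and> analytic_diffeo_on \<phi> N \<and>
        image \<phi> ` restrict_foliation F N = restrict_foliation G (\<phi> ` N))"

fun web_foliations :: "web \<Rightarrow> foliation set" where
  "web_foliations (F, G, H) = {F, G, H}"

definition web_symmetry :: "plane \<Rightarrow> web \<Rightarrow> (plane \<Rightarrow> plane) \<Rightarrow> bool" where
  "web_symmetry M W \<phi> \<longleftrightarrow>
     local_diffeo_at M \<phi> \<and> \<phi> M = M \<and>
     (\<forall>F\<in>web_foliations W. \<exists>G\<in>web_foliations W. maps_foliation_near M \<phi> F G)"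

definition simple_symmetry :: "plane \<Rightarrow> web \<Rightarrow> (plane \<Rightarrow> plane) \<Rightarrow> bool" where
  "simple_symmetry M W \<phi> \<longleftrightarrow>
     web_symmetry M W \<phi> \<and> (\<forall>F\<in>web_foliations W. maps_foliation_near M \<phi> F F)"

definition germ :: "plane \<Rightarrow> (plane \<Rightarrow> plane) \<Rightarrow> (plane \<Rightarrow> plane) set" where
  "germ M \<phi> = {\<psi>. \<forall>\<^sub>F p in nhds M. \<psi> p = \<phi> p}"

definition simple_symmetry_germs :: "plane \<Rightarrow> web \<Rightarrow> (plane \<Rightarrow> plane) set set" where
  "simple_symmetry_germs M W = germ M ` {\<phi>. simple_symmetry M W \<phi>}"

definition local_coordinates_at :: "plane \<Rightarrow> (plane \<Rightarrow> plane) \<Rightarrow> bool" where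
  "local_coordinates_at M \<psi> \<longleftrightarrow> local_diffeo_at M \<psi> \<and> \<psi> M = (0, 0)"

(* Near M, in the local coordinates \<psi> = (x, y), the web is (x, y, f). *)
fun web_in_coordinates ::
    "plane \<Rightarrow> web \<Rightarrow> (plane \<Rightarrow> plane) \<Rightarrow> (plane \<Rightarrow> real) \<Rightarrow> bool" where
  "web_in_coordinates M (F, G, H) \<psi> f \<longleftrightarrow>
     (\<exists>N. M \<in> N \<and> analytic_diffeo_on \<psi> N \<and>
        restrict_foliation F N = level_foliation (fst \<circ> \<psi>) N \<and>
        restrict_foliation G N = level_foliation (snd \<circ> \<psi>) N \<and>
        restrict_foliation H N = level_foliation (f \<circ> \<psi>) N)"

definition flat_near :: "plane \<Rightarrow> web \<Rightarrow> bool" where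
  "flat_near M W \<longleftrightarrow>
     (\<exists>\<psi>. local_coordinates_at M \<psi> \<and> web_in_coordinates M W \<psi> (\<lambda>(x, y). x + y))"

definition normal_form ::
    "plane \<Rightarrow> web \<Rightarrow> (plane \<Rightarrow> plane) \<Rightarrow> (plane \<Rightarrow> real) \<Rightarrow> bool" where
  "normal_form M W \<psi> g \<longleftrightarrow>
     local_coordinates_at M \<psi> \<and> real_analytic_at g (0, 0) \<and>
     web_in_coordinates M W \<psi> (\<lambda>(x, y). x + y + x * y * (x - y) * g (x, y))"

end

theory Submission
  imports Defs "HOL-Complex_Analysis.Complex_Analysis"
begin

text \<open>In a normal form $f = x + y + xy(x-y)g$ one has $f(x,0) = f(0,x) = x$ and $f(x,x) = 2x$. A simple
  symmetry acts as $(a(x), b(y))$ and maps level sets of $f$ to level sets of $f$, so these relations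
  force $a = b$ and $a(2x) = 2a(x)$, hence $a(x) = \<theta>x$ by differentiability at $0$. Then
  $f(\<theta>q) = \<theta>f(q)$ means $\<theta>^2 g(\<theta>q) = g(q)$, and iterating this contraction (or its inverse) gives $g = 0$
  unless $\<theta> = 1$, or $\<theta> = -1$ and $g$ is even.

  A normal form exists because coordinates can be chosen such that $h(x,0) = h(0,x) = x$ for a
  first integral $h$ of the third foliation. Then $s(x) = h(x,x)$ has multiplier $2$ at $0$, and the Koenigs
  linearization $A \<circ> s = 2A$ changes $h$ into a function that satisfies also $f(x,x) = 2x$;
  the difference $f - x - y$ is divisible by $xy(x-y)$.

  Analyticity is handled by continuously complex differentiable extensions to open sets of $\<complex>^2$: these are stable
  under composition by the chain rule and under inversion by the inverse function theorem, and Cauchy's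
  integral formula in each variable recovers the power series.\<close>

section \<open>Holomorphic functions of two variables\<close>

text \<open>A symmetry acts on leaves, that is, on path components of level sets, and not on values
  of first integrals; moreover each of the three foliations comes with its own neighbourhood of M.
  The link between leaves and values is therefore settled separately, as an implication between
  equalities of values on a small common neighbourhood. The rigidity argument works with such
  implications alone, applied to points of the axes, of the diagonal and of a small box around the
  origin. It is the computation behind the uniqueness of normal coordinates up to homothety, carried
  out for the symmetry itself. The complex extensions carry continuous partial derivatives because
  the inverse function theorem and differentiation under Cauchy's integral both ask for them. Real
  functions are recovered as real parts of extensions on the real plane.\<close>

definition hol2_on :: "(complex \<times> complex) set \<Rightarrow> (complex \<times> complex \<Rightarrow> complex) \<Rightarrow> bool" where
  "hol2_on S H \<longleftrightarrow>
     (\<exists>Hz Hw. continuous_on S Hz \<and> continuous_on S Hw \<and>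
        (\<forall>p\<in>S. (H has_derivative (\<lambda>h. Hz p * fst h + Hw p * snd h)) (at p)))"

lemma hol2_onI:
  assumes "continuous_on S Hz" "continuous_on S Hw"
    and "\<And>p. p \<in> S \<Longrightarrow> (H has_derivative (\<lambda>h. Hz p * fst h + Hw p * snd h)) (at p)"
  shows "hol2_on S H"
  using assms unfolding hol2_on_def by blast

lemma hol2_on_subset: "hol2_on S H \<Longrightarrow> T \<subseteq> S \<Longrightarrow> hol2_on T H"
  unfolding hol2_on_def by (meson continuous_on_subset subset_iff)

lemma hol2_on_imp_continuous_on: "hol2_on S H \<Longrightarrow> continuous_on S H"
  unfolding hol2_on_def
  by (meson continuous_at_imp_continuous_on has_derivative_continuous)

text \<open>This is the majorant of the double series that results from Cauchy's inequality in each
  variable.\<close>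

lemma summable_on_geometric2:
  fixes x y :: real
  assumes "0 \<le> x" "x < 1" "0 \<le> y" "y < 1"
  shows "(\<lambda>(i::nat, j::nat). x ^ i * y ^ j) summable_on UNIV"
proof -
  have g: "((\<lambda>n. t ^ n) has_sum (1 / (1 - t))) (UNIV :: nat set)" if "0 \<le> t" "t < 1" for t :: real
    using that by (intro sums_nonneg_imp_has_sum geometric_sums) auto
  have "(\<lambda>(i::nat, j::nat). x ^ i * y ^ j) summable_on Sigma UNIV (\<lambda>_. UNIV)"
  proof (rule summable_on_SigmaI)
    show "((\<lambda>j. case (i, j) of (i, j) \<Rightarrow> x ^ i * y ^ j) has_sum (x ^ i * (1 / (1 - y)))) UNIV"
      for i :: nat
      using has_sum_cmult_right[OF g[OF assms(3,4)], of "x ^ i"] by simp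
    show "(\<lambda>i. x ^ i * (1 / (1 - y))) summable_on (UNIV :: nat set)"
      using has_sum_cmult_left[OF g[OF assms(1,2)], of "1 / (1 - y)"]
      by (rule has_sum_imp_summable)
  qed (use assms in auto)
  then show ?thesis by (simp add: UNIV_Times_UNIV[symmetric] del: UNIV_Times_UNIV)
qed

text \<open>The expansion is made in w first. Its coefficients are Cauchy integrals over a circle,
  hence holomorphic in z, and are expanded in z in turn. Cauchy's inequality, applied twice, bounds
  the coefficients by \<open>M / r ^ j / r ^ i\<close>, so the double series converges absolutely on
  the bidisc of radius r and equals the iterated one.\<close>

lemma hol2_on_power_series:
  assumes hol: "hol2_on (ball 0 R \<times> ball 0 R) H" and r: "0 < r" "r < R"
  obtains a where "\<And>z w. norm z < r \<Longrightarrow> norm w < r \<Longrightarrow>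
     ((\<lambda>(i, j). z ^ i * w ^ j * a i j) has_sum H (z, w)) UNIV"
proof -
  obtain Hz Hw where Hz: "continuous_on (ball 0 R \<times> ball 0 R) Hz"
    and der: "\<And>p. p \<in> ball 0 R \<times> ball 0 R \<Longrightarrow>
            (H has_derivative (\<lambda>h. Hz p * fst h + Hw p * snd h)) (at p)"
    using hol unfolding hol2_on_def by blast
  have contH: "continuous_on (ball 0 R \<times> ball 0 R) H"
    using hol by (rule hol2_on_imp_continuous_on)
  have derz: "((\<lambda>z. H (z, w)) has_field_derivative Hz (z, w)) (at z within U)"
    if "norm z < R" "norm w < R" for z w U
  proof -
    have "((\<lambda>z. H (z, w)) has_derivative (\<lambda>h. Hz (z, w) * fst (h, 0::complex) + Hw (z, w) * snd (h, 0::complex))) (at z)"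
      by (rule has_derivative_compose[where f = "\<lambda>z. (z, w)" and g = H, OF _ der])
         (use that in \<open>auto intro!: derivative_eq_intros\<close>)
    then have "((\<lambda>z. H (z, w)) has_field_derivative Hz (z, w)) (at z)"
      by (simp add: has_field_derivative_def)
    then show ?thesis by (rule has_field_derivative_at_within)
  qed
  have derw: "((\<lambda>w. H (z, w)) has_field_derivative Hw (z, w)) (at w within U)"
    if "norm z < R" "norm w < R" for z w U
  proof -
    have "((\<lambda>w. H (z, w)) has_derivative (\<lambda>h. Hz (z, w) * fst (0::complex, h) + Hw (z, w) * snd (0::complex, h))) (at w)"
      by (rule has_derivative_compose[where f = "\<lambda>w. (z, w)" and g = H, OF _ der])
         (use that in \<open>auto intro!: derivative_eq_intros\<close>)
    then have "((\<lambda>w. H (z, w)) has_field_derivative Hw (z, w)) (at w)"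
      by (simp add: has_field_derivative_def)
    then show ?thesis by (rule has_field_derivative_at_within)
  qed
  have holw: "(\<lambda>w. H (z, w)) holomorphic_on ball 0 R" if "norm z < R" for z
    using derw[OF that] unfolding holomorphic_on_def field_differentiable_def by (metis mem_ball_0)
  have holr: "f holomorphic_on ball 0 r" "continuous_on (cball 0 r) f" if "f holomorphic_on ball 0 R" for f
    using that r by (auto intro!: holomorphic_on_imp_continuous_on elim: holomorphic_on_subset)
  have sub: "cball 0 r \<times> cball 0 r \<subseteq> ball (0::complex) R \<times> ball (0::complex) R"
    using r by auto
  have "bounded (H ` (cball 0 r \<times> cball 0 r))"
    by (intro compact_imp_bounded compact_continuous_image continuous_on_subset[OF contH sub]
        compact_Times compact_cball)
  then obtain M where "\<And>x. x \<in> H ` (cball 0 r \<times> cball 0 r) \<Longrightarrow> norm x \<le> M"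
    unfolding bounded_iff by blast
  then have M: "\<And>z w. norm z \<le> r \<Longrightarrow> norm w \<le> r \<Longrightarrow> norm (H (z, w)) \<le> M"
    by simp
  define c where "c j z = (deriv ^^ j) (\<lambda>w. H (z, w)) 0 / fact j" for j z
  have c_sums: "(\<lambda>j. c j z * w ^ j) sums H (z, w)" if "norm z < R" "norm w < R" for z w
    using holomorphic_power_series[OF holw[OF that(1)], of w] that by (simp add: c_def)
  have c_bound: "norm (c j z) \<le> M / r ^ j" if "norm z \<le> r" for j z
  proof -
    have "norm ((deriv ^^ j) (\<lambda>w. H (z, w)) 0) \<le> fact j * M / r ^ j"
      by (rule Cauchy_inequality) (use r that M holr[OF holw, of z] in auto)
    then show ?thesis by (simp add: c_def norm_divide field_simps)
  qed
  have c_hol: "c j holomorphic_on ball 0 R" for j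
  proof -
    let ?g = "circlepath 0 r"
    \<comment> \<open>With the velocity of the circle put into the kernel, the contour integral
      becomes an ordinary integral over the unit interval, where differentiation under the integral
      sign applies.\<close>
    let ?k = "\<lambda>t. vector_derivative ?g (at t) / ?g t ^ Suc j"
    have g: "norm (?g t) = r" for t
      using r by (simp add: circlepath norm_mult)
    have contg: "continuous_on UNIV ?g"
      unfolding circlepath_def part_circlepath_def linepath_def by (intro continuous_intros)
    have contk: "continuous_on UNIV ?k"
      unfolding vector_derivative_circlepath
      by (intro continuous_intros contg) (metis g norm_zero order_less_irrefl power_not_zero r(1))
    have "(\<lambda>z. integral (cbox 0 1) (\<lambda>t. H (z, ?g t) * ?k t)) holomorphic_on ball 0 R"
    proof (rule leibniz_rule_holomorphic)
      show "((\<lambda>z. H (z, ?g t) * ?k t) has_field_derivative Hz (z, ?g t) * ?k t) (at z within ball 0 R)"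
        if "z \<in> ball 0 R" for z t
        using that r g by (intro DERIV_cmult_right derz) auto
      show "(\<lambda>t. H (z, ?g t) * ?k t) integrable_on cbox 0 1" if "z \<in> ball 0 R" for z
        using that r g
        by (intro integrable_continuous continuous_intros continuous_on_subset[OF contk]
             continuous_on_compose2[OF contH] continuous_on_subset[OF contg]) auto
      show "continuous_on (ball 0 R \<times> cbox 0 1) (\<lambda>(z, t). Hz (z, ?g t) * ?k t)"
        unfolding case_prod_unfold using r g
        by (intro continuous_intros continuous_on_compose2[OF contk]
             continuous_on_compose2[OF Hz] continuous_on_compose2[OF contg]) auto
    qed simp
    then have "(\<lambda>z. integral (cbox 0 1) (\<lambda>t. H (z, ?g t) * ?k t) / (2 * pi * \<i>)) holomorphic_on ball 0 R"
      by (intro holomorphic_intros) auto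
    moreover have "integral (cbox 0 1) (\<lambda>t. H (z, ?g t) * ?k t) / (2 * pi * \<i>) = c j z"
      if "z \<in> ball 0 R" for z
    proof -
      have "((\<lambda>u. H (z, u) / (u - 0) ^ Suc j) has_contour_integral
           2 * pi * \<i> / fact j * (deriv ^^ j) (\<lambda>w. H (z, w)) 0) ?g"
        by (rule Cauchy_has_contour_integral_higher_derivative_circlepath)
           (use r that holr[OF holw, of z] in auto)
      then have "contour_integral ?g (\<lambda>u. H (z, u) / u ^ Suc j) = 2 * pi * \<i> * c j z"
        by (simp add: c_def contour_integral_unique)
      then show ?thesis by (simp add: contour_integral_integral)
    qed
    ultimately show ?thesis by (rule holomorphic_transform)
  qed
  define a where "a i j = (deriv ^^ i) (c j) 0 / fact i" for i j
  have a_bound: "norm (a i j) \<le> M / r ^ j / r ^ i" for i j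
  proof -
    have "norm ((deriv ^^ i) (c j) 0) \<le> fact i * (M / r ^ j) / r ^ i"
      by (rule Cauchy_inequality[OF holr[OF c_hol]]) (use r c_bound in auto)
    then show ?thesis by (simp add: a_def norm_divide field_simps)
  qed
  have a_sums: "(\<lambda>i. a i j * z ^ i) sums c j z" if "norm z < R" for z j
    using holomorphic_power_series[OF c_hol, of z] that by (simp add: a_def)
  have "((\<lambda>(i, j). z ^ i * w ^ j * a i j) has_sum H (z, w)) UNIV"
    if zw: "norm z < r" "norm w < r" for z w
  proof -
    define x where "x = norm z / r"
    define y where "y = norm w / r"
    have xy: "0 \<le> x" "x < 1" "0 \<le> y" "y < 1" using zw r by (auto simp: x_def y_def)
    have bd: "norm (z ^ i * w ^ j * a i j) \<le> M * (x ^ i * y ^ j)" for i j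
    proof -
      have "norm (z ^ i * w ^ j * a i j) \<le> norm z ^ i * norm w ^ j * (M / r ^ j / r ^ i)"
        unfolding norm_mult norm_power by (intro mult_left_mono a_bound) simp
      also have "\<dots> = M * (x ^ i * y ^ j)" by (simp add: x_def y_def field_simps)
      finally show ?thesis .
    qed
    have sg: "(\<lambda>(i, j). M * (x ^ i * y ^ j)) summable_on UNIV"
      using summable_on_cmult_right[OF summable_on_geometric2[OF xy], of M] by (simp add: case_prod_unfold)
    have summ: "(\<lambda>(i, j). z ^ i * w ^ j * a i j) summable_on UNIV"
      by (rule abs_summable_summable, rule Infinite_Sum.abs_summable_on_comparison_test'[OF sg])
         (simp only: case_prod_unfold bd)
    \<comment> \<open>The exponent of z is the first index, but the sum over it is the inner one;
      the indices are interchanged for the iterated sum and back again at the end.\<close>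
    have bij: "bij_betw prod.swap (UNIV :: (nat \<times> nat) set) UNIV" by simp
    have summ': "(\<lambda>(j, i). z ^ i * w ^ j * a i j) summable_on Sigma UNIV (\<lambda>_. UNIV)"
      using summ summable_on_reindex_bij_betw[OF bij, of "\<lambda>(i, j). z ^ i * w ^ j * a i j"]
      by (simp add: case_prod_unfold)
    have zR: "norm z < R" "norm w < R" using zw r by auto
    have inner: "((\<lambda>i. case (j, i) of (j, i) \<Rightarrow> z ^ i * w ^ j * a i j) has_sum c j z * w ^ j) UNIV" for j
    proof -
      have "(\<lambda>i. z ^ i * w ^ j * a i j) summable_on UNIV"
        using summable_on_SigmaD1[OF summ', of j] by simp
      moreover have "(\<lambda>i. z ^ i * w ^ j * a i j) sums (c j z * w ^ j)"
        using sums_mult2[OF a_sums[OF zR(1), of j], of "w ^ j"] by (simp add: mult_ac)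
      ultimately have "((\<lambda>i. z ^ i * w ^ j * a i j) has_sum c j z * w ^ j) UNIV"
        using has_sum_imp_sums has_sum_infsum sums_unique2 by metis
      then show ?thesis by simp
    qed
    \<comment> \<open>The inner sums are \<open>c j z * w ^ j\<close>, and their sum over j is
      already known to be \<open>H (z, w)\<close>; this identifies the value of the double
      sum.\<close>
    have tot: "((\<lambda>(j, i). z ^ i * w ^ j * a i j) has_sum infsum (\<lambda>(j, i). z ^ i * w ^ j * a i j) (Sigma UNIV (\<lambda>_. UNIV))) (Sigma UNIV (\<lambda>_. UNIV))"
      using summ' by (rule has_sum_infsum)
    have "((\<lambda>j. c j z * w ^ j) has_sum infsum (\<lambda>(j, i). z ^ i * w ^ j * a i j) (Sigma UNIV (\<lambda>_. UNIV))) UNIV"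
      by (rule has_sum_SigmaD[OF tot]) (use inner in auto)
    then have "infsum (\<lambda>(j, i). z ^ i * w ^ j * a i j) (Sigma UNIV (\<lambda>_. UNIV)) = H (z, w)"
      using has_sum_imp_sums sums_unique2 c_sums[OF zR] by blast
    with tot have "((\<lambda>(j, i). z ^ i * w ^ j * a i j) has_sum H (z, w)) UNIV" by simp
    then show ?thesis
      using has_sum_reindex_bij_betw[OF bij, of "\<lambda>(i, j). z ^ i * w ^ j * a i j"]
      by (simp add: case_prod_unfold)
  qed
  then show ?thesis using that by blast
qed

lemma norm_linear_form_le:
  fixes a b :: "'a::real_normed_algebra"
  assumes "norm a \<le> c" "norm b \<le> d"
  shows "norm (a * fst h + b * snd h) \<le> (c + d) * norm h"
proof -
  have "norm (a * fst h) \<le> c * norm h"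
    using assms(1) norm_fst_le[of "fst h" "snd h"]
    by (intro order_trans[OF norm_mult_ineq] mult_mono) (auto intro: order_trans[OF norm_ge_zero])
  moreover have "norm (b * snd h) \<le> d * norm h"
    using assms(2) norm_snd_le[of "snd h" "fst h"]
    by (intro order_trans[OF norm_mult_ineq] mult_mono) (auto intro: order_trans[OF norm_ge_zero])
  ultimately show ?thesis
    by (simp add: distrib_right norm_triangle_mono)
qed

text \<open>A double power series enumerated as a single one: with arbitrary exponent sequences i
  and j the theorem on termwise differentiation of an ordinary series applies. Absolute convergence
  at radius \<rho> dominates the differentiated series on every smaller bidisc.\<close>

lemma hol2_on_suminf_monomials:
  fixes c :: "nat \<Rightarrow> complex" and i j :: "nat \<Rightarrow> nat"
  assumes \<rho>: "0 < \<rho>" and summ: "summable (\<lambda>n. norm (c n) * \<rho> ^ i n * \<rho> ^ j n)"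
  shows "hol2_on (ball 0 \<rho> \<times> ball 0 \<rho>) (\<lambda>(z, w). \<Sum>n. c n * z ^ i n * w ^ j n)"
proof -
  let ?F = "\<lambda>n p. c n * fst p ^ i n * snd p ^ j n"
  let ?Fz = "\<lambda>n p. c n * (of_nat (i n) * fst p ^ (i n - 1)) * snd p ^ j n"
  let ?Fw = "\<lambda>n p. c n * fst p ^ i n * (of_nat (j n) * snd p ^ (j n - 1))"
  define G where "G p = (\<Sum>n. ?F n p)" for p
  define Gz where "Gz p = (\<Sum>n. ?Fz n p)" for p
  define Gw where "Gw p = (\<Sum>n. ?Fw n p)" for p
  have main: "continuous_on (ball 0 r \<times> ball 0 r) Gz \<and> continuous_on (ball 0 r \<times> ball 0 r) Gw \<and>
      (\<forall>p\<in>ball 0 r \<times> ball 0 r. (G has_derivative (\<lambda>h. Gz p * fst h + Gw p * snd h)) (at p))"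
    if r: "0 < r" "r < \<rho>" for r
  proof -
    let ?S = "ball (0::complex) r \<times> ball (0::complex) r"
    \<comment> \<open>The factor n produced by differentiation is absorbed by the passage from
      \<rho> to the smaller radius r, at the price of a constant K.\<close>
    have "(\<lambda>n. real n * (r / \<rho>) ^ n) \<longlonglongrightarrow> 0"
      using r by (intro powser_times_n_limit_0) auto
    then have "Bseq (\<lambda>n. real n * (r / \<rho>) ^ n)"
      by (meson convergentI convergent_imp_Bseq)
    then obtain K where K: "0 < K" "\<And>n. norm (real n * (r / \<rho>) ^ n) \<le> K"
      by (auto elim: BseqE)
    have K': "real n * r ^ (n - 1) \<le> K / r * \<rho> ^ n" for n
    proof (cases n)
      case (Suc m)
      have "real n * r ^ n \<le> K * \<rho> ^ n"
        using K(2)[of n] r by (simp add: power_divide field_simps)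
      then show ?thesis using r Suc by (simp add: field_simps)
    qed (use K r in auto)
    have le: "norm z ^ n \<le> \<rho> ^ n" if "z \<in> ball 0 r" for z :: complex and n
      using that r by (intro power_mono) auto
    have le': "real n * norm z ^ (n - 1) \<le> K / r * \<rho> ^ n" if "z \<in> ball 0 r" for z :: complex and n
      using that r by (intro order_trans[OF _ K'] mult_left_mono power_mono) auto
    define B where "B n = K / r * (norm (c n) * \<rho> ^ i n * \<rho> ^ j n)" for n
    have B: "summable B" unfolding B_def using summ by (rule summable_mult)
    have Bz: "norm (?Fz n p) \<le> B n" if "p \<in> ?S" for n p
    proof -
      have "norm (?Fz n p) = norm (c n) * (real (i n) * norm (fst p) ^ (i n - 1)) * norm (snd p) ^ j n"
        by (simp add: norm_mult norm_power)
      also have "\<dots> \<le> norm (c n) * (K / r * \<rho> ^ i n) * \<rho> ^ j n"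
        using that r K by (intro mult_mono le le' mult_nonneg_nonneg) auto
      finally show ?thesis by (simp add: B_def mult_ac)
    qed
    have Bw: "norm (?Fw n p) \<le> B n" if "p \<in> ?S" for n p
    proof -
      have "norm (?Fw n p) = norm (c n) * norm (fst p) ^ i n * (real (j n) * norm (snd p) ^ (j n - 1))"
        by (simp add: norm_mult norm_power)
      also have "\<dots> \<le> norm (c n) * \<rho> ^ i n * (K / r * \<rho> ^ j n)"
        using that r K by (intro mult_mono le le' mult_nonneg_nonneg) auto
      finally show ?thesis by (simp add: B_def mult_ac)
    qed
    have uz: "uniform_limit ?S (\<lambda>n p. \<Sum>k<n. ?Fz k p) Gz sequentially"
      unfolding Gz_def[abs_def] by (rule Weierstrass_m_test[OF Bz B])
    have uw: "uniform_limit ?S (\<lambda>n p. \<Sum>k<n. ?Fw k p) Gw sequentially"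
      unfolding Gw_def[abs_def] by (rule Weierstrass_m_test[OF Bw B])
    have "continuous_on ?S Gz"
      by (rule uniform_limit_theorem[OF _ uz]) (auto intro!: always_eventually continuous_intros)
    moreover have "continuous_on ?S Gw"
      by (rule uniform_limit_theorem[OF _ uw]) (auto intro!: always_eventually continuous_intros)
    moreover have "(G has_derivative (\<lambda>h. Gz p * fst h + Gw p * snd h)) (at p)" if p: "p \<in> ?S" for p
    proof -
      have "\<exists>g. \<forall>p\<in>?S. (\<lambda>n. ?F n p) sums (g p) \<and>
              (g has_derivative (\<lambda>h. Gz p * fst h + Gw p * snd h)) (at p within ?S)"
      proof (rule has_derivative_series)
        show "convex ?S" by (intro convex_Times convex_ball)
        show "(?F n has_derivative (\<lambda>h. ?Fz n p * fst h + ?Fw n p * snd h)) (at p within ?S)" for n p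
          by (auto intro!: derivative_eq_intros simp: algebra_simps)
        show "\<forall>\<^sub>F n in sequentially. \<forall>p\<in>?S. \<forall>h. norm ((\<Sum>k<n. ?Fz k p * fst h + ?Fw k p * snd h) -
                 (Gz p * fst h + Gw p * snd h)) \<le> e * norm h" if e: "e > 0" for e
        proof -
          have "\<forall>\<^sub>F n in sequentially. \<forall>p\<in>?S. dist (\<Sum>k<n. ?Fz k p) (Gz p) < e / 2"
            using uniform_limitD[OF uz, of "e / 2"] e by simp
          moreover have "\<forall>\<^sub>F n in sequentially. \<forall>p\<in>?S. dist (\<Sum>k<n. ?Fw k p) (Gw p) < e / 2"
            using uniform_limitD[OF uw, of "e / 2"] e by simp
          ultimately show ?thesis
          proof eventually_elim
            case (elim n)
            show ?case
            proof (intro ballI allI)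
              fix p and h :: "complex \<times> complex" assume p: "p \<in> ?S"
              let ?a = "(\<Sum>k<n. ?Fz k p) - Gz p" and ?b = "(\<Sum>k<n. ?Fw k p) - Gw p"
              have "(\<Sum>k<n. ?Fz k p * fst h + ?Fw k p * snd h) - (Gz p * fst h + Gw p * snd h) =
                 ?a * fst h + ?b * snd h"
                by (simp add: sum.distrib sum_distrib_right left_diff_distrib)
              moreover have "norm ?a \<le> e / 2" "norm ?b \<le> e / 2"
                using bspec[OF elim(1) p] bspec[OF elim(2) p] by (simp_all only: dist_norm less_imp_le)
              ultimately show "norm ((\<Sum>k<n. ?Fz k p * fst h + ?Fw k p * snd h) -
                 (Gz p * fst h + Gw p * snd h)) \<le> e * norm h"
                using norm_linear_form_le[of ?a "e / 2" ?b "e / 2" h] by (simp only: field_sum_of_halves)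
            qed
          qed
        qed
        \<comment> \<open>Besides uniform convergence of the derivatives, convergence of the series
          at one point is required. At the origin only the terms with both exponents zero
          survive.\<close>
        show "0 \<in> ?S" using r by (simp add: zero_prod_def)
        have "norm (?F n 0) \<le> norm (c n) * \<rho> ^ i n * \<rho> ^ j n" for n
          using \<rho> by (auto simp: norm_mult norm_power power_0_left)
        then have "summable (\<lambda>n. ?F n 0)"
          by (rule summable_comparison_test'[OF summ])
        then show "(\<lambda>n. ?F n 0) sums (\<Sum>n. ?F n 0)" by (rule summable_sums)
      qed
      then obtain g where g: "\<And>p. p \<in> ?S \<Longrightarrow> (\<lambda>n. ?F n p) sums (g p)"
        "\<And>p. p \<in> ?S \<Longrightarrow> (g has_derivative (\<lambda>h. Gz p * fst h + Gw p * snd h)) (at p within ?S)"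
        by blast
      have "open ?S" by (intro open_Times open_ball)
      then have "(g has_derivative (\<lambda>h. Gz p * fst h + Gw p * snd h)) (at p)"
        using g(2)[OF p] by (simp only: at_within_open[OF p \<open>open ?S\<close>])
      then show ?thesis
        by (rule has_derivative_transform_within_open[OF _ \<open>open ?S\<close> p])
           (simp only: G_def sums_unique[OF g(1)])
    qed
    ultimately show ?thesis by (intro conjI ballI)
  qed
  \<comment> \<open>The bounds hold on smaller bidiscs only. Continuity and differentiability are
    local, and every point lies in such a bidisc.\<close>
  have ex: "\<exists>r. 0 < r \<and> r < \<rho> \<and> p \<in> ball 0 r \<times> ball 0 r" if "p \<in> ball 0 \<rho> \<times> ball 0 \<rho>" for p :: "complex \<times> complex"
  proof -
    have "max (norm (fst p)) (norm (snd p)) < \<rho>" using that by (simp add: mem_Times_iff)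
    then obtain r where r: "max (norm (fst p)) (norm (snd p)) < r" "r < \<rho>"
      using dense by blast
    have "0 \<le> max (norm (fst p)) (norm (snd p))" by (simp add: le_max_iff_disj)
    with r have "0 < r" by linarith
    then show ?thesis using r by (intro exI[of _ r]) (simp add: mem_Times_iff)
  qed
  have op: "open (ball (0::complex) r \<times> ball (0::complex) r)" for r by (intro open_Times open_ball)
  have "hol2_on (ball 0 \<rho> \<times> ball 0 \<rho>) G"
  proof (rule hol2_onI)
    show "continuous_on (ball 0 \<rho> \<times> ball 0 \<rho>) Gz"
    proof (rule continuous_at_imp_continuous_on, rule ballI)
      fix p :: "complex \<times> complex" assume "p \<in> ball 0 \<rho> \<times> ball 0 \<rho>"
      from ex[OF this] main show "isCont Gz p" using continuous_on_eq_continuous_at[OF op] by blast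
    qed
    show "continuous_on (ball 0 \<rho> \<times> ball 0 \<rho>) Gw"
    proof (rule continuous_at_imp_continuous_on, rule ballI)
      fix p :: "complex \<times> complex" assume "p \<in> ball 0 \<rho> \<times> ball 0 \<rho>"
      from ex[OF this] main show "isCont Gw p" using continuous_on_eq_continuous_at[OF op] by blast
    qed
    show "(G has_derivative (\<lambda>h. Gz p * fst h + Gw p * snd h)) (at p)" if "p \<in> ball 0 \<rho> \<times> ball 0 \<rho>" for p
      using ex[OF that] main by blast
  qed
  then show ?thesis by (simp add: G_def[abs_def] case_prod_unfold)
qed

section \<open>Real analytic functions on the plane\<close>

lemma hol2_on_const: "hol2_on S (\<lambda>_. c)"
  by (rule hol2_onI[where Hz = "\<lambda>_. 0" and Hw = "\<lambda>_. 0"]) auto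

lemma hol2_on_fst: "hol2_on S fst"
  by (rule hol2_onI[where Hz = "\<lambda>_. 1" and Hw = "\<lambda>_. 0"]) (auto intro!: derivative_eq_intros)

lemma hol2_on_snd: "hol2_on S snd"
  by (rule hol2_onI[where Hz = "\<lambda>_. 0" and Hw = "\<lambda>_. 1"]) (auto intro!: derivative_eq_intros)

lemma hol2_on_add:
  assumes "hol2_on S F" "hol2_on S G"
  shows "hol2_on S (\<lambda>p. F p + G p)"
proof -
  obtain Fz Fw Gz Gw where *: "continuous_on S Fz" "continuous_on S Fw" "continuous_on S Gz" "continuous_on S Gw"
    "\<And>p. p \<in> S \<Longrightarrow> (F has_derivative (\<lambda>h. Fz p * fst h + Fw p * snd h)) (at p)"
    "\<And>p. p \<in> S \<Longrightarrow> (G has_derivative (\<lambda>h. Gz p * fst h + Gw p * snd h)) (at p)"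
    using assms unfolding hol2_on_def by blast
  show ?thesis
    by (rule hol2_onI[where Hz = "\<lambda>p. Fz p + Gz p" and Hw = "\<lambda>p. Fw p + Gw p"])
       (auto intro!: continuous_intros derivative_eq_intros * simp: algebra_simps)
qed

lemma hol2_on_mult:
  assumes "hol2_on S F" "hol2_on S G"
  shows "hol2_on S (\<lambda>p. F p * G p)"
proof -
  obtain Fz Fw Gz Gw where *: "continuous_on S Fz" "continuous_on S Fw" "continuous_on S Gz" "continuous_on S Gw"
    "\<And>p. p \<in> S \<Longrightarrow> (F has_derivative (\<lambda>h. Fz p * fst h + Fw p * snd h)) (at p)"
    "\<And>p. p \<in> S \<Longrightarrow> (G has_derivative (\<lambda>h. Gz p * fst h + Gw p * snd h)) (at p)"
    using assms unfolding hol2_on_def by blast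
  note c = assms[THEN hol2_on_imp_continuous_on]
  show ?thesis
    by (rule hol2_onI[where Hz = "\<lambda>p. F p * Gz p + Fz p * G p" and Hw = "\<lambda>p. F p * Gw p + Fw p * G p"])
       (auto intro!: continuous_on_add continuous_on_mult derivative_eq_intros * c simp: algebra_simps)
qed

text \<open>By the chain rule the partial derivatives of the composite are sums of products of
  continuous functions, so the notion is stable without any handling of series.\<close>

lemma hol2_on_compose:
  assumes K: "hol2_on T K" and X: "hol2_on S X" and Y: "hol2_on S Y"
    and sub: "\<And>p. p \<in> S \<Longrightarrow> (X p, Y p) \<in> T"
  shows "hol2_on S (\<lambda>p. K (X p, Y p))"
proof -
  obtain Xz Xw where X': "continuous_on S Xz" "continuous_on S Xw"
    "\<And>p. p \<in> S \<Longrightarrow> (X has_derivative (\<lambda>h. Xz p * fst h + Xw p * snd h)) (at p)"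
    using X unfolding hol2_on_def by blast
  obtain Yz Yw where Y': "continuous_on S Yz" "continuous_on S Yw"
    "\<And>p. p \<in> S \<Longrightarrow> (Y has_derivative (\<lambda>h. Yz p * fst h + Yw p * snd h)) (at p)"
    using Y unfolding hol2_on_def by blast
  obtain Kz Kw where K': "continuous_on T Kz" "continuous_on T Kw"
    "\<And>p. p \<in> T \<Longrightarrow> (K has_derivative (\<lambda>h. Kz p * fst h + Kw p * snd h)) (at p)"
    using K unfolding hol2_on_def by blast
  have c: "continuous_on S X" "continuous_on S Y" using X Y by (auto intro: hol2_on_imp_continuous_on)
  let ?P = "\<lambda>p. (X p, Y p)"
  show ?thesis
  proof (rule hol2_onI[where Hz = "\<lambda>p. Kz (?P p) * Xz p + Kw (?P p) * Yz p"
                         and Hw = "\<lambda>p. Kz (?P p) * Xw p + Kw (?P p) * Yw p"])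
    show "continuous_on S (\<lambda>p. Kz (?P p) * Xz p + Kw (?P p) * Yz p)"
         "continuous_on S (\<lambda>p. Kz (?P p) * Xw p + Kw (?P p) * Yw p)"
      by (auto intro!: continuous_on_add continuous_on_mult continuous_on_Pair X' Y' c sub
            continuous_on_compose2[OF K'(1)] continuous_on_compose2[OF K'(2)])
  next
    fix p assume p: "p \<in> S"
    have "(?P has_derivative (\<lambda>h. (Xz p * fst h + Xw p * snd h, Yz p * fst h + Yw p * snd h))) (at p)"
      using p by (intro has_derivative_Pair X' Y')
    from has_derivative_compose[OF this K'(3)[OF sub[OF p]]]
    show "((\<lambda>p. K (?P p)) has_derivative (\<lambda>h. (Kz (?P p) * Xz p + Kw (?P p) * Yz p) * fst h +
       (Kz (?P p) * Xw p + Kw (?P p) * Yw p) * snd h)) (at p)"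
      by (rule has_derivative_eq_rhs) (simp add: fun_eq_iff algebra_simps)
  qed
qed

section \<open>Complex extensions of real analytic functions\<close>

definition cplx :: "plane \<Rightarrow> complex \<times> complex" where
  "cplx p = (of_real (fst p), of_real (snd p))"

lemma bounded_linear_cplx: "bounded_linear cplx"
  unfolding cplx_def[abs_def]
  by (intro bounded_linear_Pair bounded_linear_compose[OF bounded_linear_of_real]
       bounded_linear_fst bounded_linear_snd)

lemma continuous_cplx: "isCont cplx p"
  by (intro linear_continuous_at bounded_linear_cplx)

lemma inj_cplx: "inj cplx"
  by (auto simp: inj_on_def cplx_def prod_eq_iff)

lemma open_vimage_cplx: "open S \<Longrightarrow> open {p. cplx p \<in> S}"
  using continuous_open_vimage[of S cplx] continuous_cplx unfolding vimage_def by blast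

lemma eventually_cplx_in: "open S \<Longrightarrow> cplx p \<in> S \<Longrightarrow> \<forall>\<^sub>F q in nhds p. cplx q \<in> S"
  using eventually_nhds_in_open[OF open_vimage_cplx, of S p] by simp

lemma real_analytic_at_cong:
  assumes "real_analytic_at f p" and ev: "\<forall>\<^sub>F q in nhds p. f q = g q"
  shows "real_analytic_at g p"
proof -
  obtain a r where r: "r > 0" and
    a: "\<And>x y. \<bar>x\<bar> < r \<Longrightarrow> \<bar>y\<bar> < r \<Longrightarrow>
           ((\<lambda>(i, j). (x ^ i * y ^ j) *\<^sub>R a i j) has_sum f (p + (x, y))) UNIV"
    using assms(1) unfolding real_analytic_at_def by blast
  obtain e where e: "e > 0" "\<And>q. dist q p < e \<Longrightarrow> f q = g q"
    using ev unfolding eventually_nhds_metric by blast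
  \<comment> \<open>Analyticity is stated on boxes and eventual equality on balls; the box of half
    side \<open>e / 2\<close> fits into the ball of radius e since
    \<open>\<bar>x\<bar> + \<bar>y\<bar>\<close> bounds the norm.\<close>
  have eq: "f (p + (x, y)) = g (p + (x, y))" if "\<bar>x\<bar> < e / 2" "\<bar>y\<bar> < e / 2" for x y
  proof (rule e(2))
    have "dist (p + (x, y)) p = norm (x, y)" by (simp add: dist_norm)
    also have "\<dots> \<le> \<bar>x\<bar> + \<bar>y\<bar>" using norm_Pair_le[of x y] by simp
    finally show "dist (p + (x, y)) p < e" using that by simp
  qed
  have "((\<lambda>(i, j). (x ^ i * y ^ j) *\<^sub>R a i j) has_sum g (p + (x, y))) UNIV"
    if "\<bar>x\<bar> < min r (e / 2)" "\<bar>y\<bar> < min r (e / 2)" for x y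
    using a[of x y] eq[of x y] that by simp
  moreover have "min r (e / 2) > 0" using r e(1) by simp
  ultimately show ?thesis unfolding real_analytic_at_def by blast
qed

text \<open>The same coefficients define the extension. Unordered summability of reals is absolute,
  so convergence at the real point \<open>(\<rho>, \<rho>)\<close> already dominates the complex
  series on the bidisc of radius \<rho>.\<close>

lemma real_analytic_at_imp_hol2:
  fixes f :: "plane \<Rightarrow> real"
  assumes "real_analytic_at f p"
  obtains S H where "open S" "cplx p \<in> S" "hol2_on S H"
    "\<And>q. cplx q \<in> S \<Longrightarrow> H (cplx q) = of_real (f q)"
proof -
  obtain a r where r: "r > 0" and
    a: "\<And>x y. \<bar>x\<bar> < r \<Longrightarrow> \<bar>y\<bar> < r \<Longrightarrow>
           ((\<lambda>(i, j). (x ^ i * y ^ j) *\<^sub>R a i j) has_sum f (p + (x, y))) UNIV"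
    using assms unfolding real_analytic_at_def by blast
  define \<rho> where "\<rho> = r / 2"
  have \<rho>: "0 < \<rho>" "\<rho> < r" using r by (auto simp: \<rho>_def)
  \<comment> \<open>The pairs of exponents are enumerated by \<open>prod_decode\<close>, which turns
    the double series into a single one.\<close>
  let ?i = "\<lambda>n. fst (prod_decode n)" and ?j = "\<lambda>n. snd (prod_decode n)"
  define c where "c n = complex_of_real (a (?i n) (?j n))" for n
  define H0 where "H0 = (\<lambda>(z, w). \<Sum>n. c n * z ^ ?i n * w ^ ?j n)"
  have bij: "bij_betw prod_decode UNIV UNIV" by (rule bij_prod_decode)
  have "(\<lambda>(i, j). (\<rho> ^ i * \<rho> ^ j) *\<^sub>R a i j) summable_on UNIV"
    using a[of \<rho> \<rho>] \<rho> by (auto intro: has_sum_imp_summable)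
  then have "(\<lambda>x. norm (case x of (i, j) \<Rightarrow> (\<rho> ^ i * \<rho> ^ j) *\<^sub>R a i j)) summable_on UNIV"
    using summable_on_iff_abs_summable_on_real by blast
  then have "(\<lambda>n. norm (case prod_decode n of (i, j) \<Rightarrow> (\<rho> ^ i * \<rho> ^ j) *\<^sub>R a i j)) summable_on UNIV"
    using summable_on_reindex_bij_betw[OF bij, of "\<lambda>x. norm (case x of (i, j) \<Rightarrow> (\<rho> ^ i * \<rho> ^ j) *\<^sub>R a i j)"]
    by simp
  then have "summable (\<lambda>n. norm (case prod_decode n of (i, j) \<Rightarrow> (\<rho> ^ i * \<rho> ^ j) *\<^sub>R a i j))"
    by (rule summable_on_imp_summable)
  then have summ: "summable (\<lambda>n. norm (c n) * \<rho> ^ ?i n * \<rho> ^ ?j n)"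
    using \<rho> by (simp add: c_def case_prod_unfold abs_mult mult_ac)
  have H0: "hol2_on (ball 0 \<rho> \<times> ball 0 \<rho>) H0"
    unfolding H0_def by (rule hol2_on_suminf_monomials[OF \<rho>(1) summ])
  define S where "S = {q. q - cplx p \<in> ball 0 \<rho> \<times> ball 0 \<rho>}"
  define H where "H q = H0 (fst q + (- fst (cplx p)), snd q + (- snd (cplx p)))" for q
  show ?thesis
  proof
    have "open ((\<lambda>q. q - cplx p) -` (ball 0 \<rho> \<times> ball 0 \<rho>))"
      by (intro continuous_open_vimage open_Times open_ball) (auto intro!: continuous_intros)
    then show "open S" by (simp add: S_def vimage_def)
    show "cplx p \<in> S" using \<rho> by (simp add: S_def zero_prod_def)
    show "hol2_on S H" unfolding H_def
    proof (rule hol2_on_compose[OF H0])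
      show "hol2_on S (\<lambda>q. fst q + - fst (cplx p))" "hol2_on S (\<lambda>q. snd q + - snd (cplx p))"
        by (intro hol2_on_add hol2_on_fst hol2_on_snd hol2_on_const)+
    qed (simp add: S_def mem_Times_iff)
  next
    fix q assume q: "cplx q \<in> S"
    obtain x y where xy: "q = p + (x, y)" by (metis add_diff_cancel_left' diff_add_cancel add.commute surj_pair)
    then have *: "\<bar>x\<bar> < \<rho>" "\<bar>y\<bar> < \<rho>" using q by (auto simp: S_def cplx_def)
    then have "((\<lambda>(i, j). (x ^ i * y ^ j) *\<^sub>R a i j) has_sum f q) UNIV"
      using a[of x y] \<rho> xy by simp
    then have "((\<lambda>n. case prod_decode n of (i, j) \<Rightarrow> (x ^ i * y ^ j) *\<^sub>R a i j) has_sum f q) UNIV"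
      using has_sum_reindex_bij_betw[OF bij, of "\<lambda>(i, j). (x ^ i * y ^ j) *\<^sub>R a i j" "f q"] by simp
    then have "(\<lambda>n. (x ^ ?i n * y ^ ?j n) *\<^sub>R a (?i n) (?j n)) sums f q"
      by (simp add: case_prod_unfold has_sum_imp_sums)
    then have "(\<lambda>n. complex_of_real ((x ^ ?i n * y ^ ?j n) *\<^sub>R a (?i n) (?j n))) sums of_real (f q)"
      by (rule sums_of_real)
    then have "(\<lambda>n. c n * of_real x ^ ?i n * of_real y ^ ?j n) sums complex_of_real (f q)"
      by (simp add: c_def mult_ac)
    then show "H (cplx q) = of_real (f q)"
      by (simp add: H_def H0_def cplx_def xy sums_iff)
  qed
qed

text \<open>Taking the real part of H on the real plane is enough: the real parts of the Taylor
  coefficients of H then serve as coefficients of f. In this form no reality of H or of its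
  coefficients has to be established when the lemma is applied.\<close>

lemma hol2_imp_real_analytic_at:
  fixes f :: "plane \<Rightarrow> real"
  assumes S: "open S" "cplx p \<in> S" and H: "hol2_on S H"
    and ev: "\<forall>\<^sub>F q in nhds p. f q = Re (H (cplx q))"
  shows "real_analytic_at f p"
proof -
  let ?K = "\<lambda>q. H (fst q + fst (cplx p), snd q + snd (cplx p))"
  have "open ((\<lambda>q. (fst q + fst (cplx p), snd q + snd (cplx p))) -` S)"
    by (intro continuous_open_vimage S(1)) (auto intro!: continuous_intros)
  moreover have "(0, 0) \<in> (\<lambda>q. (fst q + fst (cplx p), snd q + snd (cplx p))) -` S" using S(2) by simp
  ultimately obtain A B where AB: "open A" "open B" "(0, 0) \<in> A \<times> B"
    "A \<times> B \<subseteq> (\<lambda>q. (fst q + fst (cplx p), snd q + snd (cplx p))) -` S"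
    by (rule open_prod_elim)
  then have "open (A \<inter> B)" "0 \<in> A \<inter> B" by auto
  then obtain R where "0 < R" "ball 0 R \<subseteq> A \<inter> B" by (rule openE)
  then have R: "0 < R" "ball 0 R \<subseteq> A" "ball 0 R \<subseteq> B" by auto
  have "hol2_on (ball 0 R \<times> ball 0 R) ?K"
    by (rule hol2_on_compose[OF H])
       (use AB(4) R in \<open>auto intro!: hol2_on_add hol2_on_fst hol2_on_snd hol2_on_const\<close>)
  then obtain a where a: "\<And>z w. norm z < R / 2 \<Longrightarrow> norm w < R / 2 \<Longrightarrow>
     ((\<lambda>(i, j). z ^ i * w ^ j * a i j) has_sum ?K (z, w)) UNIV"
    using hol2_on_power_series[of R ?K "R / 2"] R(1) by auto
  have "((\<lambda>(i, j). (x ^ i * y ^ j) *\<^sub>R Re (a i j)) has_sum Re (H (cplx (p + (x, y))))) UNIV"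
    if "\<bar>x\<bar> < R / 2" "\<bar>y\<bar> < R / 2" for x y
  proof -
    have "((\<lambda>u. Re (case u of (i, j) \<Rightarrow> complex_of_real x ^ i * complex_of_real y ^ j * a i j))
        has_sum Re (?K (of_real x, of_real y))) UNIV"
      using a[of "of_real x" "of_real y"] that by (intro has_sum_Re) auto
    \<comment> \<open>Monomials are real at real points, so the real part passes to the
      coefficient.\<close>
    moreover have "Re (complex_of_real x ^ i * complex_of_real y ^ j * a i j) = (x ^ i * y ^ j) *\<^sub>R Re (a i j)" for i j
    proof -
      have "complex_of_real x ^ i * complex_of_real y ^ j = of_real (x ^ i * y ^ j)" by simp
      then show ?thesis
        by (simp only: times_complex.sel Re_complex_of_real Im_complex_of_real real_scaleR_def)
    qed
    ultimately show ?thesis by (simp add: case_prod_unfold cplx_def add.commute)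
  qed
  then have "real_analytic_at (\<lambda>q. Re (H (cplx q))) p"
    unfolding real_analytic_at_def using R(1) by (intro exI[of _ "\<lambda>i j. Re (a i j)"] exI[of _ "R / 2"]) auto
  then show ?thesis
    by (rule real_analytic_at_cong) (use ev in \<open>simp add: eq_commute\<close>)
qed

section \<open>Closure properties of real analytic functions\<close>

lemma real_analytic_at_add:
  assumes "real_analytic_at f p" "real_analytic_at g p"
  shows "real_analytic_at (\<lambda>q. f q + g q) p"
proof -
  obtain a r where r: "r > 0" and
    a: "\<And>x y. \<bar>x\<bar> < r \<Longrightarrow> \<bar>y\<bar> < r \<Longrightarrow>
           ((\<lambda>(i, j). (x ^ i * y ^ j) *\<^sub>R a i j) has_sum f (p + (x, y))) UNIV"
    using assms(1) unfolding real_analytic_at_def by blast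
  obtain b s where s: "s > 0" and
    b: "\<And>x y. \<bar>x\<bar> < s \<Longrightarrow> \<bar>y\<bar> < s \<Longrightarrow>
           ((\<lambda>(i, j). (x ^ i * y ^ j) *\<^sub>R b i j) has_sum g (p + (x, y))) UNIV"
    using assms(2) unfolding real_analytic_at_def by blast
  have "((\<lambda>(i, j). (x ^ i * y ^ j) *\<^sub>R (a i j + b i j)) has_sum (f (p + (x, y)) + g (p + (x, y)))) UNIV"
    if "\<bar>x\<bar> < min r s" "\<bar>y\<bar> < min r s" for x y
    using has_sum_add[OF a[of x y] b[of x y]] that by (simp add: case_prod_unfold scaleR_add_right)
  moreover have "min r s > 0" using r s by simp
  ultimately show ?thesis unfolding real_analytic_at_def by (intro exI[of _ "\<lambda>i j. a i j + b i j"]) blast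
qed

lemma real_analytic_at_const: "real_analytic_at (\<lambda>_. c :: real) p"
  by (rule hol2_imp_real_analytic_at[OF open_UNIV _ hol2_on_const[of _ "of_real c"]]) auto

lemma real_analytic_at_fst: "real_analytic_at fst (p :: plane)"
  by (rule hol2_imp_real_analytic_at[OF open_UNIV _ hol2_on_fst]) (auto simp: cplx_def)

lemma real_analytic_at_snd: "real_analytic_at snd (p :: plane)"
  by (rule hol2_imp_real_analytic_at[OF open_UNIV _ hol2_on_snd]) (auto simp: cplx_def)

text \<open>The extensions are composed instead of the series, so nothing has to be rearranged. Two
  inner functions are allowed because every map into the plane is a pair of them.\<close>

lemma real_analytic_at_compose:
  fixes f X Y :: "plane \<Rightarrow> real"
  assumes f: "real_analytic_at f (X p, Y p)" and X: "real_analytic_at X p" and Y: "real_analytic_at Y p"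
  shows "real_analytic_at (\<lambda>q. f (X q, Y q)) p"
proof -
  obtain T K where T: "open T" "cplx (X p, Y p) \<in> T" "hol2_on T K" "\<And>q. cplx q \<in> T \<Longrightarrow> K (cplx q) = of_real (f q)"
    using real_analytic_at_imp_hol2[OF f] by blast
  obtain S F where S: "open S" "cplx p \<in> S" "hol2_on S F" "\<And>q. cplx q \<in> S \<Longrightarrow> F (cplx q) = of_real (X q)"
    using real_analytic_at_imp_hol2[OF X] by blast
  obtain S' G where S': "open S'" "cplx p \<in> S'" "hol2_on S' G" "\<And>q. cplx q \<in> S' \<Longrightarrow> G (cplx q) = of_real (Y q)"
    using real_analytic_at_imp_hol2[OF Y] by blast
  \<comment> \<open>On U both inner extensions exist and together they land in the domain of the
    outer one.\<close>
  define U where "U = (S \<inter> S') \<inter> (\<lambda>q. (F q, G q)) -` T"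
  have FG: "continuous_on (S \<inter> S') (\<lambda>q. (F q, G q))"
    using S(3) S'(3) by (intro continuous_on_Pair hol2_on_imp_continuous_on) (auto intro: hol2_on_subset)
  have op: "open U" unfolding U_def
    using continuous_on_open_vimage[of "S \<inter> S'" "\<lambda>q. (F q, G q)"] FG S(1) S'(1) T(1)
    by (metis Int_commute open_Int)
  have pU: "cplx p \<in> U" using S S' T by (simp add: U_def cplx_def)
  show ?thesis
  proof (rule hol2_imp_real_analytic_at[OF op pU])
    show "hol2_on U (\<lambda>q. K (F q, G q))"
      using S S' by (intro hol2_on_compose[OF T(3)]) (auto simp: U_def intro: hol2_on_subset)
    show "\<forall>\<^sub>F q in nhds p. f (X q, Y q) = Re (K (F (cplx q), G (cplx q)))"
      using eventually_cplx_in[OF op pU]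
    proof eventually_elim
      case (elim q)
      then have q: "cplx q \<in> S" "cplx q \<in> S'" "(F (cplx q), G (cplx q)) \<in> T" by (auto simp: U_def)
      have "(F (cplx q), G (cplx q)) = cplx (X q, Y q)" using q S(4) S'(4) by (simp add: cplx_def)
      then show ?case using T(4) q(3) by simp
    qed
  qed
qed

lemma real_analytic_at_mult:
  fixes f g :: "plane \<Rightarrow> real"
  assumes f: "real_analytic_at f p" and g: "real_analytic_at g p"
  shows "real_analytic_at (\<lambda>q. f q * g q) p"
proof -
  have "real_analytic_at (\<lambda>q. fst q * snd q) (f p, g p)"
    by (rule hol2_imp_real_analytic_at[OF open_UNIV _ hol2_on_mult[OF hol2_on_fst hol2_on_snd]]) (auto simp: cplx_def)
  from real_analytic_at_compose[OF this f g] show ?thesis by simp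
qed

lemma real_analytic_at_minus:
  fixes f :: "plane \<Rightarrow> real"
  assumes "real_analytic_at f p"
  shows "real_analytic_at (\<lambda>q. - f q) p"
  using real_analytic_at_mult[OF real_analytic_at_const[of "- 1"] assms] by simp

lemma real_analytic_at_diff:
  fixes f g :: "plane \<Rightarrow> real"
  assumes "real_analytic_at f p" "real_analytic_at g p"
  shows "real_analytic_at (\<lambda>q. f q - g q) p"
  using real_analytic_at_add[OF assms(1) real_analytic_at_minus[OF assms(2)]] by simp

text \<open>One complex extension serves at every real point of its domain; this replaces the
  re-expansion of a power series around a nearby centre.\<close>

lemma real_analytic_at_eventually:
  fixes f :: "plane \<Rightarrow> real"
  assumes "real_analytic_at f p"
  shows "\<forall>\<^sub>F q in nhds p. real_analytic_at f q"
proof -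
  obtain S F where S: "open S" "cplx p \<in> S" "hol2_on S F" "\<And>q. cplx q \<in> S \<Longrightarrow> F (cplx q) = of_real (f q)"
    using real_analytic_at_imp_hol2[OF assms] by blast
  show ?thesis
    using eventually_cplx_in[OF S(1,2)]
  proof eventually_elim
    case (elim q)
    show ?case
    proof (rule hol2_imp_real_analytic_at[OF S(1) elim S(3)])
      show "\<forall>\<^sub>F q in nhds q. f q = Re (F (cplx q))"
        using eventually_cplx_in[OF S(1) elim] by eventually_elim (simp add: S(4))
    qed
  qed
qed

section \<open>Differentials along the real plane\<close>

lemma has_derivative_comp_cplx:
  assumes "(F has_derivative (\<lambda>h. a * fst h + b * snd h)) (at (cplx p))"
  shows "((\<lambda>q. F (cplx q)) has_derivative (\<lambda>h. a * of_real (fst h) + b * of_real (snd h))) (at p)"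
proof -
  have "(cplx has_derivative cplx) (at p)"
    by (rule bounded_linear_imp_has_derivative[OF bounded_linear_cplx])
  from has_derivative_compose[OF this assms] show ?thesis by (simp add: cplx_def)
qed

lemma real_analytic_at_has_derivative:
  fixes f :: "plane \<Rightarrow> real"
  assumes "real_analytic_at f p"
  obtains a b where "(f has_derivative (\<lambda>h. a * fst h + b * snd h)) (at p)"
proof -
  obtain S F where S: "open S" "cplx p \<in> S" "hol2_on S F" "\<And>q. cplx q \<in> S \<Longrightarrow> F (cplx q) = of_real (f q)"
    using real_analytic_at_imp_hol2[OF assms] by blast
  obtain a b where F: "(F has_derivative (\<lambda>h. a * fst h + b * snd h)) (at (cplx p))"
    using S(2,3) unfolding hol2_on_def by blast
  have "((\<lambda>q. Re (F (cplx q))) has_derivative (\<lambda>h. Re (a * of_real (fst h) + b * of_real (snd h)))) (at p)"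
    by (rule bounded_linear.has_derivative[OF bounded_linear_Re has_derivative_comp_cplx[OF F]])
  then have "(f has_derivative (\<lambda>h. Re (a * of_real (fst h) + b * of_real (snd h)))) (at p)"
    by (rule has_derivative_transform_within_open[OF _ open_vimage_cplx[OF S(1)]])
       (use S in auto)
  then show ?thesis using that[of "Re a" "Re b"] by simp
qed

lemma real_analytic_at_imp_isCont:
  fixes f :: "plane \<Rightarrow> real"
  assumes "real_analytic_at f p"
  shows "isCont f p"
  using real_analytic_at_has_derivative[OF assms] has_derivative_continuous by blast

lemma real_analytic_at_bounded_linear:
  assumes "real_analytic_at f p" and h: "bounded_linear h"
  shows "real_analytic_at (\<lambda>q. h (f q)) p"
proof -
  interpret bounded_linear h by fact
  obtain a r where r: "r > 0" and
    a: "\<And>x y. \<bar>x\<bar> < r \<Longrightarrow> \<bar>y\<bar> < r \<Longrightarrow>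
           ((\<lambda>(i, j). (x ^ i * y ^ j) *\<^sub>R a i j) has_sum f (p + (x, y))) UNIV"
    using assms unfolding real_analytic_at_def by blast
  have "((\<lambda>(i, j). (x ^ i * y ^ j) *\<^sub>R h (a i j)) has_sum h (f (p + (x, y)))) UNIV"
    if "\<bar>x\<bar> < r" "\<bar>y\<bar> < r" for x y
    using has_sum_bounded_linear[OF h a[OF that]] by (simp add: case_prod_unfold scaleR)
  then show ?thesis unfolding real_analytic_at_def using r
    by (intro exI[of _ "\<lambda>i j. h (a i j)"] exI[of _ r]) simp
qed

lemma real_analytic_at_plane_iff:
  fixes \<phi> :: "plane \<Rightarrow> plane"
  shows "real_analytic_at \<phi> p \<longleftrightarrow> real_analytic_at (\<lambda>q. fst (\<phi> q)) p \<and> real_analytic_at (\<lambda>q. snd (\<phi> q)) p"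
proof safe
  assume *: "real_analytic_at (\<lambda>q. fst (\<phi> q)) p" "real_analytic_at (\<lambda>q. snd (\<phi> q)) p"
  have "real_analytic_at (\<lambda>q. (fst (\<phi> q), 0) + (0, snd (\<phi> q))) p"
    by (intro real_analytic_at_add
        real_analytic_at_bounded_linear[OF *(1), of "\<lambda>x. (x, 0)"]
        real_analytic_at_bounded_linear[OF *(2), of "\<lambda>x. (0, x)"] bounded_linear_Pair
        bounded_linear_ident bounded_linear_zero)
  then show "real_analytic_at \<phi> p" by simp
qed (auto intro: real_analytic_at_bounded_linear bounded_linear_fst bounded_linear_snd)

lemma real_analytic_at_plane_isCont:
  fixes \<phi> :: "plane \<Rightarrow> plane"
  assumes "real_analytic_at \<phi> p"
  shows "isCont \<phi> p"
proof -
  have "isCont (\<lambda>q. (fst (\<phi> q), snd (\<phi> q))) p"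
    using assms by (intro continuous_Pair real_analytic_at_imp_isCont) (simp_all add: real_analytic_at_plane_iff)
  then show ?thesis by simp
qed

text \<open>If the determinant vanishes, \<open>(d, - c)\<close> and \<open>(- b, a)\<close> lie in
  the kernel. So all entries are zero, and \<open>(1, 0)\<close> is in the kernel too. A general
  field is allowed because the real differential and its complex extension are both treated this
  way.\<close>

lemma det2_nonzero:
  fixes a b c d :: "'a::field"
  assumes "\<And>x y. a * x + b * y = 0 \<Longrightarrow> c * x + d * y = 0 \<Longrightarrow> x = 0 \<and> y = 0"
  shows "a * d - b * c \<noteq> 0"
proof
  assume det: "a * d - b * c = 0"
  have "d = 0 \<and> - c = 0" using det by (intro assms) (simp_all add: algebra_simps)
  moreover have "- b = 0 \<and> a = 0" using det by (intro assms) (simp_all add: algebra_simps)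
  ultimately show False using assms[of 1 0] by simp
qed

text \<open>The inverse function theorem is applied to the extension in two complex variables, so
  that the inverse is again continuously complex differentiable and hence real analytic on the real
  plane. The set W leaves room for keeping the domain inside a prescribed neighbourhood.\<close>

lemma analytic_diffeo_on_nearby:
  fixes \<phi> :: "plane \<Rightarrow> plane"
  assumes ra: "real_analytic_at \<phi> p" and D: "(\<phi> has_derivative D) (at p)"
    and kerD: "\<And>v. D v = 0 \<Longrightarrow> v = 0" and W: "open W" "p \<in> W"
  obtains A where "p \<in> A" "A \<subseteq> W" "analytic_diffeo_on \<phi> A"
proof -
  obtain S1 H1 where S1: "open S1" "cplx p \<in> S1" "hol2_on S1 H1"
      "\<And>q. cplx q \<in> S1 \<Longrightarrow> H1 (cplx q) = of_real (fst (\<phi> q))"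
    using real_analytic_at_imp_hol2[of "\<lambda>q. fst (\<phi> q)" p] ra by (auto simp: real_analytic_at_plane_iff)
  obtain S2 H2 where S2: "open S2" "cplx p \<in> S2" "hol2_on S2 H2"
      "\<And>q. cplx q \<in> S2 \<Longrightarrow> H2 (cplx q) = of_real (snd (\<phi> q))"
    using real_analytic_at_imp_hol2[of "\<lambda>q. snd (\<phi> q)" p] ra by (auto simp: real_analytic_at_plane_iff)
  obtain a b where ab: "continuous_on S1 a" "continuous_on S1 b"
     "\<And>q. q \<in> S1 \<Longrightarrow> (H1 has_derivative (\<lambda>h. a q * fst h + b q * snd h)) (at q)"
    using S1(3) unfolding hol2_on_def by blast
  obtain c d where cd: "continuous_on S2 c" "continuous_on S2 d"
     "\<And>q. q \<in> S2 \<Longrightarrow> (H2 has_derivative (\<lambda>h. c q * fst h + d q * snd h)) (at q)"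
    using S2(3) unfolding hol2_on_def by blast
  define S where "S = S1 \<inter> S2"
  have S: "open S" "cplx p \<in> S" using S1 S2 by (auto simp: S_def)
  have contS: "continuous_on S a" "continuous_on S b" "continuous_on S c" "continuous_on S d"
    using ab cd by (auto simp: S_def intro: continuous_on_subset)
  define \<Phi> where "\<Phi> q = (H1 q, H2 q)" for q
  define L where "L q h = (a q * fst h + b q * snd h, c q * fst h + d q * snd h)" for q h
  have blL: "bounded_linear (L q)" for q
    unfolding L_def[abs_def]
    by (intro bounded_linear_Pair bounded_linear_add bounded_linear_mult_right
         bounded_linear_compose[OF bounded_linear_mult_right] bounded_linear_fst bounded_linear_snd)
  define f' where "f' q = Blinfun (L q)" for q
  have f': "blinfun_apply (f' q) = L q" for q
    unfolding f'_def by (rule bounded_linear_Blinfun_apply[OF blL])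
  have \<Phi>cplx: "\<Phi> (cplx q) = cplx (\<phi> q)" if "cplx q \<in> S" for q
    using that S1(4) S2(4) by (simp add: \<Phi>_def cplx_def S_def)
  have der\<Phi>: "(\<Phi> has_derivative blinfun_apply (f' q)) (at q)" if "q \<in> S" for q
    unfolding f' L_def[abs_def] \<Phi>_def[abs_def] using that ab cd
    by (intro has_derivative_Pair) (auto simp: S_def)
  have cont': "continuous_on S f'"
    by (rule continuous_on_blinfun_componentwise)
       (auto simp: f' L_def intro!: continuous_intros contS)
  \<comment> \<open>Along the real plane the extension agrees with the original component, so the
    complex differential at \<open>cplx p\<close> restricts to the real one. Consequently its matrix
    is real, with the determinant of D.\<close>
  have real: "of_real (l (D h)) = e * of_real (fst h) + k * of_real (snd h)"
    if "open T" "cplx p \<in> T" "\<And>q. cplx q \<in> T \<Longrightarrow> K (cplx q) = of_real (l (\<phi> q))" "bounded_linear l"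
      and K: "(K has_derivative (\<lambda>h. e * fst h + k * snd h)) (at (cplx p))" for K T e k l h
  proof -
    have "((\<lambda>q. of_real (l (\<phi> q))) has_derivative (\<lambda>h. complex_of_real (l (D h)))) (at p)"
      by (intro bounded_linear.has_derivative[OF bounded_linear_of_real]
          bounded_linear.has_derivative[OF that(4)] D)
    then have "((\<lambda>q. K (cplx q)) has_derivative (\<lambda>h. complex_of_real (l (D h)))) (at p)"
      by (rule has_derivative_transform_within_open[OF _ open_vimage_cplx[OF that(1)]])
         (use that(2,3) in auto)
    from fun_cong[OF has_derivative_unique[OF this has_derivative_comp_cplx[OF K]], of h] show ?thesis .
  qed
  note real1 = real[OF S1(1,2,4) bounded_linear_fst ab(3)[OF S1(2)]]
    and real2 = real[OF S2(1,2,4) bounded_linear_snd cd(3)[OF S2(2)]]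
  define a0 b0 c0 d0 where "a0 = fst (D (1, 0))" and "b0 = fst (D (0, 1))"
    and "c0 = snd (D (1, 0))" and "d0 = snd (D (0, 1))"
  have abcd: "a (cplx p) = of_real a0" "b (cplx p) = of_real b0" "c (cplx p) = of_real c0" "d (cplx p) = of_real d0"
    using real1[of "(1, 0)"] real1[of "(0, 1)"] real2[of "(1, 0)"] real2[of "(0, 1)"]
    by (simp_all add: a0_def b0_def c0_def d0_def)
  have "a0 * d0 - b0 * c0 \<noteq> 0"
  proof (rule det2_nonzero)
    fix x y assume "a0 * x + b0 * y = 0" "c0 * x + d0 * y = 0"
    moreover have "complex_of_real (fst (D (x, y))) = of_real (a0 * x + b0 * y)"
      "complex_of_real (snd (D (x, y))) = of_real (c0 * x + d0 * y)"
      using real1[of "(x, y)"] real2[of "(x, y)"] by (simp_all add: abcd)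
    ultimately have "D (x, y) = 0" by (simp add: prod_eq_iff)
    then show "x = 0 \<and> y = 0" using kerD[of "(x, y)"] by (simp add: prod_eq_iff)
  qed
  moreover have "a (cplx p) * d (cplx p) - b (cplx p) * c (cplx p) = of_real (a0 * d0 - b0 * c0)"
    by (simp add: abcd)
  ultimately have det0: "a (cplx p) * d (cplx p) - b (cplx p) * c (cplx p) \<noteq> 0"
    by (metis of_real_eq_0_iff)
  \<comment> \<open>The inverse matrix by Cramer's rule: explicit entries make the continuity of the
    partial derivatives of the inverse visible.\<close>
  define C where "C q k = ((d q / (a q * d q - b q * c q)) * fst k + (- b q / (a q * d q - b q * c q)) * snd k,
                           (- c q / (a q * d q - b q * c q)) * fst k + (a q / (a q * d q - b q * c q)) * snd k)" for q and k :: "complex \<times> complex"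
  have blC: "bounded_linear (C q)" for q
    unfolding C_def[abs_def]
    by (intro bounded_linear_Pair bounded_linear_add bounded_linear_mult_right
         bounded_linear_compose[OF bounded_linear_mult_right] bounded_linear_fst bounded_linear_snd)
  have LC: "L q (C q k) = k" "C q (L q k) = k" if det: "a q * d q - b q * c q \<noteq> 0" for q k
  proof -
    define \<delta> where "\<delta> = a q * d q - b q * c q"
    have \<delta>: "\<delta> \<noteq> 0" "a q * d q = \<delta> + b q * c q" using det by (auto simp: \<delta>_def)
    show "L q (C q k) = k" "C q (L q k) = k"
      unfolding L_def C_def \<delta>_def[symmetric] using \<delta>(1)
      by (simp_all add: prod_eq_iff field_simps) (simp_all add: \<delta>_def algebra_simps)
  qed
  have "Blinfun (C (cplx p)) o\<^sub>L f' (cplx p) = id_blinfun"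
    by (rule blinfun_eqI) (simp add: f' bounded_linear_Blinfun_apply[OF blC] LC(2)[OF det0])
  from inverse_function_theorem[OF S(1) der\<Phi> cont' S(2) this]
  obtain U V g g' where U: "open U" "U \<subseteq> S" "cplx p \<in> U" and V: "open V" "\<Phi> (cplx p) \<in> V"
    and hom: "homeomorphism U V \<Phi> g"
    and g: "\<And>y. y \<in> V \<Longrightarrow> (g has_derivative g' y) (at y)"
    "\<And>y. y \<in> V \<Longrightarrow> g' y = inv (blinfun_apply (f' (g y)))"
    "\<And>y. y \<in> V \<Longrightarrow> bij (blinfun_apply (f' (g y)))"
    by blast
  have gU: "g y \<in> U" if "y \<in> V" for y using hom that by (auto simp: homeomorphism_def)
  have g\<Phi>: "g (\<Phi> q) = q" if "q \<in> U" for q using hom that by (auto simp: homeomorphism_def)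
  have \<Phi>V: "\<Phi> q \<in> V" if "q \<in> U" for q using hom that by (auto simp: homeomorphism_def)
  \<comment> \<open>Over V the theorem gives bijectivity of the differential; nonvanishing of the
    determinant is its form for matrices, and it makes Cramer's formula valid on all of V.\<close>
  have detV: "a (g y) * d (g y) - b (g y) * c (g y) \<noteq> 0" if "y \<in> V" for y
  proof (rule det2_nonzero)
    fix u v assume *: "a (g y) * u + b (g y) * v = 0" "c (g y) * u + d (g y) * v = 0"
    have "inj (L (g y))" using g(3)[OF that] by (simp add: f' bij_def)
    moreover have "L (g y) (u, v) = L (g y) (0, 0)" using * by (simp add: L_def)
    ultimately have "(u, v) = (0, 0)" by (rule injD)
    then show "u = 0 \<and> v = 0" by simp
  qed
  have g'C: "g' y = C (g y)" if "y \<in> V" for y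
  proof -
    have "inj (L (g y))" using g(3)[OF that] by (simp add: f' bij_def)
    then show ?thesis
      unfolding g(2)[OF that] f' by (intro ext inv_f_eq) (simp_all add: LC(1)[OF detV[OF that]])
  qed
  have contg: "continuous_on V g" using hom by (simp add: homeomorphism_def)
  have cg: "continuous_on V (\<lambda>y. a (g y))" "continuous_on V (\<lambda>y. b (g y))"
           "continuous_on V (\<lambda>y. c (g y))" "continuous_on V (\<lambda>y. d (g y))"
    using contS[THEN continuous_on_compose2, OF contg] gU U(2) by blast+
  have hol_g1: "hol2_on V (\<lambda>y. fst (g y))"
  proof (rule hol2_onI)
    show "((\<lambda>y. fst (g y)) has_derivative
       (\<lambda>k. (d (g y) / (a (g y) * d (g y) - b (g y) * c (g y))) * fst k +
            (- b (g y) / (a (g y) * d (g y) - b (g y) * c (g y))) * snd k)) (at y)" if "y \<in> V" for y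
      using bounded_linear.has_derivative[OF bounded_linear_fst g(1)[OF that]]
      by (simp add: g'C[OF that] C_def)
  qed (use detV in \<open>auto intro!: continuous_on_divide continuous_on_minus continuous_on_diff continuous_on_mult cg\<close>)
  have hol_g2: "hol2_on V (\<lambda>y. snd (g y))"
  proof (rule hol2_onI)
    show "((\<lambda>y. snd (g y)) has_derivative
       (\<lambda>k. (- c (g y) / (a (g y) * d (g y) - b (g y) * c (g y))) * fst k +
            (a (g y) / (a (g y) * d (g y) - b (g y) * c (g y))) * snd k)) (at y)" if "y \<in> V" for y
      using bounded_linear.has_derivative[OF bounded_linear_snd g(1)[OF that]]
      by (simp add: g'C[OF that] C_def)
  qed (use detV in \<open>auto intro!: continuous_on_divide continuous_on_minus continuous_on_diff continuous_on_mult cg\<close>)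
  define A where "A = W \<inter> {q. cplx q \<in> U}"
  have opA: "open A" unfolding A_def by (intro open_Int W open_vimage_cplx U)
  have raA: "real_analytic_at \<phi> q" if "q \<in> A" for q
  proof -
    have q: "cplx q \<in> S1" "cplx q \<in> S2" using that U(2) by (auto simp: A_def S_def)
    have "real_analytic_at (\<lambda>q. fst (\<phi> q)) q"
      by (rule hol2_imp_real_analytic_at[OF S1(1) q(1) S1(3)])
         (use eventually_cplx_in[OF S1(1) q(1)] in \<open>eventually_elim, simp add: S1(4)\<close>)
    moreover have "real_analytic_at (\<lambda>q. snd (\<phi> q)) q"
      by (rule hol2_imp_real_analytic_at[OF S2(1) q(2) S2(3)])
         (use eventually_cplx_in[OF S2(1) q(2)] in \<open>eventually_elim, simp add: S2(4)\<close>)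
    ultimately show ?thesis by (simp add: real_analytic_at_plane_iff)
  qed
  have gA: "g (cplx (\<phi> q)) = cplx q" "cplx (\<phi> q) \<in> V" if "q \<in> A" for q
    using that \<Phi>cplx[of q] g\<Phi>[of "cplx q"] \<Phi>V[of "cplx q"] U(2) by (auto simp: A_def)
  have injA: "inj_on \<phi> A"
    by (rule inj_onI) (metis gA(1) injD[OF inj_cplx])
  have contA: "continuous_on A \<phi>"
    using raA by (intro continuous_at_imp_continuous_on ballI real_analytic_at_plane_isCont)
  \<comment> \<open>A real point of V might have a nonreal preimage, so the image of A is not
    obviously the real trace of V. Invariance of domain gives its openness directly.\<close>
  have opim: "open (\<phi> ` A)" by (rule invariance_of_domain[OF contA opA injA])
  have rainv: "real_analytic_at (inv_into A \<phi>) y" if "y \<in> \<phi> ` A" for y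
  proof -
    have inv: "\<forall>\<^sub>F y' in nhds y. cplx (inv_into A \<phi> y') = g (cplx y')"
      using eventually_nhds_in_open[OF opim that]
      by eventually_elim (auto simp: gA injA inv_into_f_f)
    have yV: "cplx y \<in> V" using that gA by auto
    have "real_analytic_at (\<lambda>y. fst (inv_into A \<phi> y)) y"
    proof (rule hol2_imp_real_analytic_at[OF V(1) yV hol_g1])
      show "\<forall>\<^sub>F y' in nhds y. fst (inv_into A \<phi> y') = Re (fst (g (cplx y')))"
        using inv by eventually_elim (metis Re_complex_of_real cplx_def fst_conv)
    qed
    moreover have "real_analytic_at (\<lambda>y. snd (inv_into A \<phi> y)) y"
    proof (rule hol2_imp_real_analytic_at[OF V(1) yV hol_g2])
      show "\<forall>\<^sub>F y' in nhds y. snd (inv_into A \<phi> y') = Re (snd (g (cplx y')))"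
        using inv by eventually_elim (metis Re_complex_of_real cplx_def snd_conv)
    qed
    ultimately show ?thesis by (simp add: real_analytic_at_plane_iff)
  qed
  show ?thesis
    by (rule that[of A])
       (use W U opA opim injA raA rainv in \<open>auto simp: A_def analytic_diffeo_on_def\<close>)
qed

section \<open>Division and Koenigs linearization\<close>

lemma eventually_isCont_in:
  "isCont f x \<Longrightarrow> open S \<Longrightarrow> f x \<in> S \<Longrightarrow> \<forall>\<^sub>F y in nhds x. f y \<in> S"
  unfolding continuous_at_open eventually_nhds by blast

text \<open>Vanishing on the line x = 0 kills all coefficients without a factor x, by uniqueness of
  power series in one variable. Shifting the first index of the remaining ones gives Q.\<close>

lemma real_analytic_at_divide_fst:
  fixes P :: "plane \<Rightarrow> real"
  assumes P: "real_analytic_at P (0, 0)" and zero: "\<forall>\<^sub>F t in nhds 0. P (0, t) = 0"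
  obtains Q where "real_analytic_at Q (0, 0)" "\<forall>\<^sub>F q in nhds (0, 0). P q = fst q * Q q"
proof -
  obtain a r where r: "r > 0" and
    a': "\<And>x y. \<bar>x\<bar> < r \<Longrightarrow> \<bar>y\<bar> < r \<Longrightarrow>
           ((\<lambda>(i, j). (x ^ i * y ^ j) *\<^sub>R a i j) has_sum P ((0, 0) + (x, y))) UNIV"
    using P unfolding real_analytic_at_def by blast
  have a: "((\<lambda>(i, j). (x ^ i * y ^ j) * a i j) has_sum P (x, y)) UNIV"
    if "\<bar>x\<bar> < r" "\<bar>y\<bar> < r" for x y
    using a'[OF that] by (simp only: real_scaleR_def add_Pair add_0)
  obtain e where e: "e > 0" "\<And>t. \<bar>t\<bar> < e \<Longrightarrow> P (0, t) = 0"
    using zero unfolding eventually_nhds_metric by (auto simp: dist_real_def)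
  \<comment> \<open>At x = 0 exactly the terms with i = 0 survive, since \<open>0 ^ 0 = 1\<close>;
    what remains is a power series in t.\<close>
  have sums0: "(\<lambda>j. a 0 j * t ^ j) sums 0" if t: "\<bar>t\<bar> < min r e" for t
  proof -
    have "((\<lambda>(i, j). (0 ^ i * t ^ j) * a i j) has_sum 0) UNIV"
      using a[of 0 t] e(2)[of t] t r by simp
    then have "((\<lambda>(i, j). (0 ^ i * t ^ j) * a i j) has_sum 0) (Pair 0 ` (UNIV :: nat set))"
      by (subst has_sum_cong_neutral[where T = UNIV]) auto
    then have "((\<lambda>(i, j). (0 ^ i * t ^ j) * a i j) \<circ> Pair 0 has_sum 0) (UNIV :: nat set)"
      by (subst (asm) has_sum_reindex) (auto simp: inj_on_def)
    then have "((\<lambda>j. a 0 j * t ^ j) has_sum 0) (UNIV :: nat set)"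
      by (simp add: o_def mult.commute)
    then show ?thesis by (rule has_sum_imp_sums)
  qed
  \<comment> \<open>The isolation of zeros used below speaks of a nonzero coefficient of positive
    index, so the constant term is treated on its own.\<close>
  have a00: "a 0 0 = 0"
  proof -
    have "(\<lambda>j. a 0 j * 0 ^ j) sums 0" using r e(1) by (intro sums0) simp
    with powser_sums_zero show ?thesis by (rule sums_unique2)
  qed
  have a0: "a 0 j = 0" for j
  proof (rule ccontr)
    assume j: "a 0 j \<noteq> 0"
    have j0: "0 < j" using a00 j by (cases j) auto
    have pos: "0 < min r e" using r e(1) by simp
    have pw: "(\<lambda>j. a 0 j * (x - 0) ^ j) sums 0" if "norm (x - 0) < min r e" for x
      using sums0[of x] that by simp
    show False
    proof (rule powser_0_nonzero[of "min r e" 0 "a 0" "\<lambda>_. 0" j, OF pos pw refl j j0])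
      fix s :: real assume s: "0 < s" and *: "\<And>z. z \<in> cball 0 s - {0 :: real} \<Longrightarrow> (0::real) \<noteq> 0"
      have "s \<in> cball 0 s - {0}" using s by simp
      from *[OF this] show False by simp
    qed
  qed
  define Q where "Q = (\<lambda>(x, y). infsum (\<lambda>(i, j). (x ^ i * y ^ j) * a (Suc i) j) UNIV)"
  define \<rho> where "\<rho> = r / 2"
  have \<rho>: "0 < \<rho>" "\<rho> < r" using r by (auto simp: \<rho>_def)
  let ?h = "\<lambda>(i :: nat, j :: nat). (Suc i, j)"
  have inj: "inj ?h" by (auto simp: inj_on_def)
  have Qsum: "((\<lambda>(i, j). (x ^ i * y ^ j) * a (Suc i) j) has_sum Q (x, y)) UNIV"
    if xy: "\<bar>x\<bar> < \<rho>" "\<bar>y\<bar> < \<rho>" for x y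
  proof -
    \<comment> \<open>The terms of positive first index at the point \<open>(\<rho>, y)\<close>,
      divided by \<rho>, dominate the series of Q whenever
      \<open>\<bar>x\<bar> < \<rho>\<close>.\<close>
    have "(\<lambda>(i, j). (\<rho> ^ i * y ^ j) * a i j) summable_on UNIV"
      using a[of \<rho> y] \<rho> xy by (auto intro: has_sum_imp_summable)
    then have "(\<lambda>(i, j). (\<rho> ^ i * y ^ j) * a i j) summable_on range ?h"
      by (rule summable_on_subset_banach) simp
    then have "((\<lambda>(i, j). (\<rho> ^ i * y ^ j) * a i j) \<circ> ?h) summable_on UNIV"
      by (subst (asm) summable_on_reindex[OF inj])
    then have "(\<lambda>p. (1 / \<rho>) * (((\<lambda>(i, j). (\<rho> ^ i * y ^ j) * a i j) \<circ> ?h) p)) summable_on UNIV"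
      by (rule summable_on_cmult_right)
    then have "(\<lambda>(i, j). (\<rho> ^ i * y ^ j) * a (Suc i) j) summable_on UNIV"
      using \<rho> by (simp add: o_def case_prod_unfold mult.assoc)
    then have s: "(\<lambda>p. norm (case p of (i, j) \<Rightarrow> (\<rho> ^ i * y ^ j) * a (Suc i) j)) summable_on UNIV"
      using summable_on_iff_abs_summable_on_real by blast
    have "(\<lambda>(i, j). (x ^ i * y ^ j) * a (Suc i) j) summable_on UNIV"
      by (rule abs_summable_summable, rule Infinite_Sum.abs_summable_on_comparison_test'[OF s])
         (use xy \<rho> in \<open>auto simp: abs_mult power_abs intro!: mult_right_mono power_mono\<close>)
    then show ?thesis unfolding Q_def by (simp add: has_sum_infsum)
  qed
  have raQ: "real_analytic_at Q (0, 0)"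
    unfolding real_analytic_at_def using \<rho>(1) Qsum
    by (intro exI[of _ "\<lambda>i j. a (Suc i) j"] exI[of _ \<rho>]) simp
  have PQ: "P (x, y) = x * Q (x, y)" if xy: "\<bar>x\<bar> < \<rho>" "\<bar>y\<bar> < \<rho>" for x y
  proof -
    have "((\<lambda>(i, j). (x ^ i * y ^ j) * a i j) has_sum P (x, y)) UNIV"
      using a[of x y] xy \<rho> by simp
    \<comment> \<open>The indices missed by the shift are those with i = 0, whose coefficients
      vanish.\<close>
    moreover have "((\<lambda>(i, j). (x ^ i * y ^ j) * a i j) has_sum P (x, y)) (range ?h) \<longleftrightarrow>
        ((\<lambda>(i, j). (x ^ i * y ^ j) * a i j) has_sum P (x, y)) UNIV"
    proof (rule has_sum_cong_neutral)
      fix p :: "nat \<times> nat" assume p: "p \<in> UNIV - range ?h"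
      obtain i j where ij: "p = (i, j)" by (cases p)
      have "i = 0" using p ij by (cases i) (auto simp: image_iff)
      then show "(case p of (i, j) \<Rightarrow> (x ^ i * y ^ j) * a i j) = 0" by (simp add: ij a0)
    qed auto
    ultimately have "((\<lambda>(i, j). (x ^ i * y ^ j) * a i j) has_sum P (x, y)) (range ?h)" by blast
    then have "((\<lambda>(i, j). (x ^ i * y ^ j) * a i j) \<circ> ?h has_sum P (x, y)) UNIV"
      by (subst (asm) has_sum_reindex[OF inj])
    moreover have "((\<lambda>p. x * (case p of (i, j) \<Rightarrow> (x ^ i * y ^ j) * a (Suc i) j)) has_sum x * Q (x, y)) UNIV"
      by (rule has_sum_cmult_right[OF Qsum[OF xy]])
    then have "((\<lambda>(i, j). (x ^ i * y ^ j) * a i j) \<circ> ?h has_sum x * Q (x, y)) UNIV"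
      by (simp add: o_def case_prod_unfold mult.assoc)
    ultimately show ?thesis by (rule has_sum_unique)
  qed
  have "\<forall>\<^sub>F q in nhds (0, 0). P q = fst q * Q q"
    unfolding eventually_nhds_metric
  proof (intro exI[of _ \<rho>] conjI allI impI)
    fix q :: plane assume "dist q (0, 0) < \<rho>"
    then have "\<bar>fst q\<bar> < \<rho>" "\<bar>snd q\<bar> < \<rho>"
      using dist_fst_le[of q "(0, 0)"] dist_snd_le[of q "(0, 0)"] by (auto simp: dist_real_def)
    then show "P q = fst q * Q q" using PQ[of "fst q" "snd q"] by simp
  qed (rule \<rho>)
  with raQ show ?thesis by (rule that)
qed

lemma hol2_on_holomorphic_fst:
  assumes "f holomorphic_on B" "open B"
  shows "hol2_on (B \<times> UNIV) (\<lambda>q. f (fst q))"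
proof (rule hol2_onI)
  show "continuous_on (B \<times> UNIV) (\<lambda>q. deriv f (fst q))"
    by (rule continuous_on_compose2[OF holomorphic_on_imp_continuous_on[OF holomorphic_deriv[OF assms]]])
       (auto intro: continuous_intros)
  fix q :: "complex \<times> complex" assume "q \<in> B \<times> UNIV"
  then have "(f has_field_derivative deriv f (fst q)) (at (fst q))"
    using assms by (intro holomorphic_derivI) auto
  then have "((\<lambda>q. f (fst q)) has_derivative (\<lambda>h. deriv f (fst q) * fst h)) (at q)"
    by (intro has_derivative_compose[where g = f, OF has_derivative_fst[OF has_derivative_ident]])
       (simp add: has_field_derivative_def)
  then show "((\<lambda>q. f (fst q)) has_derivative (\<lambda>h. deriv f (fst q) * fst h + 0 * snd h)) (at q)"
    by simp
qed auto

text \<open>The linearization is the limit of \<open>2 ^ n * (\<sigma> ^^ n) z\<close>. Since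
  \<sigma> differs from halving by a quadratic term only, consecutive members differ by a
  geometrically small multiple of the square of the norm. Hence the convergence is uniform, the
  functional equation passes to the limit, and the limit is tangent to the identity.\<close>

lemma holomorphic_koenigs:
  assumes hol: "\<sigma> holomorphic_on B" and B: "open B" "0 \<in> B" and \<sigma>0: "\<sigma> 0 = 0" "deriv \<sigma> 0 = 1 / 2"
  obtains \<delta> A where "0 < \<delta>" "ball 0 \<delta> \<subseteq> B" "A holomorphic_on ball 0 \<delta>" "A 0 = 0"
    "(A has_field_derivative 1) (at 0)"
    "\<forall>z\<in>ball 0 \<delta>. \<sigma> z \<in> ball 0 \<delta> \<and> A (\<sigma> z) = A z / 2"
proof -
  obtain \<delta>0 where \<delta>0: "0 < \<delta>0" "cball 0 \<delta>0 \<subseteq> B" using B by (auto simp: open_contains_cball)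
  have hol': "deriv \<sigma> holomorphic_on B" "deriv (deriv \<sigma>) holomorphic_on B"
    using hol B(1) by (auto intro: holomorphic_deriv)
  have "bounded (deriv (deriv \<sigma>) ` cball 0 \<delta>0)"
    using \<delta>0 hol' by (intro compact_imp_bounded compact_continuous_image)
      (auto intro: holomorphic_on_imp_continuous_on holomorphic_on_subset)
  then obtain C where C: "0 < C" "\<And>z. z \<in> cball 0 \<delta>0 \<Longrightarrow> norm (deriv (deriv \<sigma>) z) \<le> C"
    by (auto simp: bounded_pos)
  have quad: "norm (\<sigma> z - z / 2) \<le> C * norm z ^ 2" if "z \<in> cball 0 \<delta>0" for z
  proof -
    define f where "f i = (deriv ^^ i) \<sigma>" for i :: nat
    have "norm (f 0 z - (\<Sum>i\<le>1. f i 0 * (z - 0) ^ i / fact i)) \<le> C * norm (z - 0) ^ Suc 1 / fact 1"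
    proof (rule complex_Taylor[of "cball 0 \<delta>0"])
      fix i :: nat and x assume x: "x \<in> cball (0::complex) \<delta>0" and "i \<le> 1"
      then have "i = 0 \<or> i = 1" by auto
      then have "f i holomorphic_on B" using hol hol' by (auto simp: f_def)
      then have "(f i has_field_derivative deriv (f i) x) (at x)"
        using B(1) \<delta>0(2) x by (intro holomorphic_derivI) auto
      then show "(f i has_field_derivative f (Suc i) x) (at x within cball 0 \<delta>0)"
        by (simp add: f_def has_field_derivative_at_within)
    qed (use C \<delta>0 that in \<open>auto simp: f_def\<close>)
    then show ?thesis by (simp add: f_def \<sigma>0 power2_eq_square)
  qed
  \<comment> \<open>With \<open>C * \<delta> \<le> 1 / 6\<close> the contraction factor of \<sigma>
    is at most 1/2 + 1/6 = 2/3. This rate is good enough because 2 * (2/3)^2 = 8/9 is less than 1: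
    twice the square of the factor governs the convergence below.\<close>
  define \<delta> where "\<delta> = min \<delta>0 (1 / (6 * C))"
  have \<delta>: "0 < \<delta>" "\<delta> \<le> \<delta>0" "C * \<delta> \<le> 1 / 6"
  proof -
    have "C * \<delta> \<le> C * (1 / (6 * C))" using C by (intro mult_left_mono) (auto simp: \<delta>_def)
    also have "\<dots> = 1 / 6" using C by simp
    finally show "C * \<delta> \<le> 1 / 6" .
  qed (use \<delta>0 C in \<open>auto simp: \<delta>_def\<close>)
  have quad': "norm (\<sigma> z - z / 2) \<le> C * norm z ^ 2" if "z \<in> ball 0 \<delta>" for z
    using that \<delta> by (intro quad) auto
  have contr: "norm (\<sigma> z) \<le> 2 / 3 * norm z" if z: "z \<in> ball 0 \<delta>" for z
  proof -
    have "norm (\<sigma> z) \<le> norm (\<sigma> z - z / 2) + norm (z / 2)"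
      using norm_triangle_ineq[of "\<sigma> z - z / 2" "z / 2"] by simp
    also have "norm (\<sigma> z - z / 2) \<le> C * \<delta> * norm z"
    proof (rule order_trans[OF quad'[OF z]])
      have "C * norm z * norm z \<le> C * \<delta> * norm z"
        using z C(1) by (intro mult_right_mono mult_left_mono) auto
      then show "C * norm z ^ 2 \<le> C * \<delta> * norm z" by (simp only: power2_eq_square mult.assoc)
    qed
    also have "C * \<delta> * norm z \<le> 1 / 6 * norm z" using \<delta>(3) by (intro mult_right_mono) auto
    finally show ?thesis by (simp add: norm_divide)
  qed
  have inB: "\<sigma> z \<in> ball 0 \<delta>" if "z \<in> ball 0 \<delta>" for z
  proof -
    have "norm (\<sigma> z) \<le> norm z" using contr[OF that] norm_ge_zero[of z] by linarith
    then show ?thesis using that by simp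
  qed
  have it: "(\<sigma> ^^ n) z \<in> ball 0 \<delta> \<and> norm ((\<sigma> ^^ n) z) \<le> (2 / 3) ^ n * norm z" if "z \<in> ball 0 \<delta>" for n z
  proof (induction n)
    case (Suc n)
    then have "norm ((\<sigma> ^^ Suc n) z) \<le> 2 / 3 * ((2 / 3) ^ n * norm z)"
      using contr[of "(\<sigma> ^^ n) z"] by simp
    then show ?case using Suc inB by simp
  qed (use that in auto)
  have subB: "ball 0 \<delta> \<subseteq> B" using \<delta>0(2) \<delta>(2) by auto
  have hol_it: "(\<sigma> ^^ n) holomorphic_on ball 0 \<delta>" for n
  proof (induction n)
    case (Suc n)
    have "(\<sigma> \<circ> (\<sigma> ^^ n)) holomorphic_on ball 0 \<delta>"
      by (rule holomorphic_on_compose_gen[OF Suc, of \<sigma> "ball 0 \<delta>"])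
         (use it hol subB in \<open>auto intro: holomorphic_on_subset\<close>)
    then show ?case by (simp only: funpow.simps)
  qed (auto simp: id_def)
  define An where "An n z = 2 ^ n * (\<sigma> ^^ n) z" for n z
  have holAn: "An n holomorphic_on ball 0 \<delta>" for n
    unfolding An_def[abs_def] by (intro holomorphic_intros hol_it)
  have step: "norm (An (Suc n) z - An n z) \<le> 2 * C * (8 / 9) ^ n * norm z ^ 2" if z: "z \<in> ball 0 \<delta>" for n z
  proof -
    let ?u = "(\<sigma> ^^ n) z"
    have "An (Suc n) z - An n z = 2 ^ Suc n * (\<sigma> ?u - ?u / 2)"
      by (simp add: An_def field_simps)
    then have "norm (An (Suc n) z - An n z) = 2 ^ Suc n * norm (\<sigma> ?u - ?u / 2)"
      by (simp add: norm_mult norm_power)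
    also have "\<dots> \<le> 2 ^ Suc n * (C * norm ?u ^ 2)"
      using quad' it[OF z] by (intro mult_left_mono) auto
    also have "\<dots> \<le> 2 ^ Suc n * (C * ((2 / 3) ^ n * norm z) ^ 2)"
      using it[OF z, of n] C by (intro mult_left_mono power_mono) auto
    also have "\<dots> = 2 * C * (2 * (2 / 3) ^ 2) ^ n * norm z ^ 2"
      by (simp only: power_mult_distrib power_mult[symmetric] mult.commute[of 2 n] power_Suc) (simp add: mult_ac)
    finally show ?thesis by (simp add: power2_eq_square)
  qed
  \<comment> \<open>The limit is written as a telescoping series so that the Weierstrass test
    applies to it and a bound for its distance to the identity comes with it.\<close>
  define A where "A z = z + (\<Sum>n. An (Suc n) z - An n z)" for z
  have geo: "summable (\<lambda>n. 2 * C * (8 / 9) ^ n * c)" for c :: real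
    by (intro summable_mult summable_mult2 summable_geometric) auto
  have geosum: "(\<Sum>n. 2 * C * (8 / 9) ^ n * c) = 18 * C * c" for c :: real
    by (simp add: suminf_mult suminf_mult2[symmetric] suminf_geometric summable_geometric)
  have tel: "(\<Sum>k<n. An (Suc k) z - An k z) = An n z - z" for n z
    by (induction n) (simp_all add: An_def)
  have "uniform_limit (ball 0 \<delta>) (\<lambda>n z. \<Sum>k<n. An (Suc k) z - An k z) (\<lambda>z. \<Sum>n. An (Suc n) z - An n z) sequentially"
  proof (rule Weierstrass_m_test)
    show "norm (An (Suc n) z - An n z) \<le> 2 * C * (8 / 9) ^ n * \<delta> ^ 2" if "z \<in> ball 0 \<delta>" for n z
      using that C by (intro order_trans[OF step[OF that]] mult_left_mono power_mono) auto
  qed (rule geo)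
  then have "uniform_limit (ball 0 \<delta>) (\<lambda>n z. z + (\<Sum>k<n. An (Suc k) z - An k z)) A sequentially"
    unfolding A_def[abs_def] by (intro uniform_limit_add uniform_limit_const)
  then have ul: "uniform_limit (ball 0 \<delta>) An A sequentially"
    by (simp add: tel)
  have holA: "A holomorphic_on ball 0 \<delta>"
  proof (rule holomorphic_uniform_sequence[OF open_ball holAn])
    fix x :: complex assume "x \<in> ball 0 \<delta>"
    then obtain d where "0 < d" "cball x d \<subseteq> ball 0 \<delta>" by (meson open_ball open_contains_cball)
    then show "\<exists>d. 0 < d \<and> cball x d \<subseteq> ball 0 \<delta> \<and> uniform_limit (cball x d) An A sequentially"
      using uniform_limit_on_subset[OF ul] by blast
  qed
  have lim: "(\<lambda>n. An n z) \<longlonglongrightarrow> A z" if "z \<in> ball 0 \<delta>" for z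
    using tendsto_uniform_limitI[OF ul that] .
  have A2: "A (\<sigma> z) = A z / 2" if z: "z \<in> ball 0 \<delta>" for z
  proof -
    have "An n (\<sigma> z) = An (Suc n) z / 2" for n
      by (simp add: An_def funpow_swap1)
    then have "(\<lambda>n. An n (\<sigma> z)) \<longlonglongrightarrow> A z / 2"
      using LIMSEQ_Suc[OF lim[OF z]] by (simp only:) (intro tendsto_intros, auto)
    then show ?thesis using lim[OF inB[OF z]] LIMSEQ_unique by blast
  qed
  \<comment> \<open>The constant is the geometric sum 2 C / (1 - 8/9). A quadratic bound yields both
    \<open>A 0 = 0\<close> and the derivative 1 at the origin.\<close>
  have Aid: "norm (A z - z) \<le> 18 * C * norm z ^ 2" if z: "z \<in> ball 0 \<delta>" for z
  proof -
    have s: "summable (\<lambda>n. norm (An (Suc n) z - An n z))"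
      by (rule summable_comparison_test'[OF geo[of "norm z ^ 2"], of 0]) (use step[OF z] in simp)
    have "norm (A z - z) \<le> (\<Sum>n. norm (An (Suc n) z - An n z))"
      unfolding A_def using summable_norm[OF s] by simp
    also have "\<dots> \<le> (\<Sum>n. 2 * C * (8 / 9) ^ n * norm z ^ 2)"
      by (rule suminf_le[OF step[OF z] s geo])
    finally show ?thesis by (simp only: geosum)
  qed
  have A0: "A 0 = 0" using Aid[of 0] \<delta>(1) by simp
  have "((\<lambda>h. A h / h - 1) \<longlongrightarrow> 0) (at 0)"
  proof (rule Lim_null_comparison)
    have "\<forall>\<^sub>F h in at 0. h \<in> ball 0 \<delta> \<and> h \<noteq> (0::complex)"
      using \<delta>(1) eventually_at_ball[of \<delta> 0 UNIV] by (auto simp: eventually_at_filter elim: eventually_mono)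
    then show "\<forall>\<^sub>F h in at 0. norm (A h / h - 1) \<le> 18 * C * norm h"
    proof eventually_elim
      case (elim h)
      have "A h / h - 1 = (A h - h) / h" using elim by (simp add: field_simps)
      then have "norm (A h / h - 1) = norm (A h - h) / norm h" by (simp add: norm_divide)
      also have "\<dots> \<le> 18 * C * norm h ^ 2 / norm h" using Aid elim by (intro divide_right_mono) auto
      finally show ?case using elim by (simp add: power2_eq_square)
    qed
    show "((\<lambda>h. 18 * C * norm h) \<longlongrightarrow> 0) (at (0::complex))"
      by (rule tendsto_eq_intros refl | simp)+
  qed
  then have "((\<lambda>h. A h / h) \<longlongrightarrow> 1) (at 0)"
    using tendsto_add[of "\<lambda>h. A h / h - 1" 0 "at 0" "\<lambda>_. 1" 1] by simp
  then have "(A has_field_derivative 1) (at 0)" by (simp add: DERIV_def A0)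
  then show ?thesis by (rule that[OF \<delta>(1) subB holA A0]) (intro ballI conjI inB A2)
qed

text \<open>Iterates of the expanding map s leave every small disc, so the linearization is built
  for the local inverse, whose multiplier is 1/2. Inserting \<open>s x\<close> into its functional
  equation gives the one for s.\<close>

lemma real_analytic_koenigs:
  fixes s :: "real \<Rightarrow> real"
  assumes ra: "real_analytic_at (\<lambda>p. s (fst p)) (0, 0)" and s0: "s 0 = 0"
    and ds: "(s has_real_derivative 2) (at 0)"
  obtains A where "real_analytic_at (\<lambda>p. A (fst p)) (0, 0)" "A 0 = 0" "(A has_real_derivative 1) (at 0)"
    "\<forall>\<^sub>F x in nhds 0. A (s x) = 2 * A x"
proof -
  obtain S H where S: "open S" "cplx (0, 0) \<in> S" "hol2_on S H"
    "\<And>q. cplx q \<in> S \<Longrightarrow> H (cplx q) = of_real (s (fst q))"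
    using real_analytic_at_imp_hol2[OF ra] by blast
  define T where "T = (\<lambda>z. (z, 0)) -` S"
  have T: "open T" "0 \<in> T"
    using S(1,2) unfolding T_def
    by (auto intro!: continuous_open_vimage continuous_intros simp: cplx_def)
  define Sc where "Sc z = H (z, 0)" for z
  have Sc_real: "Sc (of_real x) = of_real (s x)" if "of_real x \<in> T" for x
    using that S(4)[of "(x, 0)"] by (simp add: Sc_def T_def cplx_def)
  obtain Hz Hw where Hz: "\<And>p. p \<in> S \<Longrightarrow> (H has_derivative (\<lambda>h. Hz p * fst h + Hw p * snd h)) (at p)"
    using S(3) unfolding hol2_on_def by blast
  have dSc: "(Sc has_field_derivative Hz (z, 0)) (at z)" if "z \<in> T" for z
  proof -
    have "((\<lambda>z. H (z, 0)) has_derivative (\<lambda>h. Hz (z, 0) * fst (h, 0::complex) + Hw (z, 0) * snd (h, 0::complex))) (at z)"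
      by (rule has_derivative_compose[where f = "\<lambda>z. (z, 0)" and g = H, OF _ Hz])
         (use that in \<open>auto intro!: derivative_eq_intros simp: T_def\<close>)
    then show ?thesis by (simp add: has_field_derivative_def Sc_def[abs_def])
  qed
  have holSc: "Sc holomorphic_on T"
    using dSc T(1) by (auto simp: holomorphic_on_open)
  have op: "open ((of_real :: real \<Rightarrow> complex) -` T)" by (intro continuous_open_vimage T continuous_intros)
  have ev_T: "\<forall>\<^sub>F x in nhds (0::real). of_real x \<in> T"
    using eventually_nhds_in_open[OF op, of 0] T(2) by simp
  \<comment> \<open>The derivative of s along the real axis determines the complex derivative of the
    extension.\<close>
  have deriv2: "deriv Sc 0 = 2"
  proof -
    have "((\<lambda>x. Sc (of_real x)) has_vector_derivative Hz (0, 0)) (at (0::real))"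
      using has_vector_derivative_real_field[of Sc "Hz (0, 0)" 0 UNIV] dSc[OF T(2)] by simp
    moreover have "((\<lambda>x. complex_of_real (s x)) has_vector_derivative of_real 2) (at 0)"
      using ds by (intro has_vector_derivative_of_real) (simp add: has_real_derivative_iff_has_vector_derivative)
    then have "((\<lambda>x. Sc (of_real x)) has_vector_derivative of_real 2) (at (0::real))"
      by (rule has_vector_derivative_transform_within_open[OF _ op]) (use T(2) Sc_real in auto)
    ultimately have "Hz (0, 0) = 2" using vector_derivative_unique_at by fastforce
    then show ?thesis using DERIV_imp_deriv[OF dSc[OF T(2)]] by simp
  qed
  obtain r where r: "r > 0" "ball 0 r \<subseteq> T" "open (Sc ` ball 0 r)" "inj_on Sc (ball 0 r)"
    using has_complex_derivative_locally_invertible[OF holSc T(2,1)] deriv2 by auto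
  have holr: "Sc holomorphic_on ball 0 r" using holSc r(2) by (rule holomorphic_on_subset)
  obtain \<sigma> where \<sigma>: "\<sigma> holomorphic_on (Sc ` ball 0 r)"
      "\<And>z. z \<in> ball 0 r \<Longrightarrow> deriv Sc z * deriv \<sigma> (Sc z) = 1" "\<And>z. z \<in> ball 0 r \<Longrightarrow> \<sigma> (Sc z) = z"
    using holomorphic_has_inverse[OF holr open_ball r(4)] by blast
  have Sc0: "Sc 0 = 0" using Sc_real[of 0] T(2) s0 by simp
  have "0 \<in> Sc ` ball 0 r" using Sc0 r(1) by (metis centre_in_ball imageI)
  moreover have "\<sigma> 0 = 0" using \<sigma>(3)[of 0] Sc0 r(1) by simp
  moreover have "deriv \<sigma> 0 = 1 / 2" using \<sigma>(2)[of 0] Sc0 r(1) deriv2 by (simp add: field_simps)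
  ultimately obtain A \<delta> where A: "0 < \<delta>" "ball 0 \<delta> \<subseteq> Sc ` ball 0 r" "A holomorphic_on ball 0 \<delta>" "A 0 = 0"
      "(A has_field_derivative 1) (at 0)"
      "\<forall>z\<in>ball 0 \<delta>. \<sigma> z \<in> ball 0 \<delta> \<and> A (\<sigma> z) = A z / 2"
    by (rule holomorphic_koenigs[OF \<sigma>(1) r(3)])
  show ?thesis
  \<comment> \<open>The functional equation is real linear in A, so the real part of a complex
    solution is again a solution on the real axis.\<close>
  proof (rule that[of "\<lambda>x. Re (A (of_real x))"])
    show "real_analytic_at (\<lambda>p. Re (A (of_real (fst p)))) (0, 0)"
      by (rule hol2_imp_real_analytic_at[OF _ _ hol2_on_holomorphic_fst[OF A(3) open_ball]])
         (use A(1) in \<open>auto simp: cplx_def intro!: open_Times\<close>)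
    show "Re (A (of_real 0)) = 0" using A(4) by simp
    have "((\<lambda>x. A (of_real x)) has_vector_derivative 1) (at (0::real))"
      using has_vector_derivative_real_field[of A 1 0 UNIV] A(5) by simp
    from bounded_linear.has_vector_derivative[OF bounded_linear_Re this]
    show "((\<lambda>x. Re (A (of_real x))) has_real_derivative 1) (at 0)"
      by (simp add: has_real_derivative_iff_has_vector_derivative)
    have "isCont s 0" using ds by (rule DERIV_isCont)
    then have "\<forall>\<^sub>F x in nhds 0. s x \<in> ball 0 \<delta>"
      using A(1) s0 by (intro eventually_isCont_in) auto
    moreover have "\<forall>\<^sub>F x in nhds (0::real). x \<in> ball 0 r"
      using r(1) by (intro eventually_nhds_in_open) auto
    ultimately show "\<forall>\<^sub>F x in nhds 0. Re (A (of_real (s x))) = 2 * Re (A (of_real x))"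
      using ev_T
    proof eventually_elim
      case (elim x)
      have "\<sigma> (of_real (s x)) = of_real x"
        using \<sigma>(3)[of "of_real x"] Sc_real elim by simp
      then have "A (of_real (s x)) = 2 * A (of_real x)" using bspec[OF A(6), of "of_real (s x)"] elim(1) by (simp add: mult.commute)
      then show ?case by simp
    qed
  qed
qed

section \<open>Leaves under restriction and diffeomorphisms\<close>

lemma analytic_diffeo_onD:
  assumes "analytic_diffeo_on \<phi> A"
  shows "open A" "open (\<phi> ` A)" "inj_on \<phi> A" "continuous_on A \<phi>" "continuous_on (\<phi> ` A) (inv_into A \<phi>)"
    "\<And>p. p \<in> A \<Longrightarrow> real_analytic_at \<phi> p" "\<And>q. q \<in> \<phi> ` A \<Longrightarrow> real_analytic_at (inv_into A \<phi>) q"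
  using assms unfolding analytic_diffeo_on_def
  by (auto intro!: continuous_at_imp_continuous_on real_analytic_at_plane_isCont)

lemma path_component_set_Int_eq:
  assumes "x \<in> T" "T \<subseteq> S"
  shows "path_component_set (path_component_set S x \<inter> T) x = path_component_set T x"
proof
  show "path_component_set (path_component_set S x \<inter> T) x \<subseteq> path_component_set T x"
    by (rule path_component_mono) simp
  have "path_component_set T x \<subseteq> path_component_set S x \<inter> T"
    using path_component_mono[OF assms(2)] path_component_subset by blast
  then show "path_component_set T x \<subseteq> path_component_set (path_component_set S x \<inter> T) x"
    using assms(1) by (intro path_component_maximal) (auto simp: path_component_refl)
qed

text \<open>Every path in T is a path in S and therefore stays in one component of S; cutting S into
  components beforehand does not affect the components of T.\<close>

lemma path_components_Int:
  assumes "T \<subseteq> S"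
  shows "(\<Union>C\<in>path_components S. path_components (C \<inter> T)) = path_components T"
proof (intro equalityI subsetI)
  fix D assume "D \<in> (\<Union>C\<in>path_components S. path_components (C \<inter> T))"
  then obtain y z where z: "z \<in> path_component_set S y" "z \<in> T"
      and D: "D = path_component_set (path_component_set S y \<inter> T) z"
    unfolding path_components_def by blast
  have "path_component_set S y = path_component_set S z"
    using z(1) path_component_eq by blast
  then have "D = path_component_set T z" using D path_component_set_Int_eq[OF z(2) assms] by simp
  then show "D \<in> path_components T" using z(2) by (auto simp: path_components_def)
next
  fix D assume "D \<in> path_components T"
  then obtain z where z: "z \<in> T" "D = path_component_set T z" by (auto simp: path_components_def)
  have "D = path_component_set (path_component_set S z \<inter> T) z"
    using z path_component_set_Int_eq[OF z(1) assms] by simp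
  moreover have "z \<in> path_component_set S z" using z(1) assms by (auto simp: path_component_refl)
  ultimately show "D \<in> (\<Union>C\<in>path_components S. path_components (C \<inter> T))"
    using z(1) assms unfolding path_components_def by blast
qed

lemma path_components_subset: "C \<in> path_components S \<Longrightarrow> C \<subseteq> S"
  unfolding path_components_def using path_component_subset by blast

text \<open>Restriction does not depend on intermediate neighbourhoods. This allows statements known
  on different neighbourhoods of M to be compared on a common smaller one.\<close>

lemma restrict_foliation_restrict:
  assumes "N' \<subseteq> N"
  shows "restrict_foliation (restrict_foliation F N) N' = restrict_foliation F N'"
proof -
  have "(\<Union>C\<in>path_components (L \<inter> N). path_components (C \<inter> N')) = path_components (L \<inter> N')" for L
  proof -
    have "C \<inter> N' = C \<inter> (L \<inter> N')" if "C \<in> path_components (L \<inter> N)" for C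
      using path_components_subset[OF that] by blast
    then have "(\<Union>C\<in>path_components (L \<inter> N). path_components (C \<inter> N')) =
        (\<Union>C\<in>path_components (L \<inter> N). path_components (C \<inter> (L \<inter> N')))" by simp
    also have "\<dots> = path_components (L \<inter> N')"
      using assms by (intro path_components_Int) blast
    finally show ?thesis .
  qed
  then show ?thesis by (simp add: restrict_foliation_def UN_UN_flatten)
qed

lemma level_foliation_eq_restrict:
  "level_foliation u N = restrict_foliation (range (\<lambda>c. {p. u p = c})) N"
  by (simp add: level_foliation_def restrict_foliation_def Int_def conj_commute)

lemma restrict_level_foliation:
  "N' \<subseteq> N \<Longrightarrow> restrict_foliation (level_foliation u N) N' = level_foliation u N'"
  by (simp add: level_foliation_eq_restrict restrict_foliation_restrict)

lemma restrict_foliation_level_subset: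
  "restrict_foliation F N = level_foliation u N \<Longrightarrow> N' \<subseteq> N \<Longrightarrow> restrict_foliation F N' = level_foliation u N'"
  by (metis restrict_foliation_restrict restrict_level_foliation)

text \<open>Levels are indexed by points instead of values, so that two functions with the same
  level sets but different values can be compared.\<close>

lemma level_foliation_alt:
  "level_foliation u N = (\<Union>p\<in>N. path_components {q \<in> N. u q = u p})"
proof (intro equalityI subsetI)
  fix D assume "D \<in> level_foliation u N"
  then obtain c where D: "D \<in> path_components {p \<in> N. u p = c}" by (auto simp: level_foliation_def)
  then obtain p where "p \<in> N" "u p = c" by (auto simp: path_components_def)
  then show "D \<in> (\<Union>p\<in>N. path_components {q \<in> N. u q = u p})" using D by blast
qed (auto simp: level_foliation_def)

text \<open>Only the partition into level sets matters; in particular a first integral may be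
  composed with any function injective on its range.\<close>

lemma level_foliation_cong:
  assumes "\<And>p q. p \<in> N \<Longrightarrow> q \<in> N \<Longrightarrow> u p = u q \<longleftrightarrow> v p = v q"
  shows "level_foliation u N = level_foliation v N"
proof -
  have "{q \<in> N. u q = u p} = {q \<in> N. v q = v p}" if "p \<in> N" for p using assms that by blast
  then show ?thesis by (simp add: level_foliation_alt)
qed

lemma level_foliation_eq_valueD:
  assumes "C \<in> level_foliation u N" "p \<in> C" "q \<in> C"
  shows "u p = u q"
  using assms path_components_subset unfolding level_foliation_def by blast

lemma path_components_image:
  assumes d: "analytic_diffeo_on \<phi> N" and S: "S \<subseteq> N"
  shows "image \<phi> ` path_components S = path_components (\<phi> ` S)"
proof -
  note D = analytic_diffeo_onD[OF d]
  let ?i = "inv_into N \<phi>"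
  have iS: "?i ` \<phi> ` S = S" using D(3) S by (rule inv_into_image_cancel)
  have eq: "\<phi> ` path_component_set S x = path_component_set (\<phi> ` S) (\<phi> x)" if x: "x \<in> S" for x
  proof
    show "\<phi> ` path_component_set S x \<subseteq> path_component_set (\<phi> ` S) (\<phi> x)"
    proof (rule path_component_maximal)
      show "\<phi> x \<in> \<phi> ` path_component_set S x" using x by (auto simp: path_component_refl)
      show "path_connected (\<phi> ` path_component_set S x)"
        using path_component_subset[of S x] S
        by (intro path_connected_continuous_image continuous_on_subset[OF D(4)]) auto
      show "\<phi> ` path_component_set S x \<subseteq> \<phi> ` S" using path_component_subset[of S x] by blast
    qed
    have "?i ` path_component_set (\<phi> ` S) (\<phi> x) \<subseteq> path_component_set S x"
    proof (rule path_component_maximal)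
      have "?i (\<phi> x) = x" using x S D(3) by auto
      moreover have "\<phi> x \<in> path_component_set (\<phi> ` S) (\<phi> x)" using x by (auto simp: path_component_refl)
      ultimately show "x \<in> ?i ` path_component_set (\<phi> ` S) (\<phi> x)" by (metis imageI)
      show "path_connected (?i ` path_component_set (\<phi> ` S) (\<phi> x))"
        using path_component_subset[of "\<phi> ` S" "\<phi> x"] S
        by (intro path_connected_continuous_image continuous_on_subset[OF D(5)]) auto
      show "?i ` path_component_set (\<phi> ` S) (\<phi> x) \<subseteq> S"
        using image_mono[OF path_component_subset[of "\<phi> ` S" "\<phi> x"], of ?i] iS by simp
    qed
    then have "\<phi> ` ?i ` path_component_set (\<phi> ` S) (\<phi> x) \<subseteq> \<phi> ` path_component_set S x" by (rule image_mono)
    moreover have "\<phi> ` ?i ` path_component_set (\<phi> ` S) (\<phi> x) = path_component_set (\<phi> ` S) (\<phi> x)"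
      by (rule image_inv_into_cancel[OF refl])
         (use path_component_subset[of "\<phi> ` S" "\<phi> x"] S in blast)
    ultimately show "path_component_set (\<phi> ` S) (\<phi> x) \<subseteq> \<phi> ` path_component_set S x" by simp
  qed
  then show ?thesis unfolding path_components_def image_image by (intro image_cong refl)
qed

lemma restrict_foliation_image:
  assumes d: "analytic_diffeo_on \<phi> N" and F: "\<Union>F \<subseteq> N" and N': "N' \<subseteq> N"
  shows "image \<phi> ` restrict_foliation F N' = restrict_foliation (image \<phi> ` F) (\<phi> ` N')"
proof -
  have "image \<phi> ` path_components (L \<inter> N') = path_components (\<phi> ` L \<inter> \<phi> ` N')" if "L \<in> F" for L
  proof -
    have "\<phi> ` (L \<inter> N') = \<phi> ` L \<inter> \<phi> ` N'"
      using analytic_diffeo_onD(3)[OF d] F N' that by (intro inj_on_image_Int) auto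
    moreover have "L \<inter> N' \<subseteq> N" using N' by blast
    ultimately show ?thesis using path_components_image[OF d] by simp
  qed
  then show ?thesis by (simp add: restrict_foliation_def image_UN)
qed

lemma restrict_foliation_subset: "\<Union>(restrict_foliation F N) \<subseteq> N"
  using path_components_subset unfolding restrict_foliation_def by blast

text \<open>Restricting in two stages reduces the claim to leaves that already lie in N, where
  \<phi> is injective and commutes with intersections.\<close>

lemma maps_restrict_foliation_subset:
  assumes d: "analytic_diffeo_on \<phi> N" and N': "N' \<subseteq> N"
    and maps: "image \<phi> ` restrict_foliation F N = restrict_foliation G (\<phi> ` N)"
  shows "image \<phi> ` restrict_foliation F N' = restrict_foliation G (\<phi> ` N')"
proof -
  have "image \<phi> ` restrict_foliation F N' = image \<phi> ` restrict_foliation (restrict_foliation F N) N'"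
    by (simp add: restrict_foliation_restrict[OF N'])
  also have "\<dots> = restrict_foliation (image \<phi> ` restrict_foliation F N) (\<phi> ` N')"
    by (rule restrict_foliation_image[OF d restrict_foliation_subset N'])
  also have "\<dots> = restrict_foliation G (\<phi> ` N')"
    unfolding maps by (rule restrict_foliation_restrict[OF image_mono[OF N']])
  finally show ?thesis .
qed

text \<open>The hypothesis compares equalities of values rather than values, so it also covers a map
  under which a first integral changes sign.\<close>

lemma level_foliation_image:
  assumes d: "analytic_diffeo_on \<phi> N"
    and uv: "\<And>p q. p \<in> N \<Longrightarrow> q \<in> N \<Longrightarrow> u p = u q \<longleftrightarrow> v (\<phi> p) = v (\<phi> q)"
  shows "image \<phi> ` level_foliation u N = level_foliation v (\<phi> ` N)"
proof -
  have "image \<phi> ` path_components {q \<in> N. u q = u p} = path_components {q \<in> \<phi> ` N. v q = v (\<phi> p)}"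
    if "p \<in> N" for p
  proof -
    have "\<phi> ` {q \<in> N. u q = u p} = {q \<in> \<phi> ` N. v q = v (\<phi> p)}"
      using uv[OF _ that] by (simp add: Compr_image_eq conj_commute cong: conj_cong)
    then show ?thesis using path_components_image[OF d, of "{q \<in> N. u q = u p}"] by auto
  qed
  then show ?thesis by (simp add: level_foliation_alt image_UN)
qed

text \<open>A chart is only needed for the source foliation: its plaques in a convex chart domain are
  connected, and connectedness is what keeps the image inside one leaf.\<close>

lemma maps_foliation_level:
  assumes \<kappa>: "analytic_diffeo_on \<kappa> N0" "M \<in> N0" "restrict_foliation F N0 = level_foliation (\<lambda>p. fst (\<kappa> p)) N0"
    and \<phi>: "analytic_diffeo_on \<phi> N1" "M \<in> N1" "image \<phi> ` restrict_foliation F N1 = restrict_foliation G (\<phi> ` N1)"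
    and v: "open N2" "\<phi> M \<in> N2" "restrict_foliation G N2 = level_foliation v N2"
  shows "\<exists>N. open N \<and> M \<in> N \<and> (\<forall>p\<in>N. \<forall>q\<in>N. fst (\<kappa> p) = fst (\<kappa> q) \<longrightarrow> v (\<phi> p) = v (\<phi> q))"
proof -
  note C = analytic_diffeo_onD[OF \<kappa>(1)] and P = analytic_diffeo_onD[OF \<phi>(1)]
  let ?i = "inv_into N0 \<kappa>"
  \<comment> \<open>On this set the leaves of F are described by \<kappa> and are mapped by \<phi>,
    while their images lie where the leaves of G are described by v.\<close>
  define N' where "N' = N0 \<inter> (N1 \<inter> \<phi> -` N2)"
  have "open (N1 \<inter> \<phi> -` N2)" using P(4,1) v(1) continuous_on_open_vimage by (metis Int_commute)
  then have opN': "open N'" unfolding N'_def using C(1) by blast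
  have MN': "M \<in> N'" using \<kappa> \<phi> v by (simp add: N'_def)
  have "open (\<kappa> ` N0 \<inter> ?i -` N')" using C(5,2) opN' continuous_on_open_vimage by (metis Int_commute)
  moreover have "\<kappa> M \<in> \<kappa> ` N0 \<inter> ?i -` N'" using \<kappa>(2) C(3) MN' by auto
  ultimately obtain r where r: "0 < r" "ball (\<kappa> M) r \<subseteq> \<kappa> ` N0 \<inter> ?i -` N'" by (rule openE)
  define N where "N = N0 \<inter> \<kappa> -` ball (\<kappa> M) r"
  have "open N" unfolding N_def using C(4,1) continuous_on_open_vimage by (metis Int_commute open_ball)
  moreover have "M \<in> N" using \<kappa>(2) r by (simp add: N_def)
  moreover have "v (\<phi> p) = v (\<phi> q)" if pq: "p \<in> N" "q \<in> N" "fst (\<kappa> p) = fst (\<kappa> q)" for p q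
  proof -
    let ?E = "closed_segment (\<kappa> p) (\<kappa> q)"
    have E: "?E \<subseteq> ball (\<kappa> M) r"
      using pq by (intro closed_segment_subset convex_ball) (auto simp: N_def)
    have fstE: "fst z = fst (\<kappa> p)" if z: "z \<in> ?E" for z
    proof -
      obtain u where "z = (1 - u) *\<^sub>R \<kappa> p + u *\<^sub>R \<kappa> q" using z by (auto simp: in_segment)
      then have "fst z = (1 - u) * fst (\<kappa> p) + u * fst (\<kappa> q)" by simp
      then show ?thesis using pq(3) by (simp add: algebra_simps)
    qed
    let ?S = "{x \<in> N'. fst (\<kappa> x) = fst (\<kappa> p)}"
    have inv: "?i (\<kappa> p) = p" "?i (\<kappa> q) = q" using pq C(3) by (auto simp: N_def)
    have pE: "p \<in> ?i ` ?E" and qE: "q \<in> ?i ` ?E"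
      using imageI[OF ends_in_segment(1)[where a = "\<kappa> p" and b = "\<kappa> q"], of ?i]
        imageI[OF ends_in_segment(2)[where a = "\<kappa> p" and b = "\<kappa> q"], of ?i] by (simp_all only: inv)
    have sub: "?i ` ?E \<subseteq> path_component_set ?S p"
    proof (rule path_component_maximal)
      show "p \<in> ?i ` ?E" by (rule pE)
      show "path_connected (?i ` ?E)"
        using E r by (intro path_connected_continuous_image continuous_on_subset[OF C(5)]
             convex_imp_path_connected convex_closed_segment) auto
      show "?i ` ?E \<subseteq> ?S"
      proof
        fix x assume "x \<in> ?i ` ?E"
        then obtain z where z: "z \<in> ?E" "x = ?i z" by blast
        then have "z \<in> \<kappa> ` N0" "x \<in> N'" using E r by auto
        then show "x \<in> ?S" using fstE[OF z(1)] z(2) f_inv_into_f[of z \<kappa> N0] by simp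
      qed
    qed
    have p: "p \<in> path_component_set ?S p" and q: "q \<in> path_component_set ?S p"
      using subsetD[OF sub pE] subsetD[OF sub qE] .
    have "path_component_set ?S p \<in> level_foliation (\<lambda>p. fst (\<kappa> p)) N'"
      using subsetD[OF path_component_subset p] unfolding level_foliation_def path_components_def
      by (intro UN_I[of "fst (\<kappa> p)"] imageI) simp_all
    also have "level_foliation (\<lambda>p. fst (\<kappa> p)) N' = restrict_foliation F N'"
      using restrict_foliation_level_subset[OF \<kappa>(3), of N'] by (auto simp: N'_def)
    finally have "\<phi> ` path_component_set ?S p \<in> image \<phi> ` restrict_foliation F N'" by blast
    also have "\<dots> = restrict_foliation G (\<phi> ` N')"
      by (rule maps_restrict_foliation_subset[OF \<phi>(1) _ \<phi>(3)]) (auto simp: N'_def)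
    also have "\<dots> = level_foliation v (\<phi> ` N')"
      by (rule restrict_foliation_level_subset[OF v(3)]) (auto simp: N'_def)
    finally show ?thesis by (rule level_foliation_eq_valueD[OF _ imageI[OF p] imageI[OF q]])
  qed
  ultimately show ?thesis by blast
qed

section \<open>Operations on analytic diffeomorphisms\<close>

lemma real_analytic_at_plane_compose:
  fixes \<phi> \<psi> :: "plane \<Rightarrow> plane"
  assumes \<phi>: "real_analytic_at \<phi> p" and \<psi>: "real_analytic_at \<psi> (\<phi> p)"
  shows "real_analytic_at (\<lambda>q. \<psi> (\<phi> q)) p"
proof -
  have \<phi>': "real_analytic_at (\<lambda>q. fst (\<phi> q)) p" "real_analytic_at (\<lambda>q. snd (\<phi> q)) p"
    using \<phi> by (simp_all add: real_analytic_at_plane_iff)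
  have \<psi>': "real_analytic_at (\<lambda>q. fst (\<psi> q)) (fst (\<phi> p), snd (\<phi> p))"
     "real_analytic_at (\<lambda>q. snd (\<psi> q)) (fst (\<phi> p), snd (\<phi> p))"
    using \<psi> by (simp_all add: real_analytic_at_plane_iff)
  show ?thesis
    using real_analytic_at_compose[OF \<psi>'(1) \<phi>'] real_analytic_at_compose[OF \<psi>'(2) \<phi>']
    by (simp add: real_analytic_at_plane_iff)
qed

lemma real_analytic_at_comp_plane:
  fixes f :: "plane \<Rightarrow> real" and \<phi> :: "plane \<Rightarrow> plane"
  assumes f: "real_analytic_at f (\<phi> p)" and \<phi>: "real_analytic_at \<phi> p"
  shows "real_analytic_at (\<lambda>q. f (\<phi> q)) p"
  using real_analytic_at_compose[of f "\<lambda>q. fst (\<phi> q)" p "\<lambda>q. snd (\<phi> q)"] assms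
  by (simp add: real_analytic_at_plane_iff)

lemma real_analytic_at_Pair:
  fixes f g :: "plane \<Rightarrow> real"
  shows "real_analytic_at f p \<Longrightarrow> real_analytic_at g p \<Longrightarrow> real_analytic_at (\<lambda>q. (f q, g q)) p"
  by (simp add: real_analytic_at_plane_iff)

lemma real_analytic_at_plane_has_derivative:
  fixes \<phi> :: "plane \<Rightarrow> plane"
  assumes "real_analytic_at \<phi> p"
  obtains D where "(\<phi> has_derivative D) (at p)"
proof -
  have ra: "real_analytic_at (\<lambda>q. fst (\<phi> q)) p" "real_analytic_at (\<lambda>q. snd (\<phi> q)) p"
    using assms by (simp_all add: real_analytic_at_plane_iff)
  obtain a b where 1: "((\<lambda>q. fst (\<phi> q)) has_derivative (\<lambda>h. a * fst h + b * snd h)) (at p)"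
    using real_analytic_at_has_derivative[OF ra(1)] .
  obtain c d where 2: "((\<lambda>q. snd (\<phi> q)) has_derivative (\<lambda>h. c * fst h + d * snd h)) (at p)"
    using real_analytic_at_has_derivative[OF ra(2)] .
  from has_derivative_Pair[OF 1 2] show ?thesis using that by simp
qed

text \<open>The function \<open>inv_into\<close> changes with the set, so analyticity of the new
  inverse is transferred from the old one by their agreement near each image point, which rests on
  the openness of the image.\<close>

lemma analytic_diffeo_on_subset:
  assumes d: "analytic_diffeo_on \<phi> A" and A': "open A'" "A' \<subseteq> A"
  shows "analytic_diffeo_on \<phi> A'"
proof -
  note D = analytic_diffeo_onD[OF d]
  have inj': "inj_on \<phi> A'" using D(3) A'(2) by (rule inj_on_subset)
  have "\<phi> ` A' = \<phi> ` A \<inter> inv_into A \<phi> -` A'" using A'(2) D(3) by auto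
  moreover have "open (\<phi> ` A \<inter> inv_into A \<phi> -` A')"
    using D(5,2) A'(1) continuous_on_open_vimage by (metis Int_commute)
  ultimately have op: "open (\<phi> ` A')" by simp
  have "real_analytic_at (inv_into A' \<phi>) q" if q: "q \<in> \<phi> ` A'" for q
  proof (rule real_analytic_at_cong)
    show "real_analytic_at (inv_into A \<phi>) q" using D(7) q A'(2) by blast
    show "\<forall>\<^sub>F y in nhds q. inv_into A \<phi> y = inv_into A' \<phi> y"
      using eventually_nhds_in_open[OF op q]
      by eventually_elim (use A'(2) D(3) inj' in auto)
  qed
  then show ?thesis unfolding analytic_diffeo_on_def using A' op inj' D(6) by blast
qed

lemma analytic_diffeo_on_inv:
  assumes d: "analytic_diffeo_on \<phi> A"
  shows "analytic_diffeo_on (inv_into A \<phi>) (\<phi> ` A)"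
proof -
  note D = analytic_diffeo_onD[OF d]
  have im: "inv_into A \<phi> ` \<phi> ` A = A" using D(3) by (simp add: inv_into_image_cancel)
  have inj: "inj_on (inv_into A \<phi>) (\<phi> ` A)" by (rule inj_on_inv_into) simp
  have "real_analytic_at (inv_into (\<phi> ` A) (inv_into A \<phi>)) p" if p: "p \<in> A" for p
  proof (rule real_analytic_at_cong)
    show "real_analytic_at \<phi> p" using D(6) p by blast
    show "\<forall>\<^sub>F y in nhds p. \<phi> y = inv_into (\<phi> ` A) (inv_into A \<phi>) y"
      using eventually_nhds_in_open[OF D(1) p]
    proof eventually_elim
      case (elim y)
      have "inv_into (\<phi> ` A) (inv_into A \<phi>) (inv_into A \<phi> (\<phi> y)) = \<phi> y"
        using inj elim by (intro inv_into_f_f) auto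
      then show ?case using elim D(3) by simp
    qed
  qed
  then show ?thesis unfolding analytic_diffeo_on_def using D im inj by simp
qed

lemma analytic_diffeo_on_compose:
  assumes d: "analytic_diffeo_on \<phi> A" and e: "analytic_diffeo_on \<psi> B" and sub: "\<phi> ` A \<subseteq> B"
  shows "analytic_diffeo_on (\<lambda>p. \<psi> (\<phi> p)) A"
proof -
  have e': "analytic_diffeo_on \<psi> (\<phi> ` A)"
    by (rule analytic_diffeo_on_subset[OF e analytic_diffeo_onD(2)[OF d] sub])
  note D = analytic_diffeo_onD[OF d] and E = analytic_diffeo_onD[OF e']
  have im: "(\<lambda>p. \<psi> (\<phi> p)) ` A = \<psi> ` \<phi> ` A" by (simp add: image_image)
  have inj: "inj_on (\<lambda>p. \<psi> (\<phi> p)) A"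
    using comp_inj_on[OF D(3) E(3)] by (simp add: o_def)
  have "real_analytic_at (inv_into A (\<lambda>p. \<psi> (\<phi> p))) q" if q: "q \<in> \<psi> ` \<phi> ` A" for q
  proof (rule real_analytic_at_cong)
    have "inv_into (\<phi> ` A) \<psi> q \<in> \<phi> ` A" using q by (rule inv_into_into)
    then show "real_analytic_at (\<lambda>q. inv_into A \<phi> (inv_into (\<phi> ` A) \<psi> q)) q"
      by (rule real_analytic_at_plane_compose[OF E(7)[OF q] D(7)])
    show "\<forall>\<^sub>F y in nhds q. inv_into A \<phi> (inv_into (\<phi> ` A) \<psi> y) = inv_into A (\<lambda>p. \<psi> (\<phi> p)) y"
      using eventually_nhds_in_open[OF E(2) q]
    proof eventually_elim
      case (elim y)
      then obtain x where x: "x \<in> A" "y = \<psi> (\<phi> x)" by blast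
      have "inv_into A (\<lambda>p. \<psi> (\<phi> p)) y = x" unfolding x(2) using inj x(1) by (rule inv_into_f_f)
      moreover have "inv_into (\<phi> ` A) \<psi> y = \<phi> x" unfolding x(2) using E(3) x(1) by (intro inv_into_f_f) auto
      ultimately show ?case using x(1) D(3) by simp
    qed
  qed
  moreover have "real_analytic_at (\<lambda>p. \<psi> (\<phi> p)) p" if "p \<in> A" for p
    by (rule real_analytic_at_plane_compose[OF D(6)[OF that] E(6)[OF imageI[OF that]]])
  ultimately show ?thesis unfolding analytic_diffeo_on_def im using D E inj by blast
qed

text \<open>An involution is its own inverse, so its analyticity already contains that of the
  inverse. The identity, the central symmetry and the exchange of coordinates are all of this
  kind.\<close>

lemma analytic_diffeo_on_linear_involution:
  fixes L :: "plane \<Rightarrow> plane"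
  assumes "\<And>p. L (L p) = p" "\<And>p. real_analytic_at L p" "open A"
  shows "analytic_diffeo_on L A"
proof -
  have inj: "inj_on L S" for S by (rule inj_on_inverseI[of _ L]) (rule assms(1))
  have inv: "inv_into UNIV L = L"
  proof (rule ext)
    fix p
    have "inv_into UNIV L (L (L p)) = L p" by (rule inv_into_f_f[OF inj]) simp
    then show "inv_into UNIV L p = L p" by (simp add: assms(1))
  qed
  have "range L = UNIV" by (rule surjI[of L L]) (rule assms(1))
  then have "analytic_diffeo_on L UNIV"
    unfolding analytic_diffeo_on_def using assms(2) inj inv by simp
  then show ?thesis using assms(3) by (rule analytic_diffeo_on_subset) simp
qed

lemma analytic_diffeo_on_id: "open A \<Longrightarrow> analytic_diffeo_on (\<lambda>p. p) A"
  by (rule analytic_diffeo_on_linear_involution)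
     (simp_all add: real_analytic_at_plane_iff real_analytic_at_fst real_analytic_at_snd)

lemma analytic_diffeo_on_minus: "open A \<Longrightarrow> analytic_diffeo_on (\<lambda>p. - p) A"
  by (rule analytic_diffeo_on_linear_involution)
     (simp_all add: real_analytic_at_plane_iff real_analytic_at_minus real_analytic_at_fst real_analytic_at_snd)

lemma analytic_diffeo_on_swap: "open A \<Longrightarrow> analytic_diffeo_on (\<lambda>p. (snd p, fst p)) A"
  by (rule analytic_diffeo_on_linear_involution)
     (simp_all add: real_analytic_at_plane_iff real_analytic_at_fst real_analytic_at_snd)

lemma analytic_diffeo_on_inv_has_derivative:
  assumes d: "analytic_diffeo_on \<phi> A" and p: "p \<in> A" and D: "(\<phi> has_derivative D) (at p)"
  obtains E where "(inv_into A \<phi> has_derivative E) (at (\<phi> p))" "\<forall>v. D (E v) = v" "\<forall>v. E (D v) = v"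
proof -
  note F = analytic_diffeo_onD[OF d]
  obtain E where E: "(inv_into A \<phi> has_derivative E) (at (\<phi> p))"
    using real_analytic_at_plane_has_derivative F(7) p by blast
  have inv: "inv_into A \<phi> (\<phi> p) = p" using F(3) p by simp
  have "((\<lambda>q. inv_into A \<phi> (\<phi> q)) has_derivative (\<lambda>v. E (D v))) (at p)"
    by (rule has_derivative_compose[OF D E])
  then have "((\<lambda>q. q) has_derivative (\<lambda>v. E (D v))) (at p)"
    by (rule has_derivative_transform_within_open[OF _ F(1) p]) (use F(3) in simp)
  from fun_cong[OF has_derivative_unique[OF this has_derivative_ident]]
  have ED: "E (D v) = v" for v .
  have "((\<lambda>q. \<phi> (inv_into A \<phi> q)) has_derivative (\<lambda>v. D (E v))) (at (\<phi> p))"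
    by (rule has_derivative_compose[OF E]) (simp only: inv D)
  then have "((\<lambda>q. q) has_derivative (\<lambda>v. D (E v))) (at (\<phi> p))"
    by (rule has_derivative_transform_within_open[OF _ F(2)]) (use p in \<open>auto simp: f_inv_into_f\<close>)
  from fun_cong[OF has_derivative_unique[OF this has_derivative_ident]]
  have DE: "D (E v) = v" for v .
  show ?thesis by (rule that[OF E]) (simp_all add: DE ED)
qed

section \<open>Existence of normal forms\<close>

lemma eventually_isCont_compose:
  assumes "isCont c x" "\<forall>\<^sub>F q in nhds (c x). R q"
  shows "\<forall>\<^sub>F t in nhds x. R (c t)"
proof -
  obtain S where S: "open S" "c x \<in> S" "\<And>q. q \<in> S \<Longrightarrow> R q"
    using assms(2) unfolding eventually_nhds by blast
  show ?thesis
    by (rule eventually_mono[OF eventually_isCont_in[OF assms(1) S(1,2)] S(3)])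
qed

text \<open>This removes the points at which a factor cannot be cancelled: along a curve the
  quotient is known to vanish off the parameter 0 and is continuous there.\<close>

lemma eventually_nhds_zero_of_punctured:
  fixes k :: "real \<Rightarrow> real"
  assumes "isCont k 0" and ev: "\<forall>\<^sub>F t in nhds 0. t \<noteq> 0 \<longrightarrow> k t = 0"
  shows "\<forall>\<^sub>F t in nhds 0. k t = 0"
proof -
  have "(k \<longlongrightarrow> k 0) (at 0)" using assms(1) by (simp add: isCont_def)
  moreover have "(k \<longlongrightarrow> 0) (at 0)"
    using ev by (intro tendsto_eventually) (simp add: eventually_at_filter)
  ultimately have "k 0 = 0" by (rule tendsto_unique[rotated]) simp
  then show ?thesis using ev by (auto elim!: eventually_mono)
qed

text \<open>The factors x, y and x - y are split off one after the other, each being turned into the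
  first coordinate by a linear change. The quotient keeps vanishing on the remaining lines: off the
  origin by cancellation, at the origin by continuity.\<close>

lemma real_analytic_at_divide_xy_diff:
  fixes P :: "plane \<Rightarrow> real"
  assumes P: "real_analytic_at P (0, 0)"
    and z1: "\<forall>\<^sub>F t in nhds 0. P (0, t) = 0" and z2: "\<forall>\<^sub>F t in nhds 0. P (t, 0) = 0"
    and z3: "\<forall>\<^sub>F t in nhds 0. P (t, t) = 0"
  obtains g where "real_analytic_at g (0, 0)"
    "\<forall>\<^sub>F q in nhds (0, 0). P q = fst q * snd q * (fst q - snd q) * g q"
proof -
  obtain Q1 where Q1: "real_analytic_at Q1 (0, 0)" "\<forall>\<^sub>F q in nhds (0, 0). P q = fst q * Q1 q"
    using real_analytic_at_divide_fst[OF P z1] .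
  have "isCont (\<lambda>t. Q1 (t, 0)) 0"
    by (rule isCont_o2[where f = "\<lambda>t. (t, 0)" and g = Q1])
       (auto intro!: continuous_intros real_analytic_at_imp_isCont[OF Q1(1)])
  moreover have "\<forall>\<^sub>F t in nhds 0. t \<noteq> 0 \<longrightarrow> Q1 (t, 0) = 0"
  proof -
    have "\<forall>\<^sub>F t in nhds 0. P (t, 0) = fst (t, 0::real) * Q1 (t, 0)"
      by (rule eventually_isCont_compose[where c = "\<lambda>t. (t, 0)" and R = "\<lambda>q. P q = fst q * Q1 q"]) (use Q1(2) in \<open>auto intro!: continuous_intros\<close>)
    with z2 show ?thesis by eventually_elim auto
  qed
  ultimately have Q1z: "\<forall>\<^sub>F t in nhds 0. Q1 (t, 0) = 0"
    by (rule eventually_nhds_zero_of_punctured)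
  have "real_analytic_at (\<lambda>q. Q1 (snd q, fst q)) (0, 0)"
    by (rule real_analytic_at_compose) (simp_all add: Q1(1) real_analytic_at_fst real_analytic_at_snd)
  then obtain Q2' where Q2': "real_analytic_at Q2' (0, 0)"
      "\<forall>\<^sub>F q in nhds (0, 0). Q1 (snd q, fst q) = fst q * Q2' q"
    using real_analytic_at_divide_fst[of "\<lambda>q. Q1 (snd q, fst q)"] Q1z by auto
  define Q2 where "Q2 q = Q2' (snd q, fst q)" for q
  have raQ2: "real_analytic_at Q2 (0, 0)"
    unfolding Q2_def[abs_def]
    by (rule real_analytic_at_compose) (simp_all add: Q2'(1) real_analytic_at_fst real_analytic_at_snd)
  have Q2: "\<forall>\<^sub>F q in nhds (0, 0). Q1 q = snd q * Q2 q"
  proof -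
    have "\<forall>\<^sub>F q in nhds (0, 0::real). Q1 (snd (snd q, fst q), fst (snd q, fst q)) = fst (snd q, fst q) * Q2' (snd q, fst q)"
      by (rule eventually_isCont_compose[where c = "\<lambda>q. (snd q, fst q)" and R = "\<lambda>q. Q1 (snd q, fst q) = fst q * Q2' q"]) (use Q2'(2) in \<open>auto intro!: continuous_intros\<close>)
    then show ?thesis by (simp add: Q2_def)
  qed
  have "isCont (\<lambda>t. Q2 (t, t)) 0"
    by (rule isCont_o2[where f = "\<lambda>t. (t, t)" and g = Q2])
       (auto intro!: continuous_intros real_analytic_at_imp_isCont[OF raQ2])
  moreover have "\<forall>\<^sub>F t in nhds 0. t \<noteq> 0 \<longrightarrow> Q2 (t, t) = 0"
  proof -
    have "\<forall>\<^sub>F t in nhds 0. P (t, t) = fst (t, t) * Q1 (t, t)"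
      by (rule eventually_isCont_compose[where c = "\<lambda>t. (t, t)" and R = "\<lambda>q. P q = fst q * Q1 q"]) (use Q1(2) in \<open>auto intro!: continuous_intros\<close>)
    moreover have "\<forall>\<^sub>F t in nhds 0. Q1 (t, t) = snd (t, t) * Q2 (t, t)"
      by (rule eventually_isCont_compose[where c = "\<lambda>t. (t, t)" and R = "\<lambda>q. Q1 q = snd q * Q2 q"]) (use Q2 in \<open>auto intro!: continuous_intros\<close>)
    ultimately show ?thesis using z3 by eventually_elim auto
  qed
  ultimately have Q2z: "\<forall>\<^sub>F t in nhds 0. Q2 (t, t) = 0"
    by (rule eventually_nhds_zero_of_punctured)
  \<comment> \<open>The shear takes the line where the first coordinate is zero to the
    diagonal.\<close>
  have "real_analytic_at (\<lambda>q. Q2 (fst q + snd q, snd q)) (0, 0)"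
    by (rule real_analytic_at_compose)
       (simp_all add: raQ2 real_analytic_at_fst real_analytic_at_snd real_analytic_at_add)
  then obtain Q3 where Q3: "real_analytic_at Q3 (0, 0)"
      "\<forall>\<^sub>F q in nhds (0, 0). Q2 (fst q + snd q, snd q) = fst q * Q3 q"
    using real_analytic_at_divide_fst[of "\<lambda>q. Q2 (fst q + snd q, snd q)"] Q2z by auto
  define g where "g q = Q3 (fst q - snd q, snd q)" for q
  have rag: "real_analytic_at g (0, 0)"
    unfolding g_def[abs_def]
    by (rule real_analytic_at_compose)
       (simp_all add: Q3(1) real_analytic_at_fst real_analytic_at_snd real_analytic_at_diff)
  have "\<forall>\<^sub>F q in nhds (0, 0::real). Q2 (fst (fst q - snd q, snd q) + snd (fst q - snd q, snd q), snd (fst q - snd q, snd q))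
       = fst (fst q - snd q, snd q) * Q3 (fst q - snd q, snd q)"
    by (rule eventually_isCont_compose[where c = "\<lambda>q. (fst q - snd q, snd q)" and R = "\<lambda>q. Q2 (fst q + snd q, snd q) = fst q * Q3 q"])
       (use Q3(2) in \<open>auto intro!: continuous_intros\<close>)
  then have "\<forall>\<^sub>F q in nhds (0, 0). Q2 q = (fst q - snd q) * g q" by (simp add: g_def)
  with Q1(2) Q2 have "\<forall>\<^sub>F q in nhds (0, 0). P q = fst q * snd q * (fst q - snd q) * g q"
    by eventually_elim simp
  with rag show ?thesis by (rule that)
qed

text \<open>Analyticity of a function of one variable is expressed throughout as analyticity of its
  composition with the first projection; this carries it over to the second.\<close>

lemma real_analytic_at_comp_snd:
  assumes "real_analytic_at (\<lambda>p. b (fst p) :: real) (0, 0)"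
  shows "real_analytic_at (\<lambda>p. b (snd p)) (0, 0)"
  using real_analytic_at_compose[of "\<lambda>p. b (fst p)" snd "(0, 0)" "\<lambda>_. 0"] assms
  by (simp add: real_analytic_at_snd real_analytic_at_const)

lemma has_derivative_product_map:
  fixes a b :: "real \<Rightarrow> real"
  assumes "(a has_real_derivative \<alpha>) (at 0)" "(b has_real_derivative \<beta>) (at 0)"
  shows "((\<lambda>p. (a (fst p), b (snd p))) has_derivative (\<lambda>k. (\<alpha> * fst k, \<beta> * snd k))) (at (0, 0))"
proof -
  have "((\<lambda>p. a (fst p)) has_derivative (\<lambda>k. \<alpha> * fst k)) (at (0, 0))"
    by (rule has_derivative_compose[where f = fst, OF has_derivative_fst[OF has_derivative_ident]])
       (use assms in \<open>simp add: has_field_derivative_def\<close>)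
  moreover have "((\<lambda>p. b (snd p)) has_derivative (\<lambda>k. \<beta> * snd k)) (at (0, 0))"
    by (rule has_derivative_compose[where f = snd, OF has_derivative_snd[OF has_derivative_ident]])
       (use assms in \<open>simp add: has_field_derivative_def\<close>)
  ultimately show ?thesis by (rule has_derivative_Pair)
qed

lemma analytic_diffeo_on_product_map:
  fixes a b :: "real \<Rightarrow> real"
  assumes a: "real_analytic_at (\<lambda>p. a (fst p)) (0, 0)" "(a has_real_derivative \<alpha>) (at 0)" "\<alpha> \<noteq> 0"
    and b: "real_analytic_at (\<lambda>p. b (fst p)) (0, 0)" "(b has_real_derivative \<beta>) (at 0)" "\<beta> \<noteq> 0"
  obtains B where "(0, 0) \<in> B" "analytic_diffeo_on (\<lambda>p. (a (fst p), b (snd p))) B"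
proof -
  have ra: "real_analytic_at (\<lambda>p. (a (fst p), b (snd p))) (0, 0)"
    by (intro real_analytic_at_Pair a(1) real_analytic_at_comp_snd[OF b(1)])
  have inj: "v = 0" if "(\<alpha> * fst v, \<beta> * snd v) = 0" for v
    using that a(3) b(3) by (simp add: zero_prod_def prod_eq_iff)
  show ?thesis
    by (rule analytic_diffeo_on_nearby[OF ra has_derivative_product_map[OF a(2) b(2)] inj open_UNIV UNIV_I])
       (assumption, rule that)
qed

text \<open>The planar inverse function theorem, applied to a in both coordinates and restricted to
  the horizontal axis, gives the statement in one variable.\<close>

lemma real_analytic_local_inj:
  fixes a :: "real \<Rightarrow> real"
  assumes a: "real_analytic_at (\<lambda>p. a (fst p)) (0, 0)" "(a has_real_derivative \<alpha>) (at 0)" "\<alpha> \<noteq> 0"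
  obtains J where "open J" "0 \<in> J" "inj_on a J"
proof -
  obtain B where B: "(0, 0) \<in> B" "analytic_diffeo_on (\<lambda>p. (a (fst p), a (snd p))) B"
    using analytic_diffeo_on_product_map[OF a a] .
  show ?thesis
  proof (rule that[of "(\<lambda>x. (x, 0)) -` B"])
    show "open ((\<lambda>x. (x, 0)) -` B)"
      using analytic_diffeo_onD(1)[OF B(2)] by (intro continuous_open_vimage) (auto intro!: continuous_intros)
    show "inj_on a ((\<lambda>x. (x, 0)) -` B)"
    proof (rule inj_onI)
      fix x y assume xy: "x \<in> (\<lambda>x. (x, 0)) -` B" "y \<in> (\<lambda>x. (x, 0)) -` B" "a x = a y"
      have "(x, 0) = (y, 0::real)"
        by (rule inj_onD[OF analytic_diffeo_onD(3)[OF B(2)]]) (use xy in auto)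
      then show "x = y" by simp
    qed
  qed (use B in simp)
qed

text \<open>The restrictions \<open>a1\<close> and \<open>b1\<close> of h to the axes are taken as
  coordinates, which gives the two axis relations. The linearization A is then applied to both
  coordinates and to the value of h: the axis relations persist, and the restriction s to the
  diagonal is conjugated to doubling. As A has derivative 1, the derivatives \<alpha> and \<beta>
  are kept.\<close>

lemma analytic_web_function_normal_form:
  fixes h :: "plane \<Rightarrow> real"
  assumes ra: "real_analytic_at h (0, 0)" and h0: "h (0, 0) = 0"
    and dh: "(h has_derivative (\<lambda>k. \<alpha> * fst k + \<beta> * snd k)) (at (0, 0))"
    and nz: "\<alpha> \<noteq> 0" "\<beta> \<noteq> 0"
  obtains a b A g where
    "real_analytic_at (\<lambda>p. a (fst p)) (0, 0)" "a 0 = 0" "(a has_real_derivative \<alpha>) (at 0)"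
    "real_analytic_at (\<lambda>p. b (fst p)) (0, 0)" "b 0 = 0" "(b has_real_derivative \<beta>) (at 0)"
    "real_analytic_at (\<lambda>p. A (fst p)) (0, 0)" "A 0 = 0" "(A has_real_derivative 1) (at 0)"
    "real_analytic_at g (0, 0)"
    "\<forall>\<^sub>F p in nhds (0, 0). A (h p) =
       (\<lambda>(x, y). x + y + x * y * (x - y) * g (x, y)) (a (fst p), b (snd p))"
proof -
  define a1 where "a1 x = h (x, 0)" for x
  define b1 where "b1 y = h (0, y)" for y
  have ra1: "real_analytic_at (\<lambda>p. a1 (fst p)) (0, 0)" unfolding a1_def
    by (rule real_analytic_at_compose) (simp_all add: ra real_analytic_at_fst real_analytic_at_const)
  have rb1: "real_analytic_at (\<lambda>p. b1 (fst p)) (0, 0)" unfolding b1_def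
    by (rule real_analytic_at_compose) (simp_all add: ra real_analytic_at_fst real_analytic_at_const)
  have da1: "(a1 has_real_derivative \<alpha>) (at 0)"
  proof -
    have "((\<lambda>x. (x, 0::real)) has_derivative (\<lambda>x. (x, 0))) (at 0)"
      by (intro has_derivative_Pair has_derivative_ident has_derivative_const)
    from has_derivative_compose[OF this dh] show ?thesis
      by (simp add: has_field_derivative_def a1_def[abs_def])
  qed
  have db1: "(b1 has_real_derivative \<beta>) (at 0)"
  proof -
    have "((\<lambda>x. (0::real, x)) has_derivative (\<lambda>x. (0, x))) (at 0)"
      by (intro has_derivative_Pair has_derivative_ident has_derivative_const)
    from has_derivative_compose[OF this dh] show ?thesis
      by (simp add: has_field_derivative_def b1_def[abs_def])
  qed
  have a10: "a1 0 = 0" and b10: "b1 0 = 0" using h0 by (simp_all add: a1_def b1_def)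
  obtain B1 where B1: "(0, 0) \<in> B1" "analytic_diffeo_on (\<lambda>p. (a1 (fst p), b1 (snd p))) B1"
    using analytic_diffeo_on_product_map[OF ra1 da1 nz(1) rb1 db1 nz(2)] .
  define i1 where "i1 = inv_into B1 (\<lambda>p. (a1 (fst p), b1 (snd p)))"
  note D1 = analytic_diffeo_onD[OF B1(2)]
  have i1: "i1 (a1 (fst p), b1 (snd p)) = p" if "p \<in> B1" for p
    unfolding i1_def using inv_into_f_f[OF D1(3) that] by simp
  have ra_i1: "real_analytic_at i1 (0, 0)"
    using D1(7)[OF imageI[OF B1(1)]] by (simp add: i1_def a10 b10)
  have i10: "i1 (0, 0) = (0, 0)" using i1[OF B1(1)] a10 b10 by simp
  \<comment> \<open>This is h on the diagonal of the coordinates \<open>(a1, b1)\<close>.\<close>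
  define s where "s t = h (i1 (t, t))" for t
  have ras: "real_analytic_at (\<lambda>p. s (fst p)) (0, 0)"
  proof -
    have "real_analytic_at (\<lambda>p. (fst p, fst p)) (0, 0 :: real)"
      by (rule real_analytic_at_Pair) (rule real_analytic_at_fst)+
    then have "real_analytic_at (\<lambda>p. i1 (fst p, fst p)) (0, 0)"
      by (rule real_analytic_at_plane_compose[of "\<lambda>p. (fst p, fst p)"]) (simp add: ra_i1)
    then show ?thesis unfolding s_def
      by (rule real_analytic_at_comp_plane[rotated]) (simp add: i10 ra)
  qed
  have s0: "s 0 = 0" by (simp add: s_def i10 h0)
  have ds: "(s has_real_derivative 2) (at 0)"
  proof -
    \<comment> \<open>In the coordinates \<open>(a1, b1)\<close> the differential of h is the sum of
      the two components; on the diagonal this gives the multiplier 1 + 1 = 2.\<close>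
    obtain E where E': "(inv_into B1 (\<lambda>p. (a1 (fst p), b1 (snd p))) has_derivative E)
        (at (a1 (fst (0, 0 :: real)), b1 (snd (0 :: real, 0))))"
      and E2: "\<forall>v. (\<alpha> * fst (E v), \<beta> * snd (E v)) = v"
      using analytic_diffeo_on_inv_has_derivative[OF B1(2,1) has_derivative_product_map[OF da1 db1]] .
    have E: "(i1 has_derivative E) (at (0, 0))" using E' by (simp add: i1_def a10 b10)
    have "((\<lambda>t. (t, t)) has_derivative (\<lambda>t. (t, t))) (at (0::real))"
      by (intro has_derivative_Pair has_derivative_ident)
    from has_derivative_compose[OF this, of i1 E] E
    have "((\<lambda>t. i1 (t, t)) has_derivative (\<lambda>t. E (t, t))) (at 0)" by simp
    from has_derivative_compose[OF this, of h] dh i10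
    have "(s has_derivative (\<lambda>t. \<alpha> * fst (E (t, t)) + \<beta> * snd (E (t, t)))) (at 0)"
      by (simp add: s_def[abs_def])
    moreover have "\<alpha> * fst (E (t, t)) + \<beta> * snd (E (t, t)) = 2 * t" for t
      using spec[OF E2, of "(t, t)"] by simp
    ultimately show ?thesis by (simp add: has_field_derivative_def)
  qed
  obtain A where A: "real_analytic_at (\<lambda>p. A (fst p)) (0, 0)" "A 0 = 0" "(A has_real_derivative 1) (at 0)"
      "\<forall>\<^sub>F x in nhds 0. A (s x) = 2 * A x"
    using real_analytic_koenigs[OF ras s0 ds] .
  have raA: "real_analytic_at (\<lambda>p. A (k p)) (0, 0)" if "real_analytic_at k (0, 0)" "k (0, 0) = 0" for k :: "plane \<Rightarrow> real"
    using real_analytic_at_compose[of "\<lambda>p. A (fst p)" k "(0, 0)" "\<lambda>_. 0"] that A(1)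
    by (simp add: real_analytic_at_const)
  define a where "a x = A (a1 x)" for x
  define b where "b y = A (b1 y)" for y
  have ra_a: "real_analytic_at (\<lambda>p. a (fst p)) (0, 0)" unfolding a_def by (rule raA[OF ra1]) (simp add: a10)
  have ra_b: "real_analytic_at (\<lambda>p. b (fst p)) (0, 0)" unfolding b_def by (rule raA[OF rb1]) (simp add: b10)
  have a0: "a 0 = 0" and b0: "b 0 = 0" using A(2) a10 b10 by (simp_all add: a_def b_def)
  have da: "(a has_real_derivative \<alpha>) (at 0)"
    using DERIV_chain2[of A 1 a1 0 \<alpha> UNIV] A(3) da1 a10 by (simp add: a_def[abs_def])
  have db: "(b has_real_derivative \<beta>) (at 0)"
    using DERIV_chain2[of A 1 b1 0 \<beta> UNIV] A(3) db1 b10 by (simp add: b_def[abs_def])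
  obtain B2 where B2: "(0, 0) \<in> B2" "analytic_diffeo_on (\<lambda>p. (a (fst p), b (snd p))) B2"
    using analytic_diffeo_on_product_map[OF ra_a da nz(1) ra_b db nz(2)] .
  define \<Psi> where "\<Psi> = (\<lambda>p. (a (fst p), b (snd p)))"
  define i2 where "i2 = inv_into B2 \<Psi>"
  note B2' = B2(2)[folded \<Psi>_def]
  note D2 = analytic_diffeo_onD[OF B2']
  have \<Psi>0: "\<Psi> (0, 0) = (0, 0)" by (simp add: \<Psi>_def a0 b0)
  have i2: "i2 (\<Psi> p) = p" if "p \<in> B2" for p
    unfolding i2_def using D2(3) that by (rule inv_into_f_f)
  have \<Psi>i2: "\<Psi> (i2 q) = q" if "q \<in> \<Psi> ` B2" for q
    unfolding i2_def using that by (rule f_inv_into_f)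
  have ra_i2: "real_analytic_at i2 (0, 0)"
    using D2(7)[OF imageI[OF B2(1)]] by (simp add: i2_def \<Psi>0)
  have i20: "i2 (0, 0) = (0, 0)" using i2[OF B2(1)] \<Psi>0 by simp
  \<comment> \<open>The function that defines the third foliation in the final coordinates.\<close>
  define f0 where "f0 q = A (h (i2 q))" for q
  have raf0: "real_analytic_at f0 (0, 0)"
    unfolding f0_def
    by (rule raA, rule real_analytic_at_comp_plane) (simp_all add: i20 ra ra_i2 h0)
  \<comment> \<open>Injectivity near 0 translates the equations \<open>a x = 0\<close>,
    \<open>b y = 0\<close> and \<open>a x = b y\<close> into \<open>x = 0\<close>,
    \<open>y = 0\<close> and \<open>a1 x = b1 y\<close>, for which h is known.\<close>
  obtain JA where JA: "open JA" "0 \<in> JA" "inj_on A JA" using real_analytic_local_inj[OF A(1,3)] by auto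
  obtain Ja where Ja: "open Ja" "0 \<in> Ja" "inj_on a Ja" using real_analytic_local_inj[OF ra_a da nz(1)] .
  obtain Jb where Jb: "open Jb" "0 \<in> Jb" "inj_on b Jb" using real_analytic_local_inj[OF ra_b db nz(2)] .
  have Ca1: "isCont a1 0" and Cb1: "isCont b1 0" using da1 db1 by (auto intro: DERIV_isCont)
  have fsts: "isCont fst (0, 0 :: real)" "isCont snd (0 :: real, 0)" by (auto intro: continuous_intros)
  let ?R = "\<lambda>p. p \<in> B1 \<and> p \<in> B2 \<and> fst p \<in> Ja \<and> snd p \<in> Jb \<and> a1 (fst p) \<in> JA \<and> b1 (snd p) \<in> JA \<and>
     A (s (a1 (fst p))) = 2 * A (a1 (fst p))"
  have R: "\<forall>\<^sub>F p in nhds (0, 0). ?R p"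
  proof (intro eventually_conj)
    show "\<forall>\<^sub>F p in nhds (0, 0). p \<in> B1" "\<forall>\<^sub>F p in nhds (0, 0). p \<in> B2"
      using B1(1) B2(1) D1(1) D2(1) by (auto intro: eventually_nhds_in_open)
    show "\<forall>\<^sub>F p in nhds (0, 0::real). fst p \<in> Ja" using fsts Ja by (intro eventually_isCont_in) auto
    show "\<forall>\<^sub>F p in nhds (0::real, 0). snd p \<in> Jb" using fsts Jb by (intro eventually_isCont_in) auto
    have c: "isCont (\<lambda>p. a1 (fst p)) (0, 0 :: real)" "isCont (\<lambda>p. b1 (snd p)) (0 :: real, 0)"
      using isCont_o2[OF fsts(1), of a1] isCont_o2[OF fsts(2), of b1] Ca1 Cb1 by simp_all
    show "\<forall>\<^sub>F p in nhds (0, 0::real). a1 (fst p) \<in> JA"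
      using JA a10 by (intro eventually_isCont_in[OF c(1)]) auto
    show "\<forall>\<^sub>F p in nhds (0::real, 0). b1 (snd p) \<in> JA"
      using JA b10 by (intro eventually_isCont_in[OF c(2)]) auto
    show "\<forall>\<^sub>F p in nhds (0, 0::real). A (s (a1 (fst p))) = 2 * A (a1 (fst p))"
      by (rule eventually_isCont_compose[OF c(1), where R = "\<lambda>x. A (s x) = 2 * A x"]) (simp add: a10 A(4))
  qed
  have "\<forall>\<^sub>F q in nhds (0, 0). ?R (i2 q)"
    by (rule eventually_isCont_compose[where c = i2 and x = "(0, 0)" and R = ?R])
       (simp_all only: i20 R real_analytic_at_plane_isCont[OF ra_i2])
  moreover have "\<forall>\<^sub>F q in nhds (0, 0). q \<in> \<Psi> ` B2"
    using D2(2) imageI[OF B2(1), of \<Psi>] \<Psi>0 by (intro eventually_nhds_in_open) simp_all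
  ultimately have ax: "\<forall>\<^sub>F q in nhds (0, 0). (fst q = 0 \<longrightarrow> f0 q = snd q) \<and> (snd q = 0 \<longrightarrow> f0 q = fst q) \<and>
      (fst q = snd q \<longrightarrow> f0 q = 2 * fst q)"
  proof eventually_elim
    case (elim q)
    obtain x y where p: "i2 q = (x, y)" by fastforce
    have q: "q = (a x, b y)" using \<Psi>i2[OF elim(2)] by (simp add: p \<Psi>_def)
    have J: "x \<in> Ja" "y \<in> Jb" "a1 x \<in> JA" "b1 y \<in> JA" "(x, y) \<in> B1" "A (s (a1 x)) = 2 * A (a1 x)"
      using elim(1) by (simp_all add: p)
    have "f0 q = b y" if "a x = 0"
    proof -
      have "x = 0" using inj_onD[OF Ja(3), of x 0] that a0 J(1) Ja(2) by simp
      then show ?thesis by (simp add: f0_def p b_def b1_def)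
    qed
    moreover have "f0 q = a x" if "b y = 0"
    proof -
      have "y = 0" using inj_onD[OF Jb(3), of y 0] that b0 J(2) Jb(2) by simp
      then show ?thesis by (simp add: f0_def p a_def a1_def)
    qed
    moreover have "f0 q = 2 * a x" if "a x = b y"
    proof -
      have "a1 x = b1 y" using inj_onD[OF JA(3), of "a1 x" "b1 y"] that J(3,4) by (simp add: a_def b_def)
      then have "i1 (a1 x, a1 x) = (x, y)" using i1[OF J(5)] by simp
      then show ?thesis using J(6) by (simp add: f0_def p s_def a_def)
    qed
    ultimately show ?case by (simp add: q)
  qed
  define P where "P q = f0 q - fst q - snd q" for q
  have raP: "real_analytic_at P (0, 0)" unfolding P_def
    by (intro real_analytic_at_diff raf0 real_analytic_at_fst real_analytic_at_snd)
  have P0: "\<forall>\<^sub>F q in nhds (0, 0). (fst q = 0 \<longrightarrow> P q = 0) \<and> (snd q = 0 \<longrightarrow> P q = 0) \<and> (fst q = snd q \<longrightarrow> P q = 0)"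
    using ax by eventually_elim (simp add: P_def)
  have curve: "\<forall>\<^sub>F t in nhds 0. (fst (c t) = 0 \<longrightarrow> P (c t) = 0) \<and> (snd (c t) = 0 \<longrightarrow> P (c t) = 0) \<and> (fst (c t) = snd (c t) \<longrightarrow> P (c t) = 0)"
    if "isCont c 0" "c 0 = (0, 0)" for c :: "real \<Rightarrow> plane"
    by (rule eventually_isCont_compose[OF that(1)]) (simp only: that(2) P0)
  obtain g where g: "real_analytic_at g (0, 0)"
    "\<forall>\<^sub>F q in nhds (0, 0). P q = fst q * snd q * (fst q - snd q) * g q"
  proof (rule real_analytic_at_divide_xy_diff[OF raP])
    show "\<forall>\<^sub>F t in nhds 0. P (0, t) = 0" using curve[of "\<lambda>t. (0, t)"] by (auto intro!: continuous_intros elim!: eventually_mono)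
    show "\<forall>\<^sub>F t in nhds 0. P (t, 0) = 0" using curve[of "\<lambda>t. (t, 0)"] by (auto intro!: continuous_intros elim!: eventually_mono)
    show "\<forall>\<^sub>F t in nhds 0. P (t, t) = 0" using curve[of "\<lambda>t. (t, t)"] by (auto intro!: continuous_intros elim!: eventually_mono)
  qed
  have "isCont \<Psi> (0, 0)" by (rule real_analytic_at_plane_isCont[OF D2(6)[OF B2(1)]])
  then have "\<forall>\<^sub>F p in nhds (0, 0). P (\<Psi> p) = fst (\<Psi> p) * snd (\<Psi> p) * (fst (\<Psi> p) - snd (\<Psi> p)) * g (\<Psi> p)"
    by (rule eventually_isCont_compose) (simp only: \<Psi>0 g(2))
  moreover have "\<forall>\<^sub>F p in nhds (0, 0). p \<in> B2" using B2(1) D2(1) by (auto intro: eventually_nhds_in_open)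
  ultimately have "\<forall>\<^sub>F p in nhds (0, 0). A (h p) =
       (\<lambda>(x, y). x + y + x * y * (x - y) * g (x, y)) (a (fst p), b (snd p))"
  proof eventually_elim
    case (elim p)
    have "f0 (\<Psi> p) = A (h p)" using i2[OF elim(2)] by (simp add: f0_def)
    then show ?case using elim(1) by (simp add: P_def \<Psi>_def)
  qed
  with ra_a a0 da ra_b b0 db A(1-3) g(1) show ?thesis by (rule that)
qed

text \<open>This inclusion turns transversality into linear algebra: a vector killed by the
  differentials of two of the first integrals lies in two tangent lines, so it is zero.\<close>

lemma kernel_subset_tangent_line:
  assumes \<kappa>: "foliated_chart F V \<kappa>" "p \<in> V" and d: "((\<lambda>q. fst (\<kappa> q)) has_derivative d) (at p)" "d h = 0"
  shows "h \<in> tangent_line F p"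
proof -
  have "real_analytic_at \<kappa> p" using \<kappa> analytic_diffeo_onD(6) unfolding foliated_chart_def by blast
  then obtain D where D: "(\<kappa> has_derivative D) (at p)" by (rule real_analytic_at_plane_has_derivative)
  have "((\<lambda>q. fst (\<kappa> q)) has_derivative (\<lambda>h. fst (D h))) (at p)"
    by (rule bounded_linear.has_derivative[OF bounded_linear_fst D])
  from fun_cong[OF has_derivative_unique[OF this d(1)], of h] have "fst (D h) = 0" using d(2) by simp
  then show ?thesis unfolding tangent_line_def using \<kappa> D by blast
qed

text \<open>First components of foliated charts are first integrals. Those of F and G form
  coordinates because F and G are transversal; in these coordinates the first integral of H has both
  partial derivatives nonzero, since H is transversal to G and to F.\<close>

lemma ex_normal_form:
  assumes web: "planar_3web_on U (F, G, H)" and M: "M \<in> U"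
  shows "\<exists>\<psi> g. normal_form M (F, G, H) \<psi> g"
proof -
  have fol: "foliation_on U F" "foliation_on U G" "foliation_on U H"
    and trans: "transversal_on U F G" "transversal_on U G H" "transversal_on U F H"
    using web by simp_all
  obtain V1 \<kappa>1 where V1: "M \<in> V1" "foliated_chart F V1 \<kappa>1" using fol(1) M unfolding foliation_on_def by blast
  obtain V2 \<kappa>2 where V2: "M \<in> V2" "foliated_chart G V2 \<kappa>2" using fol(2) M unfolding foliation_on_def by blast
  obtain V3 \<kappa>3 where V3: "M \<in> V3" "foliated_chart H V3 \<kappa>3" using fol(3) M unfolding foliation_on_def by blast
  have d: "analytic_diffeo_on \<kappa>1 V1" "analytic_diffeo_on \<kappa>2 V2" "analytic_diffeo_on \<kappa>3 V3"
    using V1 V2 V3 by (simp_all add: foliated_chart_def)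
  have lev: "restrict_foliation F V1 = level_foliation (fst \<circ> \<kappa>1) V1" "restrict_foliation G V2 = level_foliation (fst \<circ> \<kappa>2) V2"
      "restrict_foliation H V3 = level_foliation (fst \<circ> \<kappa>3) V3"
    using V1 V2 V3 by (simp_all add: foliated_chart_def)
  have ra\<kappa>: "real_analytic_at (\<lambda>q. fst (\<kappa>1 q)) M" "real_analytic_at (\<lambda>q. fst (\<kappa>2 q)) M" "real_analytic_at (\<lambda>q. fst (\<kappa>3 q)) M"
    using analytic_diffeo_onD(6)[OF d(1) V1(1)] analytic_diffeo_onD(6)[OF d(2) V2(1)] analytic_diffeo_onD(6)[OF d(3) V3(1)]
    by (simp_all add: real_analytic_at_plane_iff)
  define u v w where "u p = fst (\<kappa>1 p) - fst (\<kappa>1 M)" and "v p = fst (\<kappa>2 p) - fst (\<kappa>2 M)"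
    and "w p = fst (\<kappa>3 p) - fst (\<kappa>3 M)" for p
  have rau: "real_analytic_at u M" "real_analytic_at v M" "real_analytic_at w M"
    unfolding u_def[abs_def] v_def[abs_def] w_def[abs_def]
    by (intro real_analytic_at_diff ra\<kappa> real_analytic_at_const)+
  have M0: "u M = 0" "v M = 0" "w M = 0" by (simp_all add: u_def v_def w_def)
  obtain a1 b1 where du: "((\<lambda>q. fst (\<kappa>1 q)) has_derivative (\<lambda>h. a1 * fst h + b1 * snd h)) (at M)"
    using real_analytic_at_has_derivative[OF ra\<kappa>(1)] .
  obtain a2 b2 where dv: "((\<lambda>q. fst (\<kappa>2 q)) has_derivative (\<lambda>h. a2 * fst h + b2 * snd h)) (at M)"
    using real_analytic_at_has_derivative[OF ra\<kappa>(2)] .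
  obtain a3 b3 where dw: "((\<lambda>q. fst (\<kappa>3 q)) has_derivative (\<lambda>h. a3 * fst h + b3 * snd h)) (at M)"
    using real_analytic_at_has_derivative[OF ra\<kappa>(3)] .
  note ker = kernel_subset_tangent_line[OF V1(2,1) du] kernel_subset_tangent_line[OF V2(2,1) dv]
    kernel_subset_tangent_line[OF V3(2,1) dw]
  have t: "tangent_line F M \<inter> tangent_line G M = {0}" "tangent_line G M \<inter> tangent_line H M = {0}"
     "tangent_line F M \<inter> tangent_line H M = {0}"
    using trans M by (simp_all add: transversal_on_def)
  have du': "(u has_derivative (\<lambda>h. a1 * fst h + b1 * snd h)) (at M)"
    and dv': "(v has_derivative (\<lambda>h. a2 * fst h + b2 * snd h)) (at M)"
    and dw': "(w has_derivative (\<lambda>h. a3 * fst h + b3 * snd h)) (at M)"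
    unfolding u_def[abs_def] v_def[abs_def] w_def[abs_def]
    using has_derivative_diff[OF du has_derivative_const] has_derivative_diff[OF dv has_derivative_const]
      has_derivative_diff[OF dw has_derivative_const] by simp_all
  define \<psi>0 where "\<psi>0 p = (u p, v p)" for p
  have ra\<psi>0: "real_analytic_at \<psi>0 M" unfolding \<psi>0_def[abs_def] by (rule real_analytic_at_Pair[OF rau(1,2)])
  have d\<psi>0: "(\<psi>0 has_derivative (\<lambda>h. (a1 * fst h + b1 * snd h, a2 * fst h + b2 * snd h))) (at M)"
    unfolding \<psi>0_def[abs_def] by (rule has_derivative_Pair[OF du' dv'])
  have inj\<psi>0: "k = 0" if "(a1 * fst k + b1 * snd k, a2 * fst k + b2 * snd k) = 0" for k
  proof -
    have "a1 * fst k + b1 * snd k = 0" "a2 * fst k + b2 * snd k = 0" using that by (simp_all add: zero_prod_def)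
    then show ?thesis using ker(1,2) t(1) by blast
  qed
  have o1: "open (V1 \<inter> (V2 \<inter> V3))" using d analytic_diffeo_onD(1) by blast
  have o2: "M \<in> V1 \<inter> (V2 \<inter> V3)" using V1 V2 V3 by simp
  obtain A0 where A0: "M \<in> A0" "A0 \<subseteq> V1 \<inter> (V2 \<inter> V3)" "analytic_diffeo_on \<psi>0 A0"
    by (rule analytic_diffeo_on_nearby[OF ra\<psi>0 d\<psi>0 inj\<psi>0 o1 o2])
  note D0 = analytic_diffeo_onD[OF A0(3)]
  define i0 where "i0 = inv_into A0 \<psi>0"
  have \<psi>0M: "\<psi>0 M = (0, 0)" by (simp add: \<psi>0_def M0)
  have i0: "i0 (\<psi>0 p) = p" if "p \<in> A0" for p unfolding i0_def using D0(3) that by (rule inv_into_f_f)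
  have i00: "i0 (0, 0) = M" using i0[OF A0(1)] \<psi>0M by simp
  have ra_i0: "real_analytic_at i0 (0, 0)" using D0(7)[OF imageI[OF A0(1)]] by (simp add: i0_def \<psi>0M)
  define h where "h q = w (i0 q)" for q
  have rah: "real_analytic_at h (0, 0)" unfolding h_def[abs_def]
    by (rule real_analytic_at_comp_plane[OF _ ra_i0]) (simp add: i00 rau)
  have h0: "h (0, 0) = 0" by (simp add: h_def i00 M0)
  obtain \<alpha> \<beta> where dh: "(h has_derivative (\<lambda>k. \<alpha> * fst k + \<beta> * snd k)) (at (0, 0))"
    using real_analytic_at_has_derivative[OF rah] .
  obtain E where E: "(inv_into A0 \<psi>0 has_derivative E) (at (\<psi>0 M))"
    "\<forall>k. (a1 * fst (E k) + b1 * snd (E k), a2 * fst (E k) + b2 * snd (E k)) = k"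
    using analytic_diffeo_on_inv_has_derivative[OF A0(3,1) d\<psi>0] .
  have dwE: "\<alpha> * fst k + \<beta> * snd k = a3 * fst (E k) + b3 * snd (E k)" for k
  proof -
    have "(i0 has_derivative E) (at (0, 0))" using E(1) by (simp add: i0_def \<psi>0M)
    then have "(h has_derivative (\<lambda>k. a3 * fst (E k) + b3 * snd (E k))) (at (0, 0))"
      unfolding h_def[abs_def] by (rule has_derivative_compose) (simp add: i00 dw')
    from fun_cong[OF has_derivative_unique[OF dh this], of k] show ?thesis .
  qed
  \<comment> \<open>\<open>E (1, 0)\<close> is killed by the differential of v and hence tangent to
    G; in the same way \<open>E (0, 1)\<close> is tangent to F. If \<alpha> or \<beta> were zero,
    the respective vector would be tangent to H as well.\<close>
  have E1: "a1 * fst (E (1, 0)) + b1 * snd (E (1, 0)) = 1" "a2 * fst (E (1, 0)) + b2 * snd (E (1, 0)) = 0"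
    and E2: "a1 * fst (E (0, 1)) + b1 * snd (E (0, 1)) = 0" "a2 * fst (E (0, 1)) + b2 * snd (E (0, 1)) = 1"
    using spec[OF E(2), of "(1, 0)"] spec[OF E(2), of "(0, 1)"] by simp_all
  have \<alpha>: "\<alpha> \<noteq> 0"
  proof
    assume "\<alpha> = 0"
    then have "a3 * fst (E (1, 0)) + b3 * snd (E (1, 0)) = 0" using dwE[of "(1, 0)"] by simp
    with E1(2) have "E (1, 0) = 0" using ker(2,3) t(2) by blast
    with E1(1) show False by simp
  qed
  have \<beta>: "\<beta> \<noteq> 0"
  proof
    assume "\<beta> = 0"
    then have "a3 * fst (E (0, 1)) + b3 * snd (E (0, 1)) = 0" using dwE[of "(0, 1)"] by simp
    with E2(1) have "E (0, 1) = 0" using ker(1,3) t(3) by blast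
    with E2(2) show False by simp
  qed
  obtain a b A g where
    a: "real_analytic_at (\<lambda>p. a (fst p)) (0, 0)" "a 0 = 0" "(a has_real_derivative \<alpha>) (at 0)" and
    b: "real_analytic_at (\<lambda>p. b (fst p)) (0, 0)" "b 0 = 0" "(b has_real_derivative \<beta>) (at 0)" and
    A: "real_analytic_at (\<lambda>p. A (fst p)) (0, 0)" "A 0 = 0" "(A has_real_derivative 1) (at 0)" and
    g: "real_analytic_at g (0, 0)"
    "\<forall>\<^sub>F p in nhds (0, 0). A (h p) =
       (\<lambda>(x, y). x + y + x * y * (x - y) * g (x, y)) (a (fst p), b (snd p))"
    using analytic_web_function_normal_form[OF rah h0 dh \<alpha> \<beta>] .
  obtain JA where JA: "open JA" "0 \<in> JA" "inj_on A JA" using real_analytic_local_inj[OF A(1,3)] by auto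
  obtain Ja where Ja: "open Ja" "0 \<in> Ja" "inj_on a Ja" using real_analytic_local_inj[OF a(1,3) \<alpha>] .
  obtain Jb where Jb: "open Jb" "0 \<in> Jb" "inj_on b Jb" using real_analytic_local_inj[OF b(1,3) \<beta>] .
  obtain B where B: "(0, 0) \<in> B" "analytic_diffeo_on (\<lambda>p. (a (fst p), b (snd p))) B"
    using analytic_diffeo_on_product_map[OF a(1,3) \<alpha> b(1,3) \<beta>] .
  define f where "f = (\<lambda>(x, y). x + y + x * y * (x - y) * g (x, y))"
  define \<psi> where "\<psi> p = (a (u p), b (v p))" for p
  have "\<forall>\<^sub>F p in nhds M. p \<in> A0 \<and> \<psi>0 p \<in> B \<and> u p \<in> Ja \<and> v p \<in> Jb \<and> w p \<in> JA \<and> A (h (\<psi>0 p)) = f (\<psi> p)"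
  proof (intro eventually_conj)
    show "\<forall>\<^sub>F p in nhds M. p \<in> A0" using D0(1) A0(1) by (rule eventually_nhds_in_open)
    have c\<psi>0: "isCont \<psi>0 M" by (rule real_analytic_at_plane_isCont[OF ra\<psi>0])
    show "\<forall>\<^sub>F p in nhds M. \<psi>0 p \<in> B"
      by (rule eventually_isCont_in[OF c\<psi>0 analytic_diffeo_onD(1)[OF B(2)]]) (simp add: \<psi>0M B)
    show "\<forall>\<^sub>F p in nhds M. u p \<in> Ja" "\<forall>\<^sub>F p in nhds M. v p \<in> Jb" "\<forall>\<^sub>F p in nhds M. w p \<in> JA"
      using rau[THEN real_analytic_at_imp_isCont] Ja Jb JA M0 by (auto intro!: eventually_isCont_in)
    have "\<forall>\<^sub>F p in nhds M. A (h (\<psi>0 p)) = f (a (fst (\<psi>0 p)), b (snd (\<psi>0 p)))"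
      by (rule eventually_isCont_compose[OF c\<psi>0, where R = "\<lambda>p. A (h p) = f (a (fst p), b (snd p))"])
         (simp only: \<psi>0M f_def g(2))
    then show "\<forall>\<^sub>F p in nhds M. A (h (\<psi>0 p)) = f (\<psi> p)" by (simp add: \<psi>0_def \<psi>_def)
  qed
  then obtain N where N: "open N" "M \<in> N" and NP: "\<And>p. p \<in> N \<Longrightarrow> p \<in> A0 \<and> \<psi>0 p \<in> B \<and> u p \<in> Ja \<and> v p \<in> Jb \<and> w p \<in> JA \<and> A (h (\<psi>0 p)) = f (\<psi> p)"
    unfolding eventually_nhds by blast
  have d\<psi>: "analytic_diffeo_on \<psi> N"
  proof -
    have "N \<subseteq> A0" using NP by blast
    then have "analytic_diffeo_on \<psi>0 N" by (rule analytic_diffeo_on_subset[OF A0(3) N(1)])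
    moreover have "\<psi>0 ` N \<subseteq> B" using NP by blast
    ultimately have "analytic_diffeo_on (\<lambda>p. (a (fst (\<psi>0 p)), b (snd (\<psi>0 p)))) N"
      using analytic_diffeo_on_compose[OF _ B(2)] by blast
    then show ?thesis by (simp add: \<psi>0_def \<psi>_def[abs_def])
  qed
  have NV: "N \<subseteq> V1" "N \<subseteq> V2" "N \<subseteq> V3" using NP A0(2) by blast+
  \<comment> \<open>Subtracting the value at M and composing with a locally injective function
    leaves the level sets unchanged. This covers all three passages from a chart to the normal
    coordinates.\<close>
  have level: "restrict_foliation L N = level_foliation x N"
    if L: "restrict_foliation L V = level_foliation (fst \<circ> \<kappa>) V" "N \<subseteq> V" and J: "inj_on k J"
      and x: "\<And>p. p \<in> N \<Longrightarrow> fst (\<kappa> p) - c \<in> J \<and> x p = k (fst (\<kappa> p) - c)"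
    for L V \<kappa> k J x c
  proof -
    have "level_foliation (fst \<circ> \<kappa>) N = level_foliation x N"
    proof (rule level_foliation_cong)
      fix p q assume "p \<in> N" "q \<in> N"
      then show "(fst \<circ> \<kappa>) p = (fst \<circ> \<kappa>) q \<longleftrightarrow> x p = x q"
        using x[of p] x[of q] inj_on_eq_iff[OF J] by simp
    qed
    then show ?thesis using restrict_foliation_level_subset[OF L] by simp
  qed
  have F: "restrict_foliation F N = level_foliation (fst \<circ> \<psi>) N"
    by (rule level[where c = "fst (\<kappa>1 M)", OF lev(1) NV(1) Ja(3)]) (use NP in \<open>simp add: \<psi>_def u_def\<close>)
  have G: "restrict_foliation G N = level_foliation (snd \<circ> \<psi>) N"
    by (rule level[where c = "fst (\<kappa>2 M)", OF lev(2) NV(2) Jb(3)]) (use NP in \<open>simp add: \<psi>_def v_def\<close>)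
  have H: "restrict_foliation H N = level_foliation (f \<circ> \<psi>) N"
  proof (rule level[where c = "fst (\<kappa>3 M)", OF lev(3) NV(3) JA(3)])
    fix p assume "p \<in> N"
    then show "fst (\<kappa>3 p) - fst (\<kappa>3 M) \<in> JA \<and> (f \<circ> \<psi>) p = A (fst (\<kappa>3 p) - fst (\<kappa>3 M))"
      using NP[of p] i0[of p] by (simp add: h_def w_def)
  qed
  have "local_coordinates_at M \<psi>"
    unfolding local_coordinates_at_def local_diffeo_at_def using N d\<psi> by (auto simp: \<psi>_def M0 a(2) b(2))
  moreover have "web_in_coordinates M (F, G, H) \<psi> f" using N d\<psi> F G H by auto
  ultimately show ?thesis unfolding normal_form_def f_def using g(1) by blast
qed

section \<open>Symmetries in normal form\<close>

text \<open>The quotient \<open>a x / x\<close> takes the same value at all points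
  \<open>x / 2 ^ n\<close>, and along this sequence it tends to the derivative at 0.\<close>

lemma linear_of_doubling:
  fixes a :: "real \<Rightarrow> real"
  assumes der: "(a has_real_derivative \<theta>) (at 0)" and a0: "a 0 = 0"
    and dbl: "\<And>x. \<bar>2 * x\<bar> < \<epsilon> \<Longrightarrow> a (2 * x) = 2 * a x" and x: "\<bar>x\<bar> < \<epsilon>"
  shows "a x = \<theta> * x"
proof (cases "x = 0")
  case False
  have eq: "a x = 2 ^ n * a (x / 2 ^ n)" for n
  proof (induction n)
    case (Suc n)
    have "\<bar>x / 2 ^ n\<bar> \<le> \<bar>x\<bar>"
      using mult_left_mono[of 1 "2 ^ n" "\<bar>x\<bar>"] by (simp add: abs_divide divide_le_eq)
    then have "a (2 * (x / 2 ^ Suc n)) = 2 * a (x / 2 ^ Suc n)" using x by (intro dbl) simp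
    then show ?case using Suc by simp
  qed simp
  have "(\<lambda>n. x * (1 / 2) ^ n) \<longlonglongrightarrow> x * 0"
    by (intro tendsto_mult tendsto_const LIMSEQ_power_zero) simp
  then have "filterlim (\<lambda>n. x / 2 ^ n) (at 0) sequentially"
    using False by (auto simp: filterlim_at power_divide intro!: always_eventually)
  moreover have "((\<lambda>h. a h / h) \<longlongrightarrow> \<theta>) (at 0)" using der a0 by (simp add: DERIV_def)
  ultimately have "(\<lambda>n. a (x / 2 ^ n) / (x / 2 ^ n)) \<longlonglongrightarrow> \<theta>" by (rule filterlim_compose[rotated])
  moreover have "a (x / 2 ^ n) / (x / 2 ^ n) = a x / x" for n
    using eq[of n] False by (simp add: field_simps)
  ultimately have "(\<lambda>n. a x / x) \<longlonglongrightarrow> \<theta>" by (simp only:)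
  then have "a x / x = \<theta>" by (simp add: LIMSEQ_const_iff)
  then show ?thesis using False by (simp add: field_simps)
qed (simp add: a0)

text \<open>Iteration gives \<open>g q = (\<mu>\<^sup>2) ^ n * g (\<mu> ^ n *\<^sub>R q)\<close>.
  The second factor tends to \<open>g 0\<close> and the first to 0.\<close>

lemma zero_of_contraction:
  fixes g :: "plane \<Rightarrow> real"
  assumes \<mu>: "\<bar>\<mu>\<bar> < 1" and eq: "\<And>q. q \<in> ball 0 r \<Longrightarrow> g q = \<mu>\<^sup>2 * g (\<mu> *\<^sub>R q)"
    and cont: "isCont g 0" and q: "q \<in> ball 0 r"
  shows "g q = 0"
proof -
  have *: "g q = (\<mu>\<^sup>2) ^ n * g (\<mu> ^ n *\<^sub>R q) \<and> \<mu> ^ n *\<^sub>R q \<in> ball 0 r" for n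
  proof (induction n)
    case (Suc n)
    have "g (\<mu> ^ n *\<^sub>R q) = \<mu>\<^sup>2 * g (\<mu> *\<^sub>R \<mu> ^ n *\<^sub>R q)" using Suc by (intro eq) simp
    moreover have "norm (\<mu> *\<^sub>R \<mu> ^ n *\<^sub>R q) \<le> norm (\<mu> ^ n *\<^sub>R q)"
      using \<mu> mult_right_mono[of "\<bar>\<mu>\<bar>" 1 "norm (\<mu> ^ n *\<^sub>R q)"] by (simp add: abs_mult mult.assoc)
    ultimately show ?case using Suc by (auto simp: mult_ac)
  qed (use q in simp)
  have "(\<lambda>n. \<mu> ^ n) \<longlonglongrightarrow> 0" using \<mu> by (intro LIMSEQ_power_zero) simp
  then have "(\<lambda>n. \<mu> ^ n *\<^sub>R q) \<longlonglongrightarrow> 0 *\<^sub>R q" by (intro tendsto_scaleR tendsto_const)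
  then have "(\<lambda>n. g (\<mu> ^ n *\<^sub>R q)) \<longlonglongrightarrow> g 0"
    using cont isCont_tendsto_compose[of 0 g] by simp
  moreover have "(\<lambda>n. (\<mu>\<^sup>2) ^ n) \<longlonglongrightarrow> 0" using \<mu> by (intro LIMSEQ_power_zero) (simp add: abs_square_less_1)
  ultimately have "(\<lambda>n. (\<mu>\<^sup>2) ^ n * g (\<mu> ^ n *\<^sub>R q)) \<longlonglongrightarrow> 0 * g 0" by (intro tendsto_mult)
  moreover have "(\<lambda>n. (\<mu>\<^sup>2) ^ n * g (\<mu> ^ n *\<^sub>R q)) = (\<lambda>n. g q)" using * by (intro ext) metis
  ultimately show ?thesis by (simp add: LIMSEQ_const_iff)
qed

definition web_function :: "(plane \<Rightarrow> real) \<Rightarrow> plane \<Rightarrow> real" where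
  "web_function g = (\<lambda>(x, y). x + y + x * y * (x - y) * g (x, y))"

lemma web_function_alt:
  "web_function g q = fst q + snd q + fst q * snd q * (fst q - snd q) * g q"
  by (simp add: web_function_def case_prod_unfold)

lemma real_analytic_at_web_function:
  "real_analytic_at g p \<Longrightarrow> real_analytic_at (web_function g) p"
  unfolding web_function_alt[abs_def]
  by (intro real_analytic_at_add real_analytic_at_mult real_analytic_at_diff real_analytic_at_fst real_analytic_at_snd)

text \<open>On the points off the axes and the diagonal the factor $xy(x-y)$ cancels; the remaining points
  are reached along the direction $(1, 2)$, which is transversal to all three lines.\<close>

lemma web_function_homothety:
  assumes g: "real_analytic_at g (0, 0)" and \<theta>: "\<theta> \<noteq> 0"
    and ev: "\<forall>\<^sub>F q in nhds (0, 0). web_function g (\<theta> *\<^sub>R q) = \<theta> * web_function g q"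
  shows "\<forall>\<^sub>F q in nhds (0, 0). \<theta>\<^sup>2 * g (\<theta> *\<^sub>R q) = g q"
proof -
  have "isCont (\<lambda>q :: plane. \<theta> *\<^sub>R q) (0, 0)" by (intro continuous_intros)
  then have "\<forall>\<^sub>F q in nhds (0, 0). real_analytic_at g (\<theta> *\<^sub>R q)"
    by (rule eventually_isCont_compose) (simp add: real_analytic_at_eventually[OF g])
  with ev real_analytic_at_eventually[OF g]
  have "\<forall>\<^sub>F q in nhds (0, 0). web_function g (\<theta> *\<^sub>R q) = \<theta> * web_function g q \<and>
      isCont g q \<and> isCont g (\<theta> *\<^sub>R q)"
    by eventually_elim (simp add: real_analytic_at_imp_isCont)
  then obtain S where S: "open S" "(0, 0) \<in> S" "\<And>q. q \<in> S \<Longrightarrow> web_function g (\<theta> *\<^sub>R q) = \<theta> * web_function g q \<and>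
      isCont g q \<and> isCont g (\<theta> *\<^sub>R q)"
    unfolding eventually_nhds by blast
  have "\<theta>\<^sup>2 * g (\<theta> *\<^sub>R q) = g q" if q: "q \<in> S" for q
  proof -
    define c where "c t = (fst q + t, snd q + 2 * t)" for t :: real
    have cc: "isCont c t" for t unfolding c_def[abs_def] by (intro continuous_intros)
    have c0: "c 0 = q" by (simp add: c_def)
    define k where "k t = \<theta>\<^sup>2 * g (\<theta> *\<^sub>R c t) - g (c t)" for t
    have "isCont (\<lambda>t. \<theta> *\<^sub>R c t) 0" by (intro continuous_intros cc)
    then have "isCont (\<lambda>t. g (\<theta> *\<^sub>R c t)) 0" by (rule isCont_o2) (simp add: c0 S(3)[OF q])
    moreover have "isCont (\<lambda>t. g (c t)) 0" using cc by (rule isCont_o2) (simp add: c0 S(3)[OF q])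
    ultimately have "isCont k 0" unfolding k_def[abs_def] by (intro continuous_intros)
    moreover have "\<forall>\<^sub>F t in nhds 0. t \<noteq> 0 \<longrightarrow> k t = 0"
    proof -
      have ne: "\<forall>\<^sub>F t in nhds 0. t \<noteq> 0 \<longrightarrow> t \<noteq> x" for x :: real
      proof (cases "x = 0")
        case False
        then show ?thesis using t1_space_nhds[of 0 x] by (auto elim: eventually_mono)
      qed simp
      have "\<forall>\<^sub>F t in nhds 0. c t \<in> S" using cc S(1) q by (intro eventually_isCont_in) (auto simp: c0)
      \<comment> \<open>These are the parameters at which the curve c meets the vertical axis, the
        horizontal axis and the diagonal. If q itself lies on one of the lines, the corresponding
        parameter is 0 and is excluded by t being nonzero.\<close>
      with ne[of "- fst q"] ne[of "- snd q / 2"] ne[of "fst q - snd q"] show ?thesis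
      proof eventually_elim
        case (elim t)
        show ?case
        proof
          assume t: "t \<noteq> 0"
          define x y where "x = fst q + t" and "y = snd q + 2 * t"
          have "x \<noteq> 0" "y \<noteq> 0" "x \<noteq> y" using elim t by (auto simp: x_def y_def)
          moreover have ct: "c t = (x, y)" by (simp add: c_def x_def y_def)
          have "web_function g (\<theta> *\<^sub>R (x, y)) = \<theta> * web_function g (x, y)" using S(3)[OF elim(4)] ct by simp
          \<comment> \<open>The linear part of the web function commutes with the homothety and
            cancels; the cubic factor contributes the power of \<theta>.\<close>
          then have "\<theta> * (x * y * (x - y)) * (\<theta>\<^sup>2 * g (\<theta> *\<^sub>R (x, y)) - g (x, y)) = 0"
            by (simp add: web_function_alt power2_eq_square algebra_simps)
          ultimately show "k t = 0" using \<theta> by (simp add: k_def ct)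
        qed
      qed
    qed
    ultimately have "\<forall>\<^sub>F t in nhds 0. k t = 0" by (rule eventually_nhds_zero_of_punctured)
    then have "k 0 = 0" by (rule eventually_nhds_x_imp_x)
    then show ?thesis by (simp add: k_def c0)
  qed
  then show ?thesis unfolding eventually_nhds using S(1,2) by blast
qed

lemma web_function_homothety_cases:
  assumes g: "real_analytic_at g (0, 0)" and \<theta>: "\<theta> \<noteq> 0"
    and ev: "\<forall>\<^sub>F q in nhds (0, 0). web_function g (\<theta> *\<^sub>R q) = \<theta> * web_function g q"
    and nz: "\<not> (\<forall>\<^sub>F q in nhds (0, 0). g q = 0)"
  shows "\<theta> = 1 \<or> \<theta> = - 1 \<and> (\<forall>\<^sub>F q in nhds (0, 0). g q = g (- q))"
proof -
  have eq: "\<forall>\<^sub>F q in nhds (0, 0). \<theta>\<^sup>2 * g (\<theta> *\<^sub>R q) = g q" by (rule web_function_homothety[OF g \<theta> ev])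
  then obtain r where r: "0 < r" "\<And>q. q \<in> ball 0 r \<Longrightarrow> \<theta>\<^sup>2 * g (\<theta> *\<^sub>R q) = g q"
    unfolding eventually_nhds_metric by (auto simp: zero_prod_def dist_commute)
  have cont: "isCont g 0" using real_analytic_at_imp_isCont[OF g] by (simp add: zero_prod_def)
  have contr: False if "\<bar>\<mu>\<bar> < 1" "\<And>q. q \<in> ball 0 r \<Longrightarrow> g q = \<mu>\<^sup>2 * g (\<mu> *\<^sub>R q)" for \<mu>
  proof -
    have "\<And>q. q \<in> ball 0 r \<Longrightarrow> g q = 0" by (rule zero_of_contraction[OF that cont])
    moreover have "\<forall>\<^sub>F q in nhds (0, 0). q \<in> ball (0 :: plane) r" using r(1) by (intro eventually_nhds_in_open) (auto simp: zero_prod_def)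
    ultimately have "\<forall>\<^sub>F q in nhds (0, 0). g q = 0" by (auto elim: eventually_mono)
    with nz show False ..
  qed
  have "\<not> \<bar>\<theta>\<bar> < 1" using contr[of \<theta>] r(2) by metis
  moreover have "\<not> \<bar>\<theta>\<bar> > 1"
  proof
    \<comment> \<open>Substituting the point divided by \<theta> rewrites the equation for the
      inverse homothety, which is a contraction preserving the ball.\<close>
    assume l: "\<bar>\<theta>\<bar> > 1"
    then have l': "\<bar>1 / \<theta>\<bar> < 1" by (simp add: abs_divide)
    show False
    proof (rule contr[OF l'])
      fix q :: plane assume q: "q \<in> ball 0 r"
      have "norm ((1 / \<theta>) *\<^sub>R q) \<le> norm q"
        using l' mult_right_mono[of "\<bar>1 / \<theta>\<bar>" 1 "norm q"] by simp
      then have "(1 / \<theta>) *\<^sub>R q \<in> ball 0 r" using q by simp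
      from r(2)[OF this] have "g ((1 / \<theta>) *\<^sub>R q) = \<theta>\<^sup>2 * g q" using \<theta> by simp
      then show "g q = (1 / \<theta>)\<^sup>2 * g ((1 / \<theta>) *\<^sub>R q)" using \<theta> by (simp add: power_divide)
    qed
  qed
  ultimately have "\<theta> = 1 \<or> \<theta> = - 1" by linarith
  moreover have "\<forall>\<^sub>F q in nhds (0, 0). g q = g (- q)" if "\<theta> = - 1"
    using eq that by (auto elim!: eventually_mono)
  ultimately show ?thesis by blast
qed

section \<open>Simple symmetries read in normal coordinates\<close>

lemma normal_formE:
  assumes "normal_form M (F, G, H) \<psi> g"
  obtains N where "M \<in> N" "analytic_diffeo_on \<psi> N"
    "restrict_foliation F N = level_foliation (fst \<circ> \<psi>) N"
    "restrict_foliation G N = level_foliation (snd \<circ> \<psi>) N"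
    "restrict_foliation H N = level_foliation (web_function g \<circ> \<psi>) N"
  using assms by (auto simp: normal_form_def web_function_def)

text \<open>Read in normal coordinates, the symmetry preserves equality of x, of y and of f on a
  small box. Comparing \<open>(0, y)\<close> with \<open>(y, 0)\<close> and \<open>(x, x)\<close>
  with \<open>(2 * x, 0)\<close>, which lie on common levels of f, gives the equality of the two
  components and the doubling equation.\<close>

lemma simple_symmetry_homothety:
  assumes nf: "normal_form M (F, G, H) \<psi> g" and \<phi>M: "\<phi> M = M"
    and mF: "maps_foliation_near M \<phi> F F" and mG: "maps_foliation_near M \<phi> G G" and mH: "maps_foliation_near M \<phi> H H"
  obtains \<theta> where "\<theta> \<noteq> 0" "\<forall>\<^sub>F p in nhds M. \<psi> (\<phi> p) = \<theta> *\<^sub>R \<psi> p"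
    "\<forall>\<^sub>F q in nhds (0, 0). web_function g (\<theta> *\<^sub>R q) = \<theta> * web_function g q"
proof -
  let ?f = "web_function g"
  have \<psi>M: "\<psi> M = (0, 0)" and rag: "real_analytic_at g (0, 0)"
    using nf by (simp_all add: normal_form_def local_coordinates_at_def)
  obtain N where N: "M \<in> N" "analytic_diffeo_on \<psi> N"
      "restrict_foliation F N = level_foliation (\<lambda>p. fst (\<psi> p)) N"
      "restrict_foliation G N = level_foliation (\<lambda>p. snd (\<psi> p)) N"
      "restrict_foliation H N = level_foliation (\<lambda>p. ?f (\<psi> p)) N"
    using normal_formE[OF nf, unfolded o_def] .
  note D = analytic_diffeo_onD[OF N(2)]
  obtain N1 where N1: "M \<in> N1" "analytic_diffeo_on \<phi> N1" "image \<phi> ` restrict_foliation F N1 = restrict_foliation F (\<phi> ` N1)"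
    using mF unfolding maps_foliation_near_def by blast
  obtain N2 where N2: "M \<in> N2" "analytic_diffeo_on \<phi> N2" "image \<phi> ` restrict_foliation G N2 = restrict_foliation G (\<phi> ` N2)"
    using mG unfolding maps_foliation_near_def by blast
  obtain N3 where N3: "M \<in> N3" "analytic_diffeo_on \<phi> N3" "image \<phi> ` restrict_foliation H N3 = restrict_foliation H (\<phi> ` N3)"
    using mH unfolding maps_foliation_near_def by blast
  note P = analytic_diffeo_onD[OF N1(2)]
  have \<phi>MN: "\<phi> M \<in> N" using \<phi>M N(1) by simp
  have raf: "real_analytic_at ?f (0, 0)" by (rule real_analytic_at_web_function[OF rag])
  obtain O1 where O1: "open O1" "M \<in> O1" "\<forall>p\<in>O1. \<forall>q\<in>O1. fst (\<psi> p) = fst (\<psi> q) \<longrightarrow> fst (\<psi> (\<phi> p)) = fst (\<psi> (\<phi> q))"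
    using maps_foliation_level[OF N(2,1,3) N1(2,1,3) D(1) \<phi>MN N(3)] by blast
  \<comment> \<open>The statement on leaves and values speaks of the first component of a chart;
    exchanging the coordinates puts y there.\<close>
  have ds: "analytic_diffeo_on (\<lambda>p. (snd (\<psi> p), fst (\<psi> p))) N"
    by (rule analytic_diffeo_on_compose[OF N(2) analytic_diffeo_on_swap[OF open_UNIV]]) simp
  have ls: "restrict_foliation G N = level_foliation (\<lambda>p. fst (snd (\<psi> p), fst (\<psi> p))) N" by (simp add: N(4))
  obtain O2 where O2: "open O2" "M \<in> O2" "\<forall>p\<in>O2. \<forall>q\<in>O2. snd (\<psi> p) = snd (\<psi> q) \<longrightarrow> snd (\<psi> (\<phi> p)) = snd (\<psi> (\<phi> q))"
    using maps_foliation_level[OF ds N(1) ls N2(2,1,3) D(1) \<phi>MN N(4)] by auto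
  \<comment> \<open>For the third foliation a chart is completed from its first integral: the pair
    \<open>(f, x)\<close> has an invertible differential at the origin because f has differential dx
    + dy there.\<close>
  obtain B where B: "(0, 0) \<in> B" "analytic_diffeo_on (\<lambda>q. (?f q, fst q)) B"
  proof -
    obtain c d where dg: "(g has_derivative (\<lambda>h. c * fst h + d * snd h)) (at (0, 0))"
      using real_analytic_at_has_derivative[OF rag] .
    have "(?f has_derivative (\<lambda>h. fst h + snd h)) (at (0, 0))"
      unfolding web_function_alt[abs_def]
      by (rule derivative_eq_intros dg refl | simp add: fun_eq_iff)+
    then have d: "((\<lambda>q. (?f q, fst q)) has_derivative (\<lambda>h. (fst h + snd h, fst h))) (at (0, 0))"
      by (intro has_derivative_Pair has_derivative_fst has_derivative_ident)
    have ra: "real_analytic_at (\<lambda>q. (?f q, fst q)) (0, 0)"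
      by (intro real_analytic_at_Pair raf real_analytic_at_fst)
    have inj: "k = 0" if "(fst k + snd k, fst k) = (0 :: plane)" for k :: plane
      using that by (simp add: zero_prod_def prod_eq_iff)
    show ?thesis
      by (rule analytic_diffeo_on_nearby[OF ra d inj open_UNIV UNIV_I]) (assumption, rule that)
  qed
  have oB: "open B" by (rule analytic_diffeo_onD(1)[OF B(2)])
  define N4 where "N4 = N \<inter> \<psi> -` B"
  have "open N4" unfolding N4_def using D(4,1) oB continuous_on_open_vimage by (metis Int_commute)
  then have "analytic_diffeo_on \<psi> N4" by (rule analytic_diffeo_on_subset[OF N(2)]) (simp add: N4_def)
  then have dH: "analytic_diffeo_on (\<lambda>p. (?f (\<psi> p), fst (\<psi> p))) N4"
    by (rule analytic_diffeo_on_compose[OF _ B(2)]) (auto simp: N4_def)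
  have MN4: "M \<in> N4" using N(1) \<psi>M B(1) by (simp add: N4_def)
  have lH: "restrict_foliation H N4 = level_foliation (\<lambda>p. fst (?f (\<psi> p), fst (\<psi> p))) N4"
    using restrict_foliation_level_subset[OF N(5), of N4] by (simp add: N4_def)
  obtain O3 where O3: "open O3" "M \<in> O3" "\<forall>p\<in>O3. \<forall>q\<in>O3. ?f (\<psi> p) = ?f (\<psi> q) \<longrightarrow> ?f (\<psi> (\<phi> p)) = ?f (\<psi> (\<phi> q))"
    using maps_foliation_level[OF dH MN4 lH N3(2,1,3) D(1) \<phi>MN N(5)] by auto
  have oN: "open (N1 \<inter> \<phi> -` N)" using P(4,1) D(1) continuous_on_open_vimage by (metis Int_commute)
  \<comment> \<open>All three implications hold on V, and \<phi> is injective there with image in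
    the domain of the normal coordinates.\<close>
  define V where "V = N \<inter> (O1 \<inter> O2 \<inter> O3 \<inter> (N1 \<inter> \<phi> -` N))"
  have oV: "open V" unfolding V_def by (intro open_Int D(1) O1 O2 O3 oN)
  have MV: "M \<in> V" using N N1 O1 O2 O3 \<phi>MN by (simp add: V_def)
  have VN: "V \<subseteq> N" by (simp add: V_def)
  have dV: "analytic_diffeo_on \<psi> V" by (rule analytic_diffeo_on_subset[OF N(2) oV VN])
  have "open (\<psi> ` V)" by (rule analytic_diffeo_onD(2)[OF dV])
  moreover have "(0, 0) \<in> \<psi> ` V" using imageI[OF MV, of \<psi>] \<psi>M by simp
  ultimately obtain r where r: "0 < r" "ball (0, 0) r \<subseteq> \<psi> ` V" by (rule openE)
  define \<epsilon> where "\<epsilon> = r / 2"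
  have \<epsilon>: "0 < \<epsilon>" using r by (simp add: \<epsilon>_def)
  have box: "(x, y) \<in> \<psi> ` V" if "\<bar>x\<bar> < \<epsilon>" "\<bar>y\<bar> < \<epsilon>" for x y
  proof -
    have "dist (0, 0) (x, y) \<le> \<bar>x\<bar> + \<bar>y\<bar>" using norm_Pair_le[of "- x" "- y"] by (simp add: dist_norm)
    then show ?thesis using that r(2) by (intro subsetD[OF r(2)]) (simp add: \<epsilon>_def)
  qed
  let ?i = "inv_into N \<psi>"
  \<comment> \<open>The symmetry in normal coordinates.\<close>
  define \<Theta> where "\<Theta> q = \<psi> (\<phi> (?i q))" for q
  have i: "?i q \<in> V" "\<psi> (?i q) = q" if "q \<in> \<psi> ` V" for q
  proof -
    obtain p where p: "p \<in> V" "q = \<psi> p" using \<open>q \<in> \<psi> ` V\<close> by blast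
    then have "?i q = p" using inv_into_f_f[OF D(3)] VN by blast
    then show "?i q \<in> V" "\<psi> (?i q) = q" using p by simp_all
  qed
  have i\<psi>: "?i (\<psi> p) = p" if "p \<in> N" for p using D(3) that by (rule inv_into_f_f)
  have T0: "\<Theta> (0, 0) = (0, 0)" using i\<psi>[OF N(1)] by (simp add: \<Theta>_def \<psi>M \<phi>M)
  have T1: "fst (\<Theta> q) = fst (\<Theta> q')" if "q \<in> \<psi> ` V" "q' \<in> \<psi> ` V" "fst q = fst q'" for q q'
    using bspec[OF bspec[OF O1(3)], of "?i q" "?i q'"] i[OF that(1)] i[OF that(2)] that(3) by (simp add: \<Theta>_def V_def)
  have T2: "snd (\<Theta> q) = snd (\<Theta> q')" if "q \<in> \<psi> ` V" "q' \<in> \<psi> ` V" "snd q = snd q'" for q q'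
    using bspec[OF bspec[OF O2(3)], of "?i q" "?i q'"] i[OF that(1)] i[OF that(2)] that(3) by (simp add: \<Theta>_def V_def)
  have T3: "?f (\<Theta> q) = ?f (\<Theta> q')" if "q \<in> \<psi> ` V" "q' \<in> \<psi> ` V" "?f q = ?f q'" for q q'
    using bspec[OF bspec[OF O3(3)], of "?i q" "?i q'"] i[OF that(1)] i[OF that(2)] that(3) by (simp add: \<Theta>_def V_def)
  have Tinj: "q = q'" if "q \<in> \<psi> ` V" "q' \<in> \<psi> ` V" "\<Theta> q = \<Theta> q'" for q q'
  proof -
    have V: "?i q \<in> N1" "?i q' \<in> N1" "\<phi> (?i q) \<in> N" "\<phi> (?i q') \<in> N" using i(1)[OF that(1)] i(1)[OF that(2)] by (auto simp: V_def)
    have "\<phi> (?i q) = \<phi> (?i q')" using inj_onD[OF D(3) that(3)[unfolded \<Theta>_def] V(3,4)] .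
    then have "?i q = ?i q'" by (rule inj_onD[OF P(3) _ V(1,2)])
    then show ?thesis using i(2)[OF that(1)] i(2)[OF that(2)] by metis
  qed
  define a where "a x = fst (\<Theta> (x, 0))" for x
  have Tx: "\<Theta> (x, 0) = (a x, 0)" if "\<bar>x\<bar> < \<epsilon>" for x
    using T2[of "(x, 0)" "(0, 0)"] box[of x 0] box[of 0 0] that \<epsilon> T0 by (simp add: a_def prod_eq_iff)
  have Ty: "\<Theta> (0, y) = (0, a y)" if "\<bar>y\<bar> < \<epsilon>" for y
  proof -
    have "fst (\<Theta> (0, y)) = 0" using T1[of "(0, y)" "(0, 0)"] box[of 0 y] box[of 0 0] that \<epsilon> T0 by simp
    \<comment> \<open>On both axes f is the remaining coordinate, so equality of f at the images is
      equality of the two one-variable actions.\<close>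
    moreover have "?f (\<Theta> (0, y)) = ?f (\<Theta> (y, 0))"
      using box that \<epsilon> by (intro T3) (simp_all add: web_function_alt)
    ultimately have "snd (\<Theta> (0, y)) = a y" by (simp add: Tx[OF that] web_function_alt)
    with \<open>fst (\<Theta> (0, y)) = 0\<close> show ?thesis by (simp add: prod_eq_iff)
  qed
  have T: "\<Theta> (x, y) = (a x, a y)" if "\<bar>x\<bar> < \<epsilon>" "\<bar>y\<bar> < \<epsilon>" for x y
    using T1[of "(x, y)" "(x, 0)"] T2[of "(x, y)" "(0, y)"] box that \<epsilon> Tx[of x] Ty[of y] by (simp add: prod_eq_iff)
  have dbl: "a (2 * x) = 2 * a x" if "\<bar>2 * x\<bar> < \<epsilon>" for x
  proof -
    have x: "\<bar>x\<bar> < \<epsilon>" using that by simp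
    have "?f (\<Theta> (x, x)) = ?f (\<Theta> (2 * x, 0))"
      using box[OF x x] box[OF that] \<epsilon> by (intro T3) (simp_all add: web_function_alt)
    then show ?thesis by (simp add: T[OF x x] Tx[OF that] web_function_alt)
  qed
  have a0: "a 0 = 0" by (simp add: a_def T0)
  obtain \<theta> where \<theta>: "(a has_real_derivative \<theta>) (at 0)"
  proof -
    have rai: "real_analytic_at ?i (0, 0)" using D(7)[OF imageI[OF N(1)]] by (simp add: \<psi>M)
    have iM: "?i (0, 0) = M" using i\<psi>[OF N(1)] \<psi>M by simp
    have "real_analytic_at (\<lambda>q. \<phi> (?i q)) (0, 0)"
      by (rule real_analytic_at_plane_compose[OF rai]) (simp add: iM P(6)[OF N1(1)])
    then have "real_analytic_at \<Theta> (0, 0)" unfolding \<Theta>_def[abs_def]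
      by (rule real_analytic_at_plane_compose) (simp add: iM \<phi>M D(6)[OF N(1)])
    then obtain E where E: "(\<Theta> has_derivative E) (at (0, 0))" by (rule real_analytic_at_plane_has_derivative)
    have "((\<lambda>x. (x, 0::real)) has_derivative (\<lambda>x. (x, 0))) (at 0)"
      by (intro has_derivative_Pair has_derivative_ident has_derivative_const)
    from has_derivative_compose[OF this E] have "((\<lambda>x. \<Theta> (x, 0)) has_derivative (\<lambda>x. E (x, 0))) (at 0)" .
    then have "(a has_derivative (\<lambda>x. fst (E (x, 0)))) (at 0)"
      unfolding a_def[abs_def] by (rule bounded_linear.has_derivative[OF bounded_linear_fst])
    then have "a differentiable (at 0)" unfolding differentiable_def by blast
    then show ?thesis using that real_differentiable_def by blast
  qed
  have lin: "a x = \<theta> * x" if "\<bar>x\<bar> < \<epsilon>" for x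
    using linear_of_doubling[OF \<theta> a0 dbl that] .
  have T\<theta>: "\<Theta> q = \<theta> *\<^sub>R q" if "\<bar>fst q\<bar> < \<epsilon>" "\<bar>snd q\<bar> < \<epsilon>" for q
    using T[OF that] lin[OF that(1)] lin[OF that(2)] by (simp add: prod_eq_iff)
  \<comment> \<open>A zero factor would collapse a segment of the horizontal axis, against the
    injectivity of the symmetry.\<close>
  have \<theta>0: "\<theta> \<noteq> 0"
  proof
    assume "\<theta> = 0"
    then have eq: "\<Theta> (\<epsilon> / 2, 0) = \<Theta> (0, 0)" using T\<theta>[of "(\<epsilon> / 2, 0)"] \<epsilon> T0 by (simp add: zero_prod_def)
    have "(\<epsilon> / 2, 0) = (0, 0::real)" by (rule Tinj[OF _ _ eq]) (use box \<epsilon> in simp_all)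
    then show False using \<epsilon> by simp
  qed
  have small: "\<forall>\<^sub>F q in nhds (0, 0). \<bar>fst q\<bar> < \<epsilon> \<and> \<bar>snd q\<bar> < \<epsilon> \<and> \<bar>?f q\<bar> < \<epsilon>"
  proof -
    have "isCont (\<lambda>q. (\<bar>fst q\<bar>, \<bar>snd q\<bar>, \<bar>?f q\<bar>)) (0, 0)"
      by (intro continuous_intros real_analytic_at_imp_isCont[OF raf])
    then have "\<forall>\<^sub>F q in nhds (0, 0). (\<bar>fst q\<bar>, \<bar>snd q\<bar>, \<bar>?f q\<bar>) \<in> {..<\<epsilon>} \<times> {..<\<epsilon>} \<times> {..<\<epsilon>}"
      using \<epsilon> by (intro eventually_isCont_in) (auto intro!: open_Times simp: web_function_alt)
    then show ?thesis by simp
  qed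
  show ?thesis
  proof (rule that[OF \<theta>0])
    have "isCont \<psi> M" by (rule real_analytic_at_plane_isCont[OF D(6)[OF N(1)]])
    then have "\<forall>\<^sub>F p in nhds M. \<bar>fst (\<psi> p)\<bar> < \<epsilon> \<and> \<bar>snd (\<psi> p)\<bar> < \<epsilon> \<and> \<bar>?f (\<psi> p)\<bar> < \<epsilon>"
      by (rule eventually_isCont_compose[where R = "\<lambda>q. \<bar>fst q\<bar> < \<epsilon> \<and> \<bar>snd q\<bar> < \<epsilon> \<and> \<bar>?f q\<bar> < \<epsilon>"]) (simp only: \<psi>M small)
    with eventually_nhds_in_open[OF D(1) N(1)] show "\<forall>\<^sub>F p in nhds M. \<psi> (\<phi> p) = \<theta> *\<^sub>R \<psi> p"
    proof eventually_elim
      case (elim p)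
      then show ?case using T\<theta>[of "\<psi> p"] i\<psi>[of p] by (simp add: \<Theta>_def)
    qed
    show "\<forall>\<^sub>F q in nhds (0, 0). ?f (\<theta> *\<^sub>R q) = \<theta> * ?f q"
      using small
    proof eventually_elim
      case (elim q)
      have "q \<in> \<psi> ` V" using box[of "fst q" "snd q"] elim by simp
      moreover have "(?f q, 0) \<in> \<psi> ` V" using box[of "?f q" 0] elim \<epsilon> by simp
      \<comment> \<open>The point \<open>(f q, 0)\<close> of the axis lies on the same level as q.
        There \<Theta> and f are both explicit, so the value at \<open>\<theta> *\<^sub>R q\<close>
        can be computed.\<close>
      ultimately have "?f (\<Theta> q) = ?f (\<Theta> (?f q, 0))" by (rule T3) (simp add: web_function_alt[of g "(_, 0)"])
      also have "\<Theta> q = \<theta> *\<^sub>R q" using T\<theta> elim by blast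
      also have "\<Theta> (?f q, 0) = (\<theta> * ?f q, 0)" using T\<theta>[of "(?f q, 0)"] elim \<epsilon> by simp
      also have "?f (\<theta> * ?f q, 0) = \<theta> * ?f q" by (simp add: web_function_alt[of g "(_, 0)"])
      finally show ?case .
    qed
  qed
qed

lemma flat_near_if_normal_form_zero:
  assumes nf: "normal_form M (F, G, H) \<psi> g" and zero: "\<forall>\<^sub>F q in nhds (0, 0). g q = 0"
  shows "flat_near M (F, G, H)"
proof -
  have \<psi>: "local_coordinates_at M \<psi>" and \<psi>M: "\<psi> M = (0, 0)"
    using nf by (simp_all add: normal_form_def local_coordinates_at_def)
  obtain N where N: "M \<in> N" "analytic_diffeo_on \<psi> N"
      "restrict_foliation F N = level_foliation (fst \<circ> \<psi>) N"
      "restrict_foliation G N = level_foliation (snd \<circ> \<psi>) N"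
      "restrict_foliation H N = level_foliation (web_function g \<circ> \<psi>) N"
    using normal_formE[OF nf] .
  note D = analytic_diffeo_onD[OF N(2)]
  obtain S where S: "open S" "(0, 0) \<in> S" "\<And>q. q \<in> S \<Longrightarrow> g q = 0"
    using zero unfolding eventually_nhds by blast
  define N' where "N' = N \<inter> \<psi> -` S"
  have op: "open N'" unfolding N'_def using D(4,1) S(1) continuous_on_open_vimage by (metis Int_commute)
  have sub: "N' \<subseteq> N" by (simp add: N'_def)
  have M: "M \<in> N'" using N(1) S(2) \<psi>M by (simp add: N'_def)
  have "restrict_foliation H N' = level_foliation (web_function g \<circ> \<psi>) N'"
    by (rule restrict_foliation_level_subset[OF N(5) sub])
  also have "\<dots> = level_foliation ((\<lambda>(x, y). x + y) \<circ> \<psi>) N'"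
  proof (rule level_foliation_cong)
    fix p q assume "p \<in> N'" "q \<in> N'"
    then have "g (\<psi> p) = 0" "g (\<psi> q) = 0" using S(3) by (simp_all add: N'_def)
    then show "(web_function g \<circ> \<psi>) p = (web_function g \<circ> \<psi>) q \<longleftrightarrow>
        ((\<lambda>(x, y). x + y) \<circ> \<psi>) p = ((\<lambda>(x, y). x + y) \<circ> \<psi>) q"
      by (simp add: web_function_alt case_prod_unfold)
  qed
  finally have "web_in_coordinates M (F, G, H) \<psi> (\<lambda>(x, y). x + y)"
    using M analytic_diffeo_on_subset[OF N(2) op sub] restrict_foliation_level_subset[OF N(3) sub]
      restrict_foliation_level_subset[OF N(4) sub] by auto
  with \<psi> show ?thesis unfolding flat_near_def by blast
qed

section \<open>The identity and the central symmetry\<close>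

lemma simple_symmetry_iff:
  "simple_symmetry M (F, G, H) \<phi> \<longleftrightarrow> local_diffeo_at M \<phi> \<and> \<phi> M = M \<and>
     maps_foliation_near M \<phi> F F \<and> maps_foliation_near M \<phi> G G \<and> maps_foliation_near M \<phi> H H"
  by (auto simp: simple_symmetry_def web_symmetry_def)

lemma foliation_on_Union: "foliation_on U F \<Longrightarrow> \<Union>F = U"
  unfolding foliation_on_def using partition_onD1 by blast

lemma simple_symmetry_id:
  assumes web: "planar_3web_on U (F, G, H)" and M: "M \<in> U"
  shows "simple_symmetry M (F, G, H) id"
proof -
  have fol: "foliation_on U F" "foliation_on U G" "foliation_on U H" using web by simp_all
  then have "open U" by (simp add: foliation_on_def)
  then have d: "analytic_diffeo_on id U" using analytic_diffeo_on_id by (simp add: id_def)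
  have "maps_foliation_near M id L L" if "foliation_on U L" for L
    unfolding maps_foliation_near_def using d M foliation_on_Union[OF that] by (intro exI[of _ U]) simp
  with fol d M show ?thesis unfolding simple_symmetry_iff local_diffeo_at_def by auto
qed

text \<open>The involution is the map -Id in normal coordinates. If g is even, then x, y and f are
  all odd, so equal values remain equal. A ball symmetric about the origin makes the map a bijection
  of its own domain.\<close>

lemma ex_simple_symmetry_minus:
  assumes web: "planar_3web_on U (F, G, H)" and MU: "M \<in> U" and nf: "normal_form M (F, G, H) \<psi> g"
    and even: "\<forall>\<^sub>F q in nhds (0, 0). g q = g (- q)"
  obtains \<phi> where "simple_symmetry M (F, G, H) \<phi>" "\<forall>\<^sub>F p in nhds M. \<psi> (\<phi> p) = - \<psi> p"
    "\<forall>\<^sub>F p in nhds M. \<phi> (\<phi> p) = p" "(\<phi> has_derivative (\<lambda>v. - v)) (at M)"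
proof -
  have fol: "foliation_on U F" "foliation_on U G" "foliation_on U H" using web by simp_all
  then have oU: "open U" by (simp add: foliation_on_def)
  have \<psi>M: "\<psi> M = (0, 0)" using nf by (simp add: normal_form_def local_coordinates_at_def)
  obtain N where N: "M \<in> N" "analytic_diffeo_on \<psi> N"
      "restrict_foliation F N = level_foliation (fst \<circ> \<psi>) N"
      "restrict_foliation G N = level_foliation (snd \<circ> \<psi>) N"
      "restrict_foliation H N = level_foliation (web_function g \<circ> \<psi>) N"
    using normal_formE[OF nf] .
  note D = analytic_diffeo_onD[OF N(2)]
  have "open (N \<inter> U)" using D(1) oU by blast
  then have "analytic_diffeo_on \<psi> (N \<inter> U)" by (rule analytic_diffeo_on_subset[OF N(2)]) simp
  then have o1: "open (\<psi> ` (N \<inter> U))" by (rule analytic_diffeo_onD(2))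
  obtain S where S: "open S" "(0, 0) \<in> S" "\<And>q. q \<in> S \<Longrightarrow> g q = g (- q)"
    using even unfolding eventually_nhds by blast
  have "(0, 0) \<in> \<psi> ` (N \<inter> U)" using imageI[of M "N \<inter> U" \<psi>] N(1) MU \<psi>M by simp
  then have "(0, 0) \<in> \<psi> ` (N \<inter> U) \<inter> S" using S(2) by blast
  with open_Int[OF o1 S(1)] obtain r where r: "0 < r" "ball (0, 0) r \<subseteq> \<psi> ` (N \<inter> U) \<inter> S" by (rule openE)
  define B where "B = ball (0 :: plane) r"
  have B: "B \<subseteq> \<psi> ` (N \<inter> U)" "B \<subseteq> S" "open B" "(0, 0) \<in> B" "\<And>q. q \<in> B \<Longrightarrow> - q \<in> B"
  proof -
    have eq: "ball (0, 0) r = B" by (simp add: B_def zero_prod_def)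
    show "B \<subseteq> \<psi> ` (N \<inter> U)" "B \<subseteq> S" using r(2) unfolding eq by simp_all
    show "open B" "(0, 0) \<in> B" using r(1) unfolding eq[symmetric] by simp_all
    show "- q \<in> B" if "q \<in> B" for q using that by (simp add: B_def)
  qed
  let ?i = "inv_into N \<psi>"
  define N' where "N' = N \<inter> \<psi> -` B"
  have oN': "open N'" unfolding N'_def using D(4,1) B(3) continuous_on_open_vimage by (metis Int_commute)
  have sub: "N' \<subseteq> N" by (simp add: N'_def)
  have MN': "M \<in> N'" using N(1) B(4) \<psi>M by (simp add: N'_def)
  \<comment> \<open>Staying inside U guarantees that the leaves of each foliation cover the
    neighbourhood, as a map of foliations near M demands.\<close>
  have N'U: "N' \<subseteq> U"
  proof
    fix p assume p: "p \<in> N'"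
    then obtain q where q: "q \<in> N" "q \<in> U" "\<psi> p = \<psi> q" using B(1) by (auto simp: N'_def)
    then have "p = q" using inj_onD[OF D(3) q(3)] p sub by blast
    then show "p \<in> U" using q(2) by simp
  qed
  \<comment> \<open>Conjugation of -Id by the normal coordinates.\<close>
  define \<phi> where "\<phi> p = ?i (- \<psi> p)" for p
  have im\<psi>: "- \<psi> p \<in> \<psi> ` N" if "p \<in> N'" for p
  proof -
    have "- \<psi> p \<in> B" using that by (intro B(5)) (simp add: N'_def)
    then have "- \<psi> p \<in> \<psi> ` (N \<inter> U)" by (rule subsetD[OF B(1)])
    then show ?thesis by blast
  qed
  have \<psi>\<phi>: "\<psi> (\<phi> p) = - \<psi> p" and \<phi>N': "\<phi> p \<in> N'" if p: "p \<in> N'" for p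
  proof -
    have b: "- \<psi> p \<in> B" using p B(5) by (simp add: N'_def)
    note im = im\<psi>[OF p]
    show e: "\<psi> (\<phi> p) = - \<psi> p" unfolding \<phi>_def by (rule f_inv_into_f[OF im])
    have "\<phi> p \<in> N" unfolding \<phi>_def by (rule inv_into_into[OF im])
    then show "\<phi> p \<in> N'" using e b by (simp add: N'_def)
  qed
  have \<phi>\<phi>: "\<phi> (\<phi> p) = p" if p: "p \<in> N'" for p
  proof -
    have "\<psi> (\<phi> (\<phi> p)) = \<psi> p" using \<psi>\<phi>[OF \<phi>N'[OF p]] \<psi>\<phi>[OF p] by simp
    then show ?thesis by (rule inj_onD[OF D(3) _ subsetD[OF sub \<phi>N'[OF \<phi>N'[OF p]]] subsetD[OF sub p]])
  qed
  have im: "\<phi> ` N' = N'"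
  proof
    show "N' \<subseteq> \<phi> ` N'"
    proof
      fix p assume p: "p \<in> N'"
      show "p \<in> \<phi> ` N'" by (rule image_eqI[of _ _ "\<phi> p"]) (simp_all add: \<phi>\<phi>[OF p] \<phi>N'[OF p])
    qed
  qed (use \<phi>N' in blast)
  have d: "analytic_diffeo_on \<phi> N'"
  proof -
    have "analytic_diffeo_on (\<lambda>p. - \<psi> p) N'"
      by (rule analytic_diffeo_on_compose[OF analytic_diffeo_on_subset[OF N(2) oN' sub] analytic_diffeo_on_minus[OF open_UNIV]]) simp
    then have "analytic_diffeo_on (\<lambda>p. ?i (- \<psi> p)) N'"
      by (rule analytic_diffeo_on_compose[OF _ analytic_diffeo_on_inv[OF N(2)]])
         (simp add: image_subset_iff im\<psi>)
    then show ?thesis by (simp add: \<phi>_def[abs_def])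
  qed
  have maps: "maps_foliation_near M \<phi> L L"
    if L: "foliation_on U L" "restrict_foliation L N = level_foliation u N"
      and u: "\<And>p. p \<in> N' \<Longrightarrow> u (\<phi> p) = - u p" for L and u :: "plane \<Rightarrow> real"
  proof -
    have r: "restrict_foliation L N' = level_foliation u N'" by (rule restrict_foliation_level_subset[OF L(2) sub])
    have "image \<phi> ` level_foliation u N' = level_foliation u (\<phi> ` N')"
      by (rule level_foliation_image[OF d]) (simp add: u)
    then have "image \<phi> ` restrict_foliation L N' = restrict_foliation L (\<phi> ` N')" by (simp add: r im)
    then show ?thesis unfolding maps_foliation_near_def
      using MN' N'U foliation_on_Union[OF L(1)] d by (intro exI[of _ N']) simp
  qed
  have g_even: "g (- \<psi> p) = g (\<psi> p)" if "p \<in> N'" for p using S(3)[of "\<psi> p"] that B(2) by (auto simp: N'_def)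
  have "maps_foliation_near M \<phi> F F" by (rule maps[OF fol(1) N(3)]) (simp add: \<psi>\<phi>)
  moreover have "maps_foliation_near M \<phi> G G" by (rule maps[OF fol(2) N(4)]) (simp add: \<psi>\<phi>)
  moreover have "maps_foliation_near M \<phi> H H"
    by (rule maps[OF fol(3) N(5)]) (simp add: \<psi>\<phi> g_even web_function_alt algebra_simps)
  moreover have \<phi>M: "\<phi> M = M"
  proof (rule inj_onD[OF D(3)])
    show "\<psi> (\<phi> M) = \<psi> M" using \<psi>\<phi>[OF MN'] \<psi>M by simp
  qed (use \<phi>N'[OF MN'] sub N(1) in auto)
  moreover have "local_diffeo_at M \<phi>" unfolding local_diffeo_at_def using MN' d by blast
  ultimately have sym: "simple_symmetry M (F, G, H) \<phi>" by (simp add: simple_symmetry_iff)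
  have ev: "\<forall>\<^sub>F p in nhds M. p \<in> N'" using oN' MN' by (rule eventually_nhds_in_open)
  have der: "(\<phi> has_derivative (\<lambda>v. - v)) (at M)"
  proof -
    obtain E where E: "(\<psi> has_derivative E) (at M)"
      using D(6)[OF N(1)] by (rule real_analytic_at_plane_has_derivative)
    obtain E' where E': "(?i has_derivative E') (at (\<psi> M))" "\<forall>v. E (E' v) = v" "\<forall>v. E' (E v) = v"
      using analytic_diffeo_on_inv_has_derivative[OF N(2,1) E] .
    have "((\<lambda>p. - \<psi> p) has_derivative (\<lambda>v. - E v)) (at M)" by (rule has_derivative_minus[OF E])
    then have "((\<lambda>p. ?i (- \<psi> p)) has_derivative (\<lambda>v. E' (- E v))) (at M)"
      by (rule has_derivative_compose) (use E'(1) in \<open>simp add: \<psi>M\<close>)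
    \<comment> \<open>Since -Id commutes with every linear map, conjugation leaves the linear part
      unchanged.\<close>
    moreover have "E' (- E v) = - v" for v
      using linear_neg[OF has_derivative_linear[OF E'(1)], of "E v"] spec[OF E'(3), of v] by simp
    ultimately show ?thesis by (simp add: \<phi>_def[abs_def])
  qed
  have "\<forall>\<^sub>F p in nhds M. \<psi> (\<phi> p) = - \<psi> p" using ev by eventually_elim (rule \<psi>\<phi>)
  moreover have "\<forall>\<^sub>F p in nhds M. \<phi> (\<phi> p) = p" using ev by eventually_elim (rule \<phi>\<phi>)
  ultimately show ?thesis by (rule that[OF sym _ _ der])
qed

section \<open>Germs of simple symmetries\<close>

lemma germ_eq_iff: "germ M \<phi> = germ M \<psi> \<longleftrightarrow> (\<forall>\<^sub>F p in nhds M. \<phi> p = \<psi> p)"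
proof
  assume "germ M \<phi> = germ M \<psi>"
  moreover have "\<phi> \<in> germ M \<phi>" by (simp add: germ_def)
  ultimately show "\<forall>\<^sub>F p in nhds M. \<phi> p = \<psi> p" by (simp add: germ_def)
next
  assume *: "\<forall>\<^sub>F p in nhds M. \<phi> p = \<psi> p"
  show "germ M \<phi> = germ M \<psi>"
    unfolding germ_def
  proof (intro Collect_cong iffI)
    fix \<chi>' assume "\<forall>\<^sub>F p in nhds M. \<chi>' p = \<phi> p"
    with * show "\<forall>\<^sub>F p in nhds M. \<chi>' p = \<psi> p" by eventually_elim simp
  next
    fix \<chi>' assume "\<forall>\<^sub>F p in nhds M. \<chi>' p = \<psi> p"
    with * show "\<forall>\<^sub>F p in nhds M. \<chi>' p = \<phi> p" by eventually_elim simp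
  qed
qed

lemma local_diffeo_at_isCont:
  assumes "local_diffeo_at M \<phi>"
  shows "isCont \<phi> M"
proof -
  obtain A where "M \<in> A" "analytic_diffeo_on \<phi> A" using assms unfolding local_diffeo_at_def by blast
  then show ?thesis by (intro real_analytic_at_plane_isCont analytic_diffeo_onD(6))
qed

text \<open>Both maps are continuous and fix M, so near M their values stay in a domain on which
  \<psi> is injective and can be cancelled.\<close>

lemma eventually_eq_in_coordinates:
  assumes "local_coordinates_at M \<psi>" "isCont \<phi> M" "isCont \<phi>' M" "\<phi> M = M" "\<phi>' M = M"
    and ev: "\<forall>\<^sub>F p in nhds M. \<psi> (\<phi> p) = \<psi> (\<phi>' p)"
  shows "\<forall>\<^sub>F p in nhds M. \<phi> p = \<phi>' p"
proof -
  obtain N where N: "M \<in> N" "analytic_diffeo_on \<psi> N"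
    using assms(1) unfolding local_coordinates_at_def local_diffeo_at_def by blast
  note D = analytic_diffeo_onD[OF N(2)]
  have "\<forall>\<^sub>F p in nhds M. \<phi> p \<in> N"
    by (rule eventually_isCont_in[OF assms(2) D(1)]) (simp only: assms(4) N(1))
  moreover have "\<forall>\<^sub>F p in nhds M. \<phi>' p \<in> N"
    by (rule eventually_isCont_in[OF assms(3) D(1)]) (simp only: assms(5) N(1))
  ultimately show ?thesis using ev
  proof eventually_elim
    case (elim p)
    show ?case using D(3) elim(3,1,2) by (rule inj_onD)
  qed
qed

text \<open>The normal form is arbitrary here, so the dichotomy follows from any one of them and the
  evenness criterion holds for each. The case distinction on g decides at once which alternative
  occurs, which is why the two parts of the theorem can be read off together.\<close>

lemma simple_symmetry_germs_of_normal_form: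
  assumes web: "planar_3web_on U (F, G, H)" and M: "M \<in> U" and nonflat: "\<not> flat_near M (F, G, H)"
    and nf: "normal_form M (F, G, H) \<psi> g"
  shows "if \<forall>\<^sub>F q in nhds (0, 0). g q = g (- q)
    then \<exists>\<phi>. simple_symmetry M (F, G, H) \<phi> \<and>
           simple_symmetry_germs M (F, G, H) = {germ M id, germ M \<phi>} \<and>
           germ M \<phi> \<noteq> germ M id \<and> germ M (\<phi> \<circ> \<phi>) = germ M id \<and>
           (\<phi> has_derivative (\<lambda>v. - v)) (at M)
    else simple_symmetry_germs M (F, G, H) = {germ M id}"
proof -
  let ?even = "\<forall>\<^sub>F q in nhds (0, 0). g q = g (- q)"
  have lc: "local_coordinates_at M \<psi>" and rag: "real_analytic_at g (0, 0)"
    using nf by (simp_all add: normal_form_def)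
  have nz: "\<not> (\<forall>\<^sub>F q in nhds (0, 0). g q = 0)"
    using flat_near_if_normal_form_zero[OF nf] nonflat by blast
  have id: "simple_symmetry M (F, G, H) id" by (rule simple_symmetry_id[OF web M])
  \<comment> \<open>Non-flatness enters through g not being identically zero near the origin: it
    leaves only the factors 1 and -1.\<close>
  have cases: "germ M \<phi> = germ M id \<or> ?even \<and> (\<forall>\<^sub>F p in nhds M. \<psi> (\<phi> p) = - \<psi> p)"
    if sym: "simple_symmetry M (F, G, H) \<phi>" for \<phi>
  proof -
    have \<phi>: "local_diffeo_at M \<phi>" "\<phi> M = M" "maps_foliation_near M \<phi> F F"
      "maps_foliation_near M \<phi> G G" "maps_foliation_near M \<phi> H H"
      using sym by (simp_all add: simple_symmetry_iff)
    obtain \<theta> where \<theta>: "\<theta> \<noteq> 0" "\<forall>\<^sub>F p in nhds M. \<psi> (\<phi> p) = \<theta> *\<^sub>R \<psi> p"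
      "\<forall>\<^sub>F q in nhds (0, 0). web_function g (\<theta> *\<^sub>R q) = \<theta> * web_function g q"
      using simple_symmetry_homothety[OF nf \<phi>(2-5)] .
    from web_function_homothety_cases[OF rag \<theta>(1,3) nz] show ?thesis
    proof
      assume "\<theta> = 1"
      then have ev: "\<forall>\<^sub>F p in nhds M. \<psi> (\<phi> p) = \<psi> (id p)" using \<theta>(2) by simp
      have "\<forall>\<^sub>F p in nhds M. \<phi> p = id p"
        by (rule eventually_eq_in_coordinates[OF lc local_diffeo_at_isCont[OF \<phi>(1)] _ \<phi>(2) _ ev])
           (simp_all add: id_def)
      then show ?thesis by (simp add: germ_eq_iff)
    qed (use \<theta>(2) in simp)
  qed
  show ?thesis
  proof (cases ?even)
    case True
    obtain \<phi> where \<phi>: "simple_symmetry M (F, G, H) \<phi>" "\<forall>\<^sub>F p in nhds M. \<psi> (\<phi> p) = - \<psi> p"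
      "\<forall>\<^sub>F p in nhds M. \<phi> (\<phi> p) = p" "(\<phi> has_derivative (\<lambda>v. - v)) (at M)"
      using ex_simple_symmetry_minus[OF web M nf True] .
    have uniq: "germ M \<phi>' = germ M \<phi>" if sym: "simple_symmetry M (F, G, H) \<phi>'" "\<forall>\<^sub>F p in nhds M. \<psi> (\<phi>' p) = - \<psi> p" for \<phi>'
    proof -
      have ev: "\<forall>\<^sub>F p in nhds M. \<psi> (\<phi>' p) = \<psi> (\<phi> p)" using sym(2) \<phi>(2) by eventually_elim simp
      have "\<forall>\<^sub>F p in nhds M. \<phi>' p = \<phi> p"
        by (rule eventually_eq_in_coordinates[OF lc _ _ _ _ ev])
           (use sym(1) \<phi>(1) in \<open>simp_all add: simple_symmetry_iff local_diffeo_at_isCont\<close>)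
      then show ?thesis by (simp add: germ_eq_iff)
    qed
    have "simple_symmetry_germs M (F, G, H) = {germ M id, germ M \<phi>}"
      unfolding simple_symmetry_germs_def
    proof
      show "germ M ` {\<phi>. simple_symmetry M (F, G, H) \<phi>} \<subseteq> {germ M id, germ M \<phi>}"
      proof (rule image_subsetI)
        fix \<phi>' assume "\<phi>' \<in> {\<phi>. simple_symmetry M (F, G, H) \<phi>}"
        then have sym: "simple_symmetry M (F, G, H) \<phi>'" by simp
        from cases[OF sym] show "germ M \<phi>' \<in> {germ M id, germ M \<phi>}"
          using uniq[OF sym] by (elim disjE conjE) simp_all
      qed
    qed (use id \<phi>(1) in simp)
    moreover have "germ M \<phi> \<noteq> germ M id"
    proof
      assume "germ M \<phi> = germ M id"
      then have "\<forall>\<^sub>F p in nhds M. \<phi> p = id p" by (simp add: germ_eq_iff)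
      then obtain S where S: "open S" "M \<in> S" "\<And>p. p \<in> S \<Longrightarrow> \<phi> p = id p" unfolding eventually_nhds by blast
      \<comment> \<open>A map with linear part -Id cannot agree with the identity near M, since the
        differential is unique.\<close>
      have "(\<phi> has_derivative (\<lambda>v. v)) (at M)"
        by (rule has_derivative_transform_within_open[OF has_derivative_ident S(1,2)]) (simp add: S(3))
      from fun_cong[OF has_derivative_unique[OF this \<phi>(4)], of "(1, 0)"] show False by simp
    qed
    moreover have "germ M (\<phi> \<circ> \<phi>) = germ M id" using \<phi>(3) by (simp add: germ_eq_iff)
    ultimately show ?thesis unfolding if_P[OF True] using \<phi>(1,4) by (intro exI[of _ \<phi>] conjI)
  next
    case False
    have "simple_symmetry_germs M (F, G, H) = {germ M id}"
      unfolding simple_symmetry_germs_def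
    proof
      show "germ M ` {\<phi>. simple_symmetry M (F, G, H) \<phi>} \<subseteq> {germ M id}"
        by (rule image_subsetI) (use cases False in simp)
    qed (use id in simp)
    then show ?thesis unfolding if_not_P[OF False] .
  qed
qed

text \<open>Normal coordinates are determined only up to homothety, so the criterion is asserted for
  every normal form; the existence clause guarantees that there is one to which it applies.
  Symmetries are counted as germs at M.\<close>

theorem theorem2p2:
  fixes U :: "plane set" and W :: web and M :: plane
  assumes "planar_3web_on U W" and "M \<in> U" and "\<not> flat_near M W"
  shows "(simple_symmetry_germs M W = {germ M id} \<or>
          (\<exists>\<phi>. simple_symmetry M W \<phi> \<and>
               simple_symmetry_germs M W = {germ M id, germ M \<phi>} \<and>
               germ M \<phi> \<noteq> germ M id \<and> germ M (\<phi> \<circ> \<phi>) = germ M id \<and>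
               (\<phi> has_derivative (\<lambda>v. - v)) (at M)))
       \<and> (\<exists>\<psi> g. normal_form M W \<psi> g)
       \<and> (\<forall>\<psi> g. normal_form M W \<psi> g \<longrightarrow>
            (card (simple_symmetry_germs M W) = 2 \<longleftrightarrow>
             (\<forall>\<^sub>F (x, y) in nhds (0, 0). g (x, y) = g (- x, - y))))"
proof -
  obtain F G H where W: "W = (F, G, H)" by (cases W)
  note main = simple_symmetry_germs_of_normal_form[OF assms(1)[unfolded W] assms(2) assms(3)[unfolded W]]
  have even: "(\<forall>\<^sub>F (x, y) in nhds (0, 0). g (x, y) = g (- x, - y)) \<longleftrightarrow> (\<forall>\<^sub>F q in nhds (0, 0). g q = g (- q))"
    for g :: "plane \<Rightarrow> real"
    by (simp add: case_prod_unfold uminus_prod_def)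
  have nf: "\<exists>\<psi> g. normal_form M W \<psi> g"
    using ex_normal_form[OF assms(1)[unfolded W] assms(2)] by (simp add: W)
  then obtain \<psi> g where "normal_form M W \<psi> g" by blast
  note m = main[OF this[unfolded W]]
  have alt: "simple_symmetry_germs M W = {germ M id} \<or>
          (\<exists>\<phi>. simple_symmetry M W \<phi> \<and>
               simple_symmetry_germs M W = {germ M id, germ M \<phi>} \<and>
               germ M \<phi> \<noteq> germ M id \<and> germ M (\<phi> \<circ> \<phi>) = germ M id \<and>
               (\<phi> has_derivative (\<lambda>v. - v)) (at M))"
  proof (cases "\<forall>\<^sub>F q in nhds (0, 0). g q = g (- q)")
    case True
    from m[unfolded if_P[OF True]] show ?thesis unfolding W by (rule disjI2)
  next
    case False
    from m[unfolded if_not_P[OF False]] show ?thesis unfolding W by (rule disjI1)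
  qed
  have card: "card (simple_symmetry_germs M W) = 2 \<longleftrightarrow> (\<forall>\<^sub>F q in nhds (0, 0). g q = g (- q))"
    if nf': "normal_form M W \<psi> g" for \<psi> g
  proof (cases "\<forall>\<^sub>F q in nhds (0, 0). g q = g (- q)")
    case True
    obtain \<phi> where
      "simple_symmetry_germs M W = {germ M id, germ M \<phi>}" "germ M \<phi> \<noteq> germ M id"
      using main[OF nf'[unfolded W], unfolded if_P[OF True]] unfolding W by blast
    then show ?thesis using True by simp
  next
    case False
    have "simple_symmetry_germs M W = {germ M id}"
      using main[OF nf'[unfolded W], unfolded if_not_P[OF False]] unfolding W .
    then show ?thesis using False by simp
  qed
  show ?thesis unfolding even by (intro conjI allI impI alt nf card)
qed

end
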